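(* Let $k/\mathbb{Q}$ be a finite extension with ring of integers $\mathcal{O}_k$. Let $I$ be an index set of cardinality $n\ge 2$. Let $F\in\mathcal{O}_k[Y,\mathbf{X}_I]$ be irreducible over $k(\mathbf{X}_I)$ and of total degree $D$. Define $\mathcal{L}_F=k(\mathbf{X}_I)[Y]/(F(Y,\mathbf{X}_I))$, and consider the following conditions. (I) $F$ is a strongly $n$-genuine polynomial, that is to say, $k(\mathbf{X}_I)[Y]/(F(Y,\mathbf{X}_I))$ is a strongly $n$-genuine extension of $k(\mathbf{X}_I)$. (II) For any $i_0\in I$, upon defining $I'=I\setminus\{i_0\}$, $k(\mathbf{X}_{I'})$ is integrally closed in $\mathcal{L}_F$: $\overline{k(\mathbf{X}_{I'})}\cap\mathcal{L}_F=k(\mathbf{X}_{I'})$. (III) For any $i_0\in I$, upon defining $I'=I\setminus\{i_0\}$, there exists a choice of $\mathbf{x}_{I'}\in k^{n-1}$ such that $F(Y,X_{i_0},\mathbf{x}_{I'})$ is irreducible over $\overline{k}=\overline{\mathbb{Q}}$ and has total degree equal to $\deg_{Y,X_{i_0}}F(Y,\mathbf{X}_I)$. (IV) For any $i_0\in I$, upon defining $I'=I\setminus\{i_0\}$, expand the polynomial $F(Y,\mathbf{X}_I)$ in $Y$ and $X_{i_0}$ as $F(Y,\mathbf{X}_I)=\sum_{\ell+m\le D}a_{\ell,m}(\mathbf{X}_{I'})Y^\ell X_{i_0}^m$. The Noether form $B_{\mathrm{red}}(a_{\ell,m}(\mathbf{X}_{I'}))$ is not identically zero as a polynomial in $\mathbf{X}_{I'}$.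 Then the following are equivalent: (I) $\Leftrightarrow$ (II) $\Leftrightarrow$ (III) $\Leftrightarrow$ (IV). Furthermore, for any fixed index $i_0\in I$, the following are equivalent: (II) for $i_0$ $\Leftrightarrow$ (III) for $i_0$ $\Leftrightarrow$ (IV) for $i_0$.
   Context: $\mathbf{X}_J=(X_i)_{i\in J}$ for a set of indices $J$. A finite (nontrivial) extension $M$ of $k(\mathbf{X}_I)$ is an $n$-genuine extension if every $G(Y,\mathbf{X}_I)\in k[Y,\mathbf{X}_I]$ with $M=k(\mathbf{X}_I)[Y]/(G(Y,\mathbf{X}_I))$ has nonzero degree in each $X_i$, $i\in I$. It is a strongly $n$-genuine extension if every $M'$ with $k(\mathbf{X}_I)\subsetneq M'\subset M$ is an $n$-genuine extension of $k(\mathbf{X}_I)$. A polynomial $G\in k[Y,\mathbf{X}_I]$ that is monic in $Y$ and irreducible over $k(\mathbf{X}_I)$ is a strongly $n$-genuine polynomial if $k(\mathbf{X}_I)[Y]/(G(Y,\mathbf{X}_I))$ is a strongly $n$-genuine extension of $k(\mathbf{X}_I)$. $\overline{k(\mathbf{X}_{I'})}\cap\mathcal{L}_F$ is the set of elements of $\mathcal{L}_F$ algebraic over $k(\mathbf{X}_{I'})$. $\deg_{Y,X_{i_0}}F$ is the total degree of $F$ regarded as a polynomial in $Y,X_{i_0}$ (with coefficients in $k[\mathbf{X}_{I'}]$). $F(Y,X_{i_0},\mathbf{x}_{I'})$ is the specialization $X_i\mapsto x_i$ for $i\in I'$. "(II) for $i_0$" etc. means the condition for that single index. A polynomial $f$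 is reducible over $\overline{k}$ if $f=f_1f_2$ over $\overline{k}$ with $1\le\deg f_1<\deg f$. Noether form: for each degree $D_0\ge 2$, Noether's lemma provides a finite collection of forms with integer coefficients in variables $(A_{\ell,m})_{\ell+m\le D_0}$ (referred to as "a form", and said to vanish when every form of the collection vanishes), depending only on $D_0$, such that for every $f(Y,Z)=\sum_{\ell+m\le D_0}a_{\ell,m}Y^\ell Z^m$ with coefficients in $k$, the form vanishes at $(a_{\ell,m})$ if and only if $f$ is reducible over $\overline{\mathbb{Q}}=\overline{k}$ or $\deg f<D_0$. In (IV), $B_{\mathrm{red}}$ denotes this form applied to $F$ as a polynomial in $Y,X_{i_0}$: for $\mathbf{x}_{I'}\in k^{n-1}$, $B_{\mathrm{red}}(a_{\ell,m}(\mathbf{x}_{I'}))=0$ if and only if $F(Y,X_{i_0},\mathbf{x}_{I'})$ is reducible over $\overline{\mathbb{Q}}$ or has total degree strictly less than $\deg_{Y,X_{i_0}}F$.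
   Formalization: F is also assumed to have no nonconstant factor in k[X_I]; without this the claim fails, e.g. F = X_1(Y^2 - X_1 - X_2) satisfies (I) and (II) but not (III) and (IV) for i_0 = 1. Condition (I) is read as the "that is to say" clause, without requiring F monic. *)

theory Defs
  imports
    "HOL-Library.Poly_Mapping"
    "HOL-Computational_Algebra.Polynomial_Factorial"
    "HOL-Algebra.Algebraic_Closure_Type"
begin

section \<open>Polynomials\<close>

text \<open>
  The index set \<open>I\<close> is a finite type \<open>'i\<close>, and \<open>k[X\<^sub>I]\<close> is the type of finitely supported
  functions from exponent vectors to \<open>k\<close>. Some linear order on \<open>'i\<close> is needed only for the library
  to know that this is an integral domain; no definition refers to the order.
  The ring \<open>k[Y, X\<^sub>I]\<close> is \<open>k[X\<^sub>I][Y]\<close>, that is \<open>('i, 'k) mpoly poly\<close>.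
\<close>

type_synonym ('i, 'k) mpoly = "('i \<Rightarrow>\<^sub>0 nat) \<Rightarrow>\<^sub>0 'k"

definition mpoly_eval ::
  "('c::zero \<Rightarrow> 'a::comm_ring_1) \<Rightarrow> ('v \<Rightarrow> 'a) \<Rightarrow> ('v, 'c) mpoly \<Rightarrow> 'a" where
  "mpoly_eval h x p =
     (\<Sum>t\<in>Poly_Mapping.keys p.
        h (Poly_Mapping.lookup p t) * (\<Prod>v\<in>Poly_Mapping.keys t. x v ^ Poly_Mapping.lookup t v))"

definition mpoly_vars :: "('i, 'k::zero) mpoly \<Rightarrow> 'i set" where
  "mpoly_vars p = (\<Union>t\<in>Poly_Mapping.keys p. Poly_Mapping.keys t)"

definition degree_in :: "'i \<Rightarrow> ('i, 'k::zero) mpoly poly \<Rightarrow> nat" where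
  "degree_in i G =
     Max (insert 0 {Poly_Mapping.lookup t i |t l. t \<in> Poly_Mapping.keys (Polynomial.coeff G l)})"

text \<open>
  A polynomial in two variables \<open>Y, Z\<close> over \<open>'a\<close> has type \<open>'a poly poly\<close>, with \<open>Y\<close> the outer
  variable: the coefficient of \<open>Y\<^sup>l Z\<^sup>m\<close> is \<open>coeff (coeff f l) m\<close>.
\<close>

definition coeff2 :: "'a::zero poly poly \<Rightarrow> nat \<times> nat \<Rightarrow> 'a" where
  "coeff2 f = (\<lambda>(l, m). Polynomial.coeff (Polynomial.coeff f l) m)"

definition total_degree2 :: "'a::zero poly poly \<Rightarrow> nat" where
  "total_degree2 f = Max (insert 0 {l + m |l m. coeff2 f (l, m) \<noteq> 0})"

text \<open>
  \<open>expand i F\<close> is \<open>F\<close> regarded as a polynomial in \<open>Y\<close> and \<open>X\<^sub>i\<close> with coefficients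
  \<open>a\<^bsub>l,m\<^esub>\<close> in the remaining variables: each monomial \<open>X\<^sup>t\<close> is split into its power of \<open>X\<^sub>i\<close> and the
  monomial whose exponent at \<open>i\<close> is reset to \<open>0\<close>.
\<close>

definition expand_mpoly :: "'i \<Rightarrow> ('i, 'k::comm_monoid_add) mpoly \<Rightarrow> ('i, 'k) mpoly poly" where
  "expand_mpoly i p =
     (\<Sum>t\<in>Poly_Mapping.keys p.
        Polynomial.monom
          (Poly_Mapping.single (Poly_Mapping.update i 0 t) (Poly_Mapping.lookup p t))
          (Poly_Mapping.lookup t i))"

definition expand ::
  "'i \<Rightarrow> ('i, 'k::comm_monoid_add) mpoly poly \<Rightarrow> ('i, 'k) mpoly poly poly" where
  "expand i F = map_poly (expand_mpoly i) F"

text \<open>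
  The specialization \<open>F(Y, X\<^sub>i, x\<^sub>I\<^sub>')\<close>. The value \<open>x i\<close> is irrelevant, since the coefficients of
  \<open>expand i F\<close> do not involve \<open>X\<^sub>i\<close>.
\<close>

definition specialize ::
  "'i \<Rightarrow> ('i \<Rightarrow> 'k::comm_ring_1) \<Rightarrow> ('i, 'k) mpoly poly \<Rightarrow> 'k poly poly" where
  "specialize i x F = map_poly (map_poly (mpoly_eval id x)) (expand i F)"


section \<open>Function fields and their extensions\<close>

definition number_field :: "'k::field_char_0 itself \<Rightarrow> bool" where
  "number_field _ \<longleftrightarrow> ring.finite_dimension (ring_of_type_algebra :: 'k ring) \<rat> UNIV"

type_synonym ('i, 'k) ratfun = "('i, 'k) mpoly fract"

definition ratfun_ring :: "('i::{finite,linorder}, 'k::field_char_0) ratfun ring" where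
  "ratfun_ring = ring_of_type_algebra"

text \<open>\<open>k(X\<^sub>J)\<close> as a subset of \<open>k(X\<^sub>I)\<close>\<close>

definition ratfuns_in :: "'i::{finite,linorder} set \<Rightarrow> ('i, 'k::field_char_0) ratfun set" where
  "ratfuns_in J =
     {Fraction_Field.Fract p q |p q. q \<noteq> 0 \<and> mpoly_vars p \<subseteq> J \<and> mpoly_vars q \<subseteq> J}"

text \<open>
  \<open>quot_field G\<close> is the ring \<open>k(X\<^sub>I)[Y]/(G)\<close>, whose elements are cosets of the principal ideal
  \<open>(G)\<close>, and \<open>quot_emb G\<close> its structure map from \<open>k(X\<^sub>I)\<close>. It is a field if \<open>G\<close> is irreducible
  over \<open>k(X\<^sub>I)\<close>.
\<close>

definition ratfun_poly_ring :: "('i::{finite,linorder}, 'k::field_char_0) ratfun poly ring" where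
  "ratfun_poly_ring = ring_of_type_algebra"

definition quot_field ::
  "('i::{finite,linorder}, 'k::field_char_0) mpoly poly \<Rightarrow> ('i, 'k) ratfun poly set ring" where
  "quot_field G = ratfun_poly_ring Quot (PIdl\<^bsub>ratfun_poly_ring\<^esub> (fract_poly G))"

definition quot_emb ::
  "('i::{finite,linorder}, 'k::field_char_0) mpoly poly \<Rightarrow> ('i, 'k) ratfun
     \<Rightarrow> ('i, 'k) ratfun poly set" where
  "quot_emb G a = (PIdl\<^bsub>ratfun_poly_ring\<^esub> (fract_poly G)) +>\<^bsub>ratfun_poly_ring\<^esub> [:a:]"

text \<open>An extension of \<open>k(X\<^sub>I)\<close> is a field \<open>M\<close> together with its structure map \<open>\<iota>\<close>.\<close>

definition finite_extension_of_ratfun ::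
  "('m, 'b) ring_scheme \<Rightarrow> (('i::{finite,linorder}, 'k::field_char_0) ratfun \<Rightarrow> 'm) \<Rightarrow> bool" where
  "finite_extension_of_ratfun M \<iota> \<longleftrightarrow>
     Ring.field M \<and> \<iota> \<in> ring_hom ratfun_ring M \<and>
     ring.finite_dimension M (range \<iota>) (carrier M)"

text \<open>\<open>M = k(X\<^sub>I)[Y]/(G)\<close> means that the two are isomorphic as extensions of \<open>k(X\<^sub>I)\<close>.\<close>

definition presented_by ::
  "('m, 'b) ring_scheme \<Rightarrow> (('i::{finite,linorder}, 'k::field_char_0) ratfun \<Rightarrow> 'm)
     \<Rightarrow> ('i, 'k) mpoly poly \<Rightarrow> bool" where
  "presented_by M \<iota> G \<longleftrightarrow>
     (\<exists>\<phi>\<in>ring_iso M (quot_field G). \<forall>a. \<phi> (\<iota> a) = quot_emb G a)"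

definition genuine_extension ::
  "('m, 'b) ring_scheme \<Rightarrow> (('i::{finite,linorder}, 'k::field_char_0) ratfun \<Rightarrow> 'm) \<Rightarrow> bool" where
  "genuine_extension M \<iota> \<longleftrightarrow>
     finite_extension_of_ratfun M \<iota> \<and> range \<iota> \<noteq> carrier M \<and>
     (\<forall>G. presented_by M \<iota> G \<longrightarrow> (\<forall>i. degree_in i G \<noteq> 0))"

text \<open>The condition is vacuous for the trivial extension \<open>M = k(X\<^sub>I)\<close>.\<close>

definition strongly_genuine_extension ::
  "('m, 'b) ring_scheme \<Rightarrow> (('i::{finite,linorder}, 'k::field_char_0) ratfun \<Rightarrow> 'm) \<Rightarrow> bool" where
  "strongly_genuine_extension M \<iota> \<longleftrightarrow>
     finite_extension_of_ratfun M \<iota> \<and>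
     (\<forall>M'. subfield M' M \<and> range \<iota> \<subset> M' \<longrightarrow> genuine_extension (M\<lparr>carrier := M'\<rparr>) \<iota>)"


section \<open>Reducibility and Noether forms\<close>

definition to_closure2 :: "'k::field poly poly \<Rightarrow> 'k alg_closure poly poly" where
  "to_closure2 f = map_poly (map_poly to_ac) f"

definition reducible_over_closure :: "'k::field poly poly \<Rightarrow> bool" where
  "reducible_over_closure f \<longleftrightarrow>
     (\<exists>f1 f2. to_closure2 f = f1 * f2 \<and> 1 \<le> total_degree2 f1 \<and> total_degree2 f1 < total_degree2 f)"

type_synonym coeff_form = "(nat \<times> nat, int) mpoly"

definition is_form :: "nat \<Rightarrow> coeff_form \<Rightarrow> bool" where
  "is_form D\<^sub>0 b \<longleftrightarrow>
     mpoly_vars b \<subseteq> {(l, m). l + m \<le> D\<^sub>0} \<and>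
     (\<exists>d. \<forall>t\<in>Poly_Mapping.keys b. (\<Sum>v\<in>Poly_Mapping.keys t. Poly_Mapping.lookup t v) = d)"

definition forms_vanish :: "coeff_form set \<Rightarrow> (nat \<times> nat \<Rightarrow> 'a::comm_ring_1) \<Rightarrow> bool" where
  "forms_vanish B a \<longleftrightarrow> (\<forall>b\<in>B. mpoly_eval of_int a b = 0)"

text \<open>
  The variable \<open>A\<^bsub>l,m\<^esub>\<close> of a form is the pair \<open>(l, m)\<close>, and \<open>noether_forms\<close> is the
  conclusion of Noether's lemma over \<open>k\<close> in degree \<open>D\<^sub>0\<close>. The lemma is usually stated for
  \<open>D\<^sub>0 \<ge> 2\<close>; for \<open>D\<^sub>0 = 1\<close> nothing is reducible and the two forms \<open>A\<^bsub>1,0\<^esub>\<close> and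
  \<open>A\<^bsub>0,1\<^esub>\<close> have the required property.
\<close>

definition noether_forms :: "'k::field_char_0 itself \<Rightarrow> nat \<Rightarrow> coeff_form set \<Rightarrow> bool" where
  "noether_forms _ D\<^sub>0 B \<longleftrightarrow>
     finite B \<and> (\<forall>b\<in>B. is_form D\<^sub>0 b) \<and>
     (\<forall>f :: 'k poly poly. total_degree2 f \<le> D\<^sub>0 \<longrightarrow>
        (forms_vanish B (coeff2 f) \<longleftrightarrow> reducible_over_closure f \<or> total_degree2 f < D\<^sub>0))"


section \<open>The four conditions\<close>

definition cond_I :: "('i::{finite,linorder}, 'k::field_char_0) mpoly poly \<Rightarrow> bool" where
  "cond_I F \<longleftrightarrow> strongly_genuine_extension (quot_field F) (quot_emb F)"

definition cond_II :: "'i::{finite,linorder} \<Rightarrow> ('i, 'k::field_char_0) mpoly poly \<Rightarrow> bool" where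
  "cond_II i\<^sub>0 F \<longleftrightarrow>
     (let L = quot_field F; K' = quot_emb F ` ratfuns_in (- {i\<^sub>0})
      in {z \<in> carrier L. ring.algebraic L K' z} = K')"

definition cond_III :: "'i::{finite,linorder} \<Rightarrow> ('i, 'k::field_char_0) mpoly poly \<Rightarrow> bool" where
  "cond_III i\<^sub>0 F \<longleftrightarrow>
     (\<exists>x. comm_semiring_1_class.irreducible (to_closure2 (specialize i\<^sub>0 x F)) \<and>
          total_degree2 (specialize i\<^sub>0 x F) = total_degree2 (expand i\<^sub>0 F))"

definition cond_IV ::
  "(nat \<Rightarrow> coeff_form set) \<Rightarrow> 'i::{finite,linorder} \<Rightarrow> ('i, 'k::field_char_0) mpoly poly \<Rightarrow> bool" where
  "cond_IV B i\<^sub>0 F \<longleftrightarrow>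
     \<not> forms_vanish (B (total_degree2 (expand i\<^sub>0 F))) (coeff2 (expand i\<^sub>0 F))"

end

theory Submission
  imports Defs
begin

text \<open>
  Fix an index \<open>i\<close>, write \<open>Z\<close> for \<open>X\<^sub>i\<close> and \<open>K\<close> for the field of rational functions in the
  other variables, and regard \<open>F\<close> as a polynomial in \<open>Y\<close> and \<open>Z\<close> over \<open>K\<close>. The conditions (II),
  (III) and (IV) for \<open>i\<close> all express that \<open>F\<close> stays irreducible over an algebraic closure of \<open>K\<close>,
  and the proof makes this precise by a system of linear equations, due to Ruppert and Gao,
  that detects absolute irreducibility.

  For \<open>f\<close> of total degree \<open>D\<close> in \<open>Y\<close> and \<open>Z\<close>, consider the pairs \<open>(g, h)\<close> of polynomials of
  total degree less than \<open>D\<close> for which the differential form \<open>(g dY + h dZ) / f\<close> is closed.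
  One solution is \<open>(f\<^sub>Y, f\<^sub>Z)\<close>; call \<open>f\<close> rigid if it is the only one up to scalars. If
  \<open>f = p r\<close>, the logarithmic derivative of \<open>p\<close> gives a further solution, so that rigid polynomials
  are irreducible (\<open>rigid_imp_irreducible\<close>). Conversely, let \<open>f\<close> be irreducible with \<open>f\<^sub>Y \<noteq> 0\<close>. For
  a solution \<open>(g, h)\<close> the element \<open>u = g / f\<^sub>Y\<close> of the function field of \<open>f\<close> is killed by the
  derivation that extends \<open>d/dZ\<close>, hence it is algebraic over the constants. If the field of
  constants is algebraically closed in the function field, then \<open>u\<close> is a constant \<open>c\<close> and
  \<open>(g, h) = c (f\<^sub>Y, f\<^sub>Z)\<close> (\<open>ruppert_solution_proportional\<close>). This argument is used twice: over an
  algebraically closed field (\<open>irreducible_imp_rigid\<close>), and over \<open>K\<close> itself, where (II) is exactly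
  its hypothesis (\<open>rigid_expand\<close>). To return from rational functions to polynomials one needs
  Gauss's lemma for the primitive polynomial \<open>F\<close>, hence unique factorization in \<open>k[X\<^sub>I]\<close>.

  Rigidity means that a matrix, whose entries are integers or integral linear forms in the coefficients of \<open>f\<close>,
  has trivial kernel. This property can be moved along ring homomorphisms: it holds for \<open>f\<close> if it
  holds for one image of \<open>f\<close> (\<open>rigid_reflect\<close>), and then it holds for every image under a
  homomorphism that does not kill a certain \<open>\<delta> \<noteq> 0\<close> (\<open>rigid_specialize\<close>). The two cases of
  interest are the specializations \<open>k[X\<^sub>I] \<rightarrow> k\<close>, followed by the inclusion of \<open>k\<close> into its algebraic
  closure, and the embedding of \<open>k[X\<^sub>I]\<close> into an algebraic closure \<open>E\<close> of its fraction field.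

  From (II) one gets that \<open>F\<close> is rigid over \<open>k[X\<^sub>I]\<close>, hence at some point \<open>x\<close>, and this is (III).
  From (III) one gets that \<open>F\<close> is rigid over \<open>k[X\<^sub>I]\<close>, then over \<open>E\<close>, hence irreducible over \<open>E\<close>;
  an element \<open>u\<close> of \<open>L\<^sub>F\<close> that is algebraic over \<open>K\<close> has a minimal polynomial that splits over \<open>E\<close>,
  so \<open>F\<close> divides some \<open>u - \<theta>\<close>, and \<open>u\<close> lies in \<open>K\<close>
  (\<open>alg_closed_mod_if_geometrically_rigid\<close>). This is (II). The equivalence of (III) and (IV) holds
  because a nonzero polynomial has a point where it does not vanish.

  Finally (I) is (II) for all indices. An element \<open>u\<close> of \<open>L\<^sub>F\<close> that is algebraic over \<open>K\<close>, but not in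
  \<open>K\<close>, generates a nontrivial extension of \<open>k(X\<^sub>I)\<close>; its minimal polynomial over \<open>k(X\<^sub>I)\<close> has
  coefficients in \<open>K\<close>, so after clearing denominators this extension is presented by a polynomial
  without \<open>X\<^sub>i\<close>. Conversely, the root of a polynomial without \<open>X\<^sub>i\<close> is algebraic over \<open>K\<close>.
\<close>

section \<open>Ring homomorphisms and derivations on polynomials\<close>

locale cring_hom =
  fixes \<phi> :: "'a::comm_ring_1 \<Rightarrow> 'b::comm_ring_1"
  assumes hom_add: "\<phi> (x + y) = \<phi> x + \<phi> y"
    and hom_mult: "\<phi> (x * y) = \<phi> x * \<phi> y"
    and hom_one [simp]: "\<phi> 1 = 1"
begin

lemma hom_zero [simp]: "\<phi> 0 = 0"
  using hom_add[of 0 0] by simp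

lemma hom_uminus: "\<phi> (- x) = - \<phi> x"
  using hom_add[of x "- x"] by (simp add: eq_neg_iff_add_eq_0 add.commute)

lemma hom_diff: "\<phi> (x - y) = \<phi> x - \<phi> y"
  using hom_add[of x "- y"] by (simp add: hom_uminus)

lemma hom_sum: "\<phi> (sum f A) = (\<Sum>x\<in>A. \<phi> (f x))"
  by (induction A rule: infinite_finite_induct) (auto simp: hom_add)

lemma hom_prod: "\<phi> (prod f A) = (\<Prod>x\<in>A. \<phi> (f x))"
  by (induction A rule: infinite_finite_induct) (auto simp: hom_mult)

lemma hom_power: "\<phi> (x ^ n) = \<phi> x ^ n"
  by (induction n) (auto simp: hom_mult)

lemma hom_of_nat: "\<phi> (of_nat n) = of_nat n"
  by (induction n) (auto simp: hom_add)

lemma hom_of_int: "\<phi> (of_int n) = of_int n"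
  by (cases n rule: int_diff_cases) (simp add: hom_diff hom_of_nat)

lemma hom_dvd: "x dvd y \<Longrightarrow> \<phi> x dvd \<phi> y"
  by (auto simp: hom_mult elim!: dvdE)

lemma coeff_hom: "coeff (map_poly \<phi> p) n = \<phi> (coeff p n)"
  by (simp add: coeff_map_poly)

lemma map_poly_hom_pCons: "map_poly \<phi> (pCons a p) = pCons (\<phi> a) (map_poly \<phi> p)"
  by (rule poly_eqI) (simp add: coeff_hom coeff_pCons split: nat.split)

lemma map_poly_hom_monom: "map_poly \<phi> (monom c n) = monom (\<phi> c) n"
  by (rule poly_eqI) (simp add: coeff_hom)

lemma map_poly_hom_add: "map_poly \<phi> (p + q) = map_poly \<phi> p + map_poly \<phi> q"
  by (rule poly_eqI) (simp add: coeff_hom hom_add)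

lemma map_poly_hom_mult: "map_poly \<phi> (p * q) = map_poly \<phi> p * map_poly \<phi> q"
  by (rule poly_eqI) (simp add: coeff_hom coeff_mult hom_sum hom_mult)

lemma cring_hom_map_poly: "cring_hom (map_poly \<phi>)"
  by unfold_locales (simp_all add: map_poly_hom_add map_poly_hom_mult)

lemma map_poly_hom_pcompose:
  "map_poly \<phi> (pcompose p q) = pcompose (map_poly \<phi> p) (map_poly \<phi> q)"
  by (induction p)
     (simp_all add: pcompose_pCons map_poly_hom_pCons map_poly_hom_add map_poly_hom_mult)

lemma poly_map_poly_hom: "poly (map_poly \<phi> p) (\<phi> x) = \<phi> (poly p x)"
  by (induction p) (simp_all add: map_poly_hom_pCons hom_add hom_mult)

end

lemma cring_hom_comp:
  assumes "cring_hom \<phi>" "cring_hom \<psi>"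
  shows "cring_hom (\<lambda>x. \<psi> (\<phi> x))"
proof -
  interpret a: cring_hom \<phi> by fact
  interpret b: cring_hom \<psi> by fact
  show ?thesis by unfold_locales (simp_all add: a.hom_add b.hom_add a.hom_mult b.hom_mult)
qed

lemma map_poly_hom_pderiv:
  fixes \<phi> :: "'a::idom \<Rightarrow> 'b::idom"
  assumes "cring_hom \<phi>"
  shows "map_poly \<phi> (pderiv p) = pderiv (map_poly \<phi> p)"
proof -
  interpret cring_hom \<phi> by fact
  show ?thesis by (rule poly_eqI) (simp add: coeff_hom coeff_pderiv hom_mult hom_add hom_of_nat)
qed

locale derivation =
  fixes d :: "'a::comm_ring_1 \<Rightarrow> 'a"
  assumes der_add: "d (x + y) = d x + d y"
    and der_mult: "d (x * y) = d x * y + x * d y"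
begin

lemma der_zero [simp]: "d 0 = 0"
  using der_add[of 0 0] by simp

lemma der_one [simp]: "d 1 = 0"
  using der_mult[of 1 1] by simp

lemma der_uminus: "d (- x) = - d x"
  using der_add[of x "- x"] by (simp add: eq_neg_iff_add_eq_0 add.commute)

lemma der_diff: "d (x - y) = d x - d y"
  using der_add[of x "- y"] by (simp add: der_uminus)

lemma der_sum: "d (sum f A) = (\<Sum>x\<in>A. d (f x))"
  by (induction A rule: infinite_finite_induct) (auto simp: der_add)

lemma der_of_nat: "d (of_nat n) = 0"
  by (induction n) (auto simp: der_add)

lemma coeff_der: "coeff (map_poly d p) n = d (coeff p n)"
  by (simp add: coeff_map_poly)

lemma map_poly_der_pCons: "map_poly d (pCons a p) = pCons (d a) (map_poly d p)"
  by (rule poly_eqI) (simp add: coeff_der coeff_pCons split: nat.split)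

lemma derivation_map_poly: "derivation (map_poly d)"
  by unfold_locales
     (rule poly_eqI, simp add: coeff_der der_add coeff_mult der_sum der_mult sum.distrib)+

end

lemma derivation_pderiv: "derivation (pderiv :: 'a::idom poly \<Rightarrow> 'a poly)"
  by unfold_locales (simp_all add: pderiv_add pderiv_mult)

lemma pderiv_map_poly_der:
  fixes d :: "'a::idom \<Rightarrow> 'a"
  assumes "derivation d"
  shows "pderiv (map_poly d p) = map_poly d (pderiv p)"
proof -
  interpret derivation d by fact
  show ?thesis
    by (rule poly_eqI) (simp add: coeff_der coeff_pderiv der_mult der_add der_of_nat)
qed

section \<open>Total degree in two variables\<close>

lemma coeff2_simps [simp]:
  "coeff2 0 p = (0::'a::zero)"
  "coeff2 (f + g) p = coeff2 f p + coeff2 (g::'b::comm_monoid_add poly poly) p"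
  "coeff2 (f' - g') p = coeff2 f' p - coeff2 (g'::'c::ab_group_add poly poly) p"
  "coeff2 (- g') p = - coeff2 (g'::'c::ab_group_add poly poly) p"
  by (auto simp: coeff2_def split: prod.split)

lemma coeff2_smult [simp]: "coeff2 (smult [:c:] f) p = c * coeff2 f p"
  for c :: "'a::comm_semiring_0"
  by (auto simp: coeff2_def split: prod.split)

lemma coeff2_sum: "coeff2 (sum f A) p = (\<Sum>x\<in>A. coeff2 (f x) p)"
  by (induction A rule: infinite_finite_induct) auto

lemma coeff2_eqI: "(\<And>l m. coeff2 f (l, m) = coeff2 g (l, m)) \<Longrightarrow> f = g"
  by (intro poly_eqI) (auto simp: coeff2_def)

lemma coeff2_monom: "coeff2 (monom (monom c m) l) p = (if p = (l, m) then c else 0)"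
  by (auto simp: coeff2_def split: prod.split)

lemma coeff2_mult:
  "coeff2 (f * g) (l, m) = (\<Sum>i\<le>l. \<Sum>j\<le>m. coeff2 f (i, j) * coeff2 g (l - i, m - j))"
  by (simp add: coeff2_def coeff_mult coeff_sum)

lemma finite_coeff2_support: "finite {l + m |l m. coeff2 f (l, m) \<noteq> 0}"
proof (rule finite_subset)
  show "{l + m |l m. coeff2 f (l, m) \<noteq> 0} \<subseteq>
          (\<lambda>(l, m). l + m) ` (SIGMA l:{..degree f}. {..degree (coeff f l)})"
  proof (clarify)
    fix l m assume "coeff2 f (l, m) \<noteq> 0"
    then have *: "coeff (coeff f l) m \<noteq> 0" by (simp add: coeff2_def)
    then have "coeff f l \<noteq> 0" by auto
    with * show "l + m \<in> (\<lambda>(l, m). l + m) ` (SIGMA l:{..degree f}. {..degree (coeff f l)})"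
      by (intro image_eqI[of _ _ "(l, m)"]) (auto intro: le_degree)
  qed
qed auto

lemma total_degree2_le_iff:
  "total_degree2 f \<le> n \<longleftrightarrow> (\<forall>l m. coeff2 f (l, m) \<noteq> 0 \<longrightarrow> l + m \<le> n)"
  unfolding total_degree2_def by (subst Max_le_iff) (auto simp: finite_coeff2_support)

lemma coeff2_le_total_degree2: "coeff2 f (l, m) \<noteq> 0 \<Longrightarrow> l + m \<le> total_degree2 f"
  using total_degree2_le_iff[of f "total_degree2 f"] by auto

lemma total_degree2_attained:
  assumes "f \<noteq> 0"
  obtains l m where "coeff2 f (l, m) \<noteq> 0" "l + m = total_degree2 f"
proof -
  obtain l m where lm: "coeff2 f (l, m) \<noteq> 0"
    using assms coeff2_eqI[of f 0] by auto
  have "total_degree2 f \<in> insert 0 {l + m |l m. coeff2 f (l, m) \<noteq> 0}"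
    unfolding total_degree2_def by (rule Max_in) (auto simp: finite_coeff2_support)
  then show ?thesis
    using that lm coeff2_le_total_degree2[OF lm] by fastforce
qed

text \<open>
  Among the monomials of top total degree in \<open>f\<close> and in \<open>g\<close> take those with the largest power of
  \<open>Y\<close>. Their product cannot cancel, since no other pair of monomials contributes to it.
\<close>

lemma total_degree2_mult:
  fixes f g :: "'a::idom poly poly"
  assumes "f \<noteq> 0" "g \<noteq> 0"
  shows "total_degree2 (f * g) = total_degree2 f + total_degree2 g"
proof (rule antisym)
  show "total_degree2 (f * g) \<le> total_degree2 f + total_degree2 g"
    unfolding total_degree2_le_iff
  proof (intro allI impI)
    fix l m assume "coeff2 (f * g) (l, m) \<noteq> 0"
    then have "(\<Sum>i\<le>l. \<Sum>j\<le>m. coeff2 f (i, j) * coeff2 g (l - i, m - j)) \<noteq> 0"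
      by (simp add: coeff2_mult)
    then obtain i where i: "i \<le> l" "(\<Sum>j\<le>m. coeff2 f (i, j) * coeff2 g (l - i, m - j)) \<noteq> 0"
      by (meson atMost_iff sum.neutral)
    then obtain j where j: "j \<le> m" "coeff2 f (i, j) * coeff2 g (l - i, m - j) \<noteq> 0"
      by (meson atMost_iff sum.neutral)
    then have nz: "coeff2 f (i, j) \<noteq> 0" "coeff2 g (l - i, m - j) \<noteq> 0" by auto
    note coeff2_le_total_degree2[OF nz(1)] coeff2_le_total_degree2[OF nz(2)]
    with i j show "l + m \<le> total_degree2 f + total_degree2 g" by linarith
  qed
next
  have ex: "\<exists>l m. coeff2 h (l, m) \<noteq> 0 \<and> l + m = total_degree2 h \<and>
          (\<forall>l' m'. coeff2 h (l', m') \<noteq> 0 \<longrightarrow> l' + m' = total_degree2 h \<longrightarrow> l' \<le> l)"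
    if h0: "h \<noteq> 0" for h :: "'a poly poly"
  proof -
    let ?P = "\<lambda>l. \<exists>m. coeff2 h (l, m) \<noteq> 0 \<and> l + m = total_degree2 h"
    obtain l where l: "?P l" by (rule total_degree2_attained[OF h0]) blast
    have bound: "\<And>l. ?P l \<Longrightarrow> l \<le> total_degree2 h" by auto
    have "?P (Greatest ?P)" by (rule GreatestI_nat[of ?P, OF l bound])
    moreover have "\<And>l. ?P l \<Longrightarrow> l \<le> Greatest ?P" by (rule Greatest_le_nat[of ?P, OF _ bound])
    ultimately show ?thesis by blast
  qed
  obtain l1 m1 where 1: "coeff2 f (l1, m1) \<noteq> 0" "l1 + m1 = total_degree2 f"
    "\<And>l m. coeff2 f (l, m) \<noteq> 0 \<Longrightarrow> l + m = total_degree2 f \<Longrightarrow> l \<le> l1"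
    using ex[OF assms(1)] by blast
  obtain l2 m2 where 2: "coeff2 g (l2, m2) \<noteq> 0" "l2 + m2 = total_degree2 g"
    "\<And>l m. coeff2 g (l, m) \<noteq> 0 \<Longrightarrow> l + m = total_degree2 g \<Longrightarrow> l \<le> l2"
    using ex[OF assms(2)] by blast
  have term_eq: "coeff2 f (i, j) * coeff2 g (l1 + l2 - i, m1 + m2 - j) =
      (if j = m1 then if i = l1 then coeff2 f (l1, m1) * coeff2 g (l2, m2) else 0 else 0)"
    if le: "i \<le> l1 + l2" "j \<le> m1 + m2" for i j
  proof (cases "coeff2 f (i, j) * coeff2 g (l1 + l2 - i, m1 + m2 - j) = 0")
    case False
    then have nz: "coeff2 f (i, j) \<noteq> 0" "coeff2 g (l1 + l2 - i, m1 + m2 - j) \<noteq> 0" by auto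
    note b = coeff2_le_total_degree2[OF nz(1)] coeff2_le_total_degree2[OF nz(2)]
    have "i + j = total_degree2 f" "(l1 + l2 - i) + (m1 + m2 - j) = total_degree2 g"
      using b le 1(2) 2(2) by linarith+
    with 1(3)[OF nz(1)] 2(3)[OF nz(2)] le 1(2) have "i = l1" "j = m1" by linarith+
    then show ?thesis by simp
  next
    case True
    then show ?thesis using 1(1) 2(1) by auto
  qed
  have "coeff2 (f * g) (l1 + l2, m1 + m2) = (\<Sum>i\<le>l1 + l2. \<Sum>j\<le>m1 + m2.
      if j = m1 then if i = l1 then coeff2 f (l1, m1) * coeff2 g (l2, m2) else 0 else 0)"
    unfolding coeff2_mult by (intro sum.cong refl) (use term_eq in auto)
  also have "\<dots> = coeff2 f (l1, m1) * coeff2 g (l2, m2)"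
    by (simp add: sum.delta)
  finally have "coeff2 (f * g) (l1 + l2, m1 + m2) \<noteq> 0" using 1(1) 2(1) by simp
  from coeff2_le_total_degree2[OF this]
  show "total_degree2 f + total_degree2 g \<le> total_degree2 (f * g)"
    using 1(2) 2(2) by linarith
qed

lemma total_degree2_eq_0D:
  assumes "total_degree2 f = 0"
  shows "f = [:[:coeff2 f (0, 0):]:]"
proof (rule coeff2_eqI)
  fix l m
  show "coeff2 f (l, m) = coeff2 [:[:coeff2 f (0, 0):]:] (l, m)"
    using coeff2_le_total_degree2[of f l m] assms
    by (cases "l = 0 \<and> m = 0") (auto simp: coeff2_def coeff_pCons split: nat.split)
qed

lemma total_degree2_const [simp]: "total_degree2 [:[:c:]:] = 0"
proof -
  have "total_degree2 [:[:c:]:] \<le> 0" unfolding total_degree2_le_iff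
    by (auto simp: coeff2_def coeff_pCons split: nat.splits)
  then show ?thesis by simp
qed

lemma is_unit_poly_poly_iff:
  fixes f :: "'a::field poly poly"
  shows "f dvd 1 \<longleftrightarrow> f \<noteq> 0 \<and> total_degree2 f = 0"
proof
  assume "f dvd 1"
  then show "f \<noteq> 0 \<and> total_degree2 f = 0"
    by (auto simp: is_unit_poly_iff)
next
  assume f: "f \<noteq> 0 \<and> total_degree2 f = 0"
  then obtain c where c: "f = [:[:c:]:]" using total_degree2_eq_0D by blast
  with f show "f dvd 1" by (auto simp: is_unit_const_poly_iff dvd_field_iff)
qed

lemma dvd_imp_total_degree2_le:
  fixes f g :: "'a::idom poly poly"
  assumes "f dvd g" "g \<noteq> 0"
  shows "total_degree2 f \<le> total_degree2 g"
  using assms by (auto simp: total_degree2_mult elim!: dvdE)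

lemma irreducible_iff_no_factorization:
  fixes f :: "'a::field poly poly"
  assumes "1 \<le> total_degree2 f"
  shows "irreducible f \<longleftrightarrow>
    \<not> (\<exists>f1 f2. f = f1 * f2 \<and> 1 \<le> total_degree2 f1 \<and> total_degree2 f1 < total_degree2 f)"
proof -
  have f0: "f \<noteq> 0" using assms by (auto simp: total_degree2_def coeff2_def)
  show ?thesis
  proof (intro iffI notI)
    assume irr: "irreducible f"
      and "\<exists>f1 f2. f = f1 * f2 \<and> 1 \<le> total_degree2 f1 \<and> total_degree2 f1 < total_degree2 f"
    then obtain f1 f2 where *: "f = f1 * f2" "1 \<le> total_degree2 f1"
      "total_degree2 f1 < total_degree2 f" by blast
    from irreducibleD[OF irr *(1)] have "total_degree2 f1 = 0 \<or> total_degree2 f2 = 0"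
      by (auto simp: is_unit_poly_poly_iff)
    moreover have "total_degree2 f = total_degree2 f1 + total_degree2 f2"
      using f0 * by (auto simp: total_degree2_mult)
    ultimately show False using * by linarith
  next
    assume *: "\<not> (\<exists>f1 f2. f = f1 * f2 \<and> 1 \<le> total_degree2 f1 \<and> total_degree2 f1 < total_degree2 f)"
    show "irreducible f"
    proof (rule irreducibleI)
      show "f \<noteq> 0" by fact
      show "\<not> f dvd 1" using assms by (simp add: is_unit_poly_poly_iff)
      fix a b assume ab: "f = a * b"
      then have "a \<noteq> 0" "b \<noteq> 0" using f0 by auto
      moreover have "total_degree2 f = total_degree2 a + total_degree2 b"
        using calculation by (simp add: ab total_degree2_mult)
      moreover have "total_degree2 a = 0 \<or> total_degree2 a = total_degree2 f"
        using * ab calculation(3) by (metis One_nat_def Suc_leI le_add1 le_neq_implies_less neq0_conv)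
      ultimately show "a dvd 1 \<or> b dvd 1"
        by (auto simp: is_unit_poly_poly_iff)
    qed
  qed
qed

section \<open>Systems of linear equations over integral domains\<close>

text \<open>
  The homogeneous system with one equation for each \<open>e\<close> and one unknown for each \<open>j \<in> J\<close> has only
  the trivial solution. There may be infinitely many equations.
\<close>

definition inj_system :: "'j set \<Rightarrow> ('e \<Rightarrow> 'j \<Rightarrow> 'a::idom) \<Rightarrow> bool" where
  "inj_system J M \<longleftrightarrow> (\<forall>v. (\<forall>e. (\<Sum>j\<in>J. M e j * v j) = 0) \<longrightarrow> (\<forall>j\<in>J. v j = 0))"

lemma inj_systemD:
  "inj_system J M \<Longrightarrow> (\<And>e. (\<Sum>j\<in>J. M e j * v j) = 0) \<Longrightarrow> j \<in> J \<Longrightarrow> v j = 0"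
  by (auto simp: inj_system_def)

text \<open>
  Elimination of the unknown \<open>j0\<close> with the pivot \<open>M e0 j0\<close>, multiplied out so that it makes sense
  over a domain and commutes with ring homomorphisms.
\<close>

definition eliminate :: "'e \<Rightarrow> 'j \<Rightarrow> ('e \<Rightarrow> 'j \<Rightarrow> 'a::idom) \<Rightarrow> 'e \<Rightarrow> 'j \<Rightarrow> 'a" where
  "eliminate e0 j0 M e j = M e0 j0 * M e j - M e j0 * M e0 j"

lemma sum_eliminate:
  "(\<Sum>j\<in>J. eliminate e0 j0 M e j * v j) =
     M e0 j0 * (\<Sum>j\<in>J. M e j * v j) - M e j0 * (\<Sum>j\<in>J. M e0 j * v j)"
  by (simp add: eliminate_def left_diff_distrib sum_subtractf sum_distrib_left mult.assoc)

lemma inj_system_insert_pivot: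
  fixes M :: "'e \<Rightarrow> 'j \<Rightarrow> 'a::idom"
  assumes "finite J" "j0 \<notin> J" "inj_system (insert j0 J) M"
  obtains e0 where "M e0 j0 \<noteq> 0"
proof -
  have "\<exists>e0. M e0 j0 \<noteq> 0"
  proof (rule ccontr)
    assume *: "\<nexists>e0. M e0 j0 \<noteq> 0"
    define v :: "'j \<Rightarrow> 'a" where "v j = (if j = j0 then 1 else 0)" for j
    have "(\<Sum>j\<in>insert j0 J. M e j * v j) = 0" for e
    proof -
      have "(\<Sum>j\<in>J. M e j * v j) = 0"
        using assms(2) by (intro sum.neutral) (auto simp: v_def)
      then show ?thesis using assms(1,2) * by simp
    qed
    from inj_systemD[OF assms(3) this, of j0] have "v j0 = 0" by simp
    then have "(1 :: 'a) = 0" by (simp add: v_def)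
    then show False by simp
  qed
  with that show ?thesis by blast
qed

text \<open>
  A solution \<open>v\<close> of the eliminated system becomes a solution of the full one after multiplication
  by the pivot, with the value of the unknown \<open>j0\<close> read off from the pivot equation.
\<close>

lemma inj_system_eliminate:
  assumes "finite J" "j0 \<notin> J" "inj_system (insert j0 J) M" "M e0 j0 \<noteq> 0"
  shows "inj_system J (eliminate e0 j0 M)"
  unfolding inj_system_def
proof (intro allI impI)
  fix v assume v: "\<forall>e. (\<Sum>j\<in>J. eliminate e0 j0 M e j * v j) = 0"
  \<comment> \<open>the scaled solution, completed so that the pivot equation holds\<close>
  define w where "w j = (if j = j0 then - (\<Sum>j\<in>J. M e0 j * v j) else M e0 j0 * v j)" for j
  have w0: "w j = 0" if "j \<in> insert j0 J" for j
  proof (rule inj_systemD[OF assms(3) _ that])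
    fix e
    have "(\<Sum>j\<in>J. M e j * w j) = (\<Sum>j\<in>J. M e0 j0 * (M e j * v j))"
      using assms(2) by (intro sum.cong) (auto simp: w_def)
    then show "(\<Sum>j\<in>insert j0 J. M e j * w j) = 0"
      using assms(1,2) v[rule_format, of e]
      by (simp add: sum_eliminate sum_distrib_left) (simp add: w_def sum_distrib_left)
  qed
  show "\<forall>j\<in>J. v j = 0"
  proof
    fix j assume j: "j \<in> J"
    then have "w j = 0" "j \<noteq> j0" using w0 assms(2) by auto
    then show "v j = 0" using assms(4) by (simp add: w_def)
  qed
qed

lemma inj_system_of_eliminate:
  assumes "finite J" "j0 \<notin> J" "inj_system J (eliminate e0 j0 M)" "M e0 j0 \<noteq> 0"
  shows "inj_system (insert j0 J) M"
  unfolding inj_system_def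
proof (intro allI impI)
  fix v assume "\<forall>e. (\<Sum>j\<in>insert j0 J. M e j * v j) = 0"
  then have v: "M e j0 * v j0 = - (\<Sum>j\<in>J. M e j * v j)" for e
    using assms(1,2) by (simp add: eq_neg_iff_add_eq_0)
  have v0: "v j = 0" if "j \<in> J" for j
  proof (rule inj_systemD[OF assms(3) _ that])
    fix e
    have "M e0 j0 * (\<Sum>j\<in>J. M e j * v j) = - (M e0 j0 * (M e j0 * v j0))"
      by (simp add: v)
    moreover have "M e j0 * (\<Sum>j\<in>J. M e0 j * v j) = - (M e j0 * (M e0 j0 * v j0))"
      by (simp add: v)
    ultimately show "(\<Sum>j\<in>J. eliminate e0 j0 M e j * v j) = 0"
      by (simp add: sum_eliminate mult.left_commute)
  qed
  then have "(\<Sum>j\<in>J. M e0 j * v j) = 0" by (intro sum.neutral) auto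
  then have "v j0 = 0" using v[of e0] assms(4) by simp
  with v0 show "\<forall>j\<in>insert j0 J. v j = 0" by auto
qed

text \<open>
  Elimination of one unknown after the other: a pivot with nonzero image is nonzero itself, so an
  elimination that succeeds for the image succeeds for \<open>M\<close> with the same pivots. In terms of minors,
  a maximal minor whose image is nonzero is nonzero.
\<close>

lemma inj_system_reflect:
  fixes \<phi> :: "'a::idom \<Rightarrow> 'b::idom"
  assumes "cring_hom \<phi>" "finite J" "inj_system J (\<lambda>e j. \<phi> (M e j))"
  shows "inj_system J M"
proof -
  interpret cring_hom \<phi> by fact
  show ?thesis using assms(2,3)
  proof (induction J arbitrary: M rule: finite_induct)
    case empty
    then show ?case by (simp add: inj_system_def)
  next
    case (insert j0 J)
    obtain e0 where e0: "\<phi> (M e0 j0) \<noteq> 0"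
      using inj_system_insert_pivot[OF insert.hyps(1,2) insert.prems] by blast
    from inj_system_eliminate[OF insert.hyps(1,2) insert.prems e0]
    have "inj_system J (\<lambda>e j. \<phi> (eliminate e0 j0 M e j))"
      by (simp add: eliminate_def[abs_def] hom_diff hom_mult)
    from insert.IH[OF this] show ?case
      by (rule inj_system_of_eliminate[OF insert.hyps(1,2)]) (use e0 in auto)
  qed
qed

text \<open>
  \<open>\<delta>\<close> is the product of the pivots. A homomorphism that does not kill it carries the elimination
  for \<open>M\<close> over to the image.
\<close>

lemma inj_system_specialize:
  fixes M :: "'e \<Rightarrow> 'j \<Rightarrow> 'a::idom"
  assumes "finite J" "inj_system J M"
  shows "\<exists>\<delta>. \<delta> \<noteq> 0 \<and> (\<forall>\<phi> :: 'a \<Rightarrow> 'b::idom. cring_hom \<phi> \<longrightarrow> \<phi> \<delta> \<noteq> 0 \<longrightarrow>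
                     inj_system J (\<lambda>e j. \<phi> (M e j)))"
  using assms
proof (induction J arbitrary: M rule: finite_induct)
  case empty
  then show ?case by (intro exI[of _ 1]) (simp add: inj_system_def)
next
  case (insert j0 J)
  obtain e0 where e0: "M e0 j0 \<noteq> 0"
    using inj_system_insert_pivot[OF insert.hyps(1,2) insert.prems] by blast
  from insert.IH[OF inj_system_eliminate[OF insert.hyps(1,2) insert.prems e0]]
  obtain \<delta> where \<delta>: "\<delta> \<noteq> 0" "\<And>\<phi> :: 'a \<Rightarrow> 'b. cring_hom \<phi> \<Longrightarrow> \<phi> \<delta> \<noteq> 0 \<Longrightarrow>
      inj_system J (\<lambda>e j. \<phi> (eliminate e0 j0 M e j))" by blast
  show ?case
  proof (intro exI[of _ "M e0 j0 * \<delta>"] conjI allI impI)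
    show "M e0 j0 * \<delta> \<noteq> 0" using e0 \<delta>(1) by simp
    fix \<phi> :: "'a \<Rightarrow> 'b" assume \<phi>: "cring_hom \<phi>" "\<phi> (M e0 j0 * \<delta>) \<noteq> 0"
    interpret cring_hom \<phi> by fact
    have nz: "\<phi> (M e0 j0) \<noteq> 0" "\<phi> \<delta> \<noteq> 0" using \<phi>(2) by (auto simp: hom_mult)
    have "inj_system J (eliminate e0 j0 (\<lambda>e j. \<phi> (M e j)))"
      using \<delta>(2)[OF \<phi>(1) nz(2)] by (simp add: eliminate_def[abs_def] hom_diff hom_mult)
    then show "inj_system (insert j0 J) (\<lambda>e j. \<phi> (M e j))"
      by (rule inj_system_of_eliminate[OF insert.hyps(1,2)]) (use nz in auto)
  qed
qed

text \<open>
  Each elimination step uses up one equation, because the pivot row is eliminated to zero.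
\<close>

lemma not_inj_system_underdetermined:
  assumes "finite J" "finite E" "card E < card J" "\<And>e j. e \<notin> E \<Longrightarrow> M e j = 0"
  shows "\<not> inj_system J M"
  using assms
proof (induction J arbitrary: M E rule: finite_induct)
  case empty
  then show ?case by simp
next
  case (insert j0 J)
  show ?case
  proof
    assume inj: "inj_system (insert j0 J) M"
    obtain e0 where e0: "M e0 j0 \<noteq> 0"
      using inj_system_insert_pivot[OF insert.hyps(1,2) inj] by blast
    then have "e0 \<in> E" using insert.prems(3) by blast
    then have "card (E - {e0}) < card J"
      using insert.prems(1,2) insert.hyps card_Suc_Diff1[OF insert.prems(1) \<open>e0 \<in> E\<close>] by simp
    moreover have "eliminate e0 j0 M e j = 0" if "e \<notin> E - {e0}" for e j
      using that insert.prems(3) by (auto simp: eliminate_def)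
    ultimately have "\<not> inj_system J (eliminate e0 j0 M)"
      using insert.prems(1) by (intro insert.IH[of "E - {e0}"]) auto
    with inj_system_eliminate[OF insert.hyps(1,2) inj e0] show False by simp
  qed
qed

section \<open>The Ruppert system\<close>

text \<open>
  Up to the factor \<open>f\<^sup>2\<close> this is \<open>d (g / f) - d/dY (h / f)\<close>, so it vanishes iff the form
  \<open>(g dY + h dZ) / f\<close> is closed, where \<open>d\<close> acts as \<open>d/dZ\<close> on the coefficients. The derivation \<open>d\<close> is
  a parameter because the system occurs over polynomial rings and over fraction fields.
\<close>

definition ruppert :: "('a::idom \<Rightarrow> 'a) \<Rightarrow> 'a poly \<Rightarrow> 'a poly \<Rightarrow> 'a poly \<Rightarrow> 'a poly" where
  "ruppert d f g h = map_poly d g * f - g * map_poly d f - pderiv h * f + h * pderiv f"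

text \<open>
  The coefficient of \<open>Y\<^sup>l Z\<^sup>m\<close> in \<open>Y g + Z h\<close>. By Euler's identity it is \<open>(l + m) a\<^bsub>l,m\<^esub>\<close> for
  \<open>(g, h) = (f\<^sub>Y, f\<^sub>Z)\<close>, so for \<open>a\<^bsub>l,m\<^esub> \<noteq> 0\<close> its vanishing excludes the nonzero multiples of the
  obvious solution.
\<close>

definition euler_coeff :: "nat \<Rightarrow> nat \<Rightarrow> 'a::comm_monoid_add poly poly \<Rightarrow> 'a poly poly \<Rightarrow> 'a" where
  "euler_coeff l m g h =
     (if l = 0 then 0 else coeff2 g (l - 1, m)) + (if m = 0 then 0 else coeff2 h (l, m - 1))"

definition deg_less :: "nat \<Rightarrow> 'a::zero poly poly \<Rightarrow> bool" where
  "deg_less n f \<longleftrightarrow> (\<forall>i j. coeff2 f (i, j) \<noteq> 0 \<longrightarrow> i + j < n)"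

text \<open>
  To be used for nonconstant \<open>f\<close> of total degree \<open>l + m\<close> in which \<open>Y\<^sup>l Z\<^sup>m\<close> has a nonzero coefficient.
  Over a field of characteristic \<open>0\<close> it then says that \<open>(f\<^sub>Y, f\<^sub>Z)\<close> spans the solutions. The extra equation turns "the solution space is a line"
  into "the kernel is trivial".
\<close>

definition rigid :: "nat \<Rightarrow> nat \<Rightarrow> 'a::idom poly poly \<Rightarrow> bool" where
  "rigid l m f \<longleftrightarrow> (\<forall>g h. deg_less (l + m) g \<longrightarrow> deg_less (l + m) h \<longrightarrow>
     ruppert pderiv f g h = 0 \<longrightarrow> euler_coeff l m g h = 0 \<longrightarrow> g = 0 \<and> h = 0)"

abbreviation map_coeffs2 :: "('a::zero \<Rightarrow> 'b::zero) \<Rightarrow> 'a poly poly \<Rightarrow> 'b poly poly" where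
  "map_coeffs2 \<phi> \<equiv> map_poly (map_poly \<phi>)"

lemma (in cring_hom) coeff2_map_coeffs2: "coeff2 (map_coeffs2 \<phi> f) p = \<phi> (coeff2 f p)"
  by (cases p) (simp add: coeff2_def coeff_map_poly)

lemma (in cring_hom) cring_hom_map_coeffs2: "cring_hom (map_coeffs2 \<phi>)"
  by (intro cring_hom.cring_hom_map_poly) unfold_locales

text \<open>
  The equations of the system are indexed by \<open>None\<close> for the normalization and by \<open>Some p\<close> for the
  coefficient at \<open>p\<close> of the closedness condition.
\<close>

definition ruppert_functional ::
  "nat \<Rightarrow> nat \<Rightarrow> 'a::idom poly poly \<Rightarrow> (nat \<times> nat) option \<Rightarrow> 'a poly poly \<Rightarrow> 'a poly poly \<Rightarrow> 'a" where
  "ruppert_functional l m f e g h =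
     (case e of None \<Rightarrow> euler_coeff l m g h | Some p \<Rightarrow> coeff2 (ruppert pderiv f g h) p)"

lemma ruppert_add: "derivation d \<Longrightarrow> 
    ruppert d f (g + g') (h + h') = ruppert d f g h + ruppert d f g' h'"
proof -
  assume "derivation d"
  then interpret derivation "map_poly d" by (rule derivation.derivation_map_poly)
  show ?thesis by (simp add: ruppert_def der_add pderiv_add algebra_simps)
qed

lemma ruppert_smult_const: "derivation d \<Longrightarrow> d c = 0 \<Longrightarrow>
    ruppert d f (smult c g) (smult c h) = smult c (ruppert d f g h)"
proof -
  assume "derivation d" and c: "d c = 0"
  then interpret derivation d by simp
  have "map_poly d (smult c g) = smult c (map_poly d g)"
    by (rule poly_eqI) (simp add: coeff_der der_mult c)
  then show ?thesis
    by (simp add: ruppert_def pderiv_smult smult_add_right smult_diff_right)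
qed

lemma ruppert_functional_add:
  "ruppert_functional l m f e (g + g') (h + h') =
     ruppert_functional l m f e g h + ruppert_functional l m f e g' h'"
  by (auto simp: ruppert_functional_def euler_coeff_def ruppert_add[OF derivation_pderiv]
           split: option.split)

lemma ruppert_functional_smult:
  "ruppert_functional l m f e (smult [:c:] g) (smult [:c:] h) = c * ruppert_functional l m f e g h"
  by (auto simp: ruppert_functional_def euler_coeff_def algebra_simps
        ruppert_smult_const[OF derivation_pderiv] pderiv_pCons split: option.split)

lemma ruppert_functional_sum:
  assumes "finite J"
  shows "ruppert_functional l m f e (\<Sum>j\<in>J. smult [:v j:] (a j)) (\<Sum>j\<in>J. smult [:v j:] (b j)) =
     (\<Sum>j\<in>J. ruppert_functional l m f e (a j) (b j) * v j)"
  using assms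
proof (induction J rule: finite_induct)
  case empty
  then show ?case
    by (auto simp: ruppert_functional_def euler_coeff_def ruppert_def split: option.split)
next
  case (insert j J)
  then show ?case
    by (simp add: ruppert_functional_add ruppert_functional_smult mult.commute)
qed

text \<open>
  The coefficients of \<open>g\<close> are tagged by \<open>True\<close>, those of \<open>h\<close> by \<open>False\<close>.
\<close>

definition unknowns :: "nat \<Rightarrow> (bool \<times> nat \<times> nat) set" where
  "unknowns n = UNIV \<times> {(i, j). i + j < n}"

lemma finite_unknowns: "finite (unknowns n)"
proof -
  have "{(i, j). i + j < n} \<subseteq> {..<n} \<times> {..<n}" by auto
  then have "finite {(i, j). i + j < n}" by (rule finite_subset) simp
  then show ?thesis unfolding unknowns_def by (intro finite_cartesian_product) auto
qed

definition unknown_monom :: "bool \<Rightarrow> bool \<times> nat \<times> nat \<Rightarrow> 'a::comm_ring_1 poly poly" where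
  "unknown_monom b j = (if fst j = b then monom (monom 1 (snd (snd j))) (fst (snd j)) else 0)"

definition ruppert_matrix ::
  "nat \<Rightarrow> nat \<Rightarrow> 'a::idom poly poly \<Rightarrow> (nat \<times> nat) option \<Rightarrow> bool \<times> nat \<times> nat \<Rightarrow> 'a" where
  "ruppert_matrix l m f e j = ruppert_functional l m f e (unknown_monom True j) (unknown_monom False j)"

lemma coeff2_unknown_sum:
  "coeff2 (\<Sum>j\<in>unknowns n. smult [:v j:] (unknown_monom b j)) p =
     (if fst p + snd p < n then v (b, p) else 0)"
proof -
  have "coeff2 (\<Sum>j\<in>unknowns n. smult [:v j:] (unknown_monom b j)) p =
      (\<Sum>j\<in>unknowns n. if j = (b, p) then v j else 0)"
    unfolding coeff2_sum coeff2_smult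
    by (intro sum.cong) (auto simp: unknown_monom_def coeff2_monom)
  also have "\<dots> = (if fst p + snd p < n then v (b, p) else 0)"
    by (subst sum.delta[OF finite_unknowns]) (auto simp: unknowns_def split: prod.splits)
  finally show ?thesis .
qed

lemma deg_less_eq_unknown_sum:
  assumes "deg_less n g"
    and "\<And>p. fst p + snd p < n \<Longrightarrow> v (b, p) = coeff2 g p"
  shows "g = (\<Sum>j\<in>unknowns n. smult [:v j:] (unknown_monom b j))"
  by (rule coeff2_eqI) (use assms in \<open>auto simp: coeff2_unknown_sum deg_less_def\<close>)

lemma ruppert_functional_all_zero:
  "(\<forall>e. ruppert_functional l m f e g h = 0) \<longleftrightarrow>
     ruppert pderiv f g h = 0 \<and> euler_coeff l m g h = 0"
proof -
  have "(\<forall>e. ruppert_functional l m f e g h = 0) \<longleftrightarrow>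
     euler_coeff l m g h = 0 \<and> (\<forall>p. coeff2 (ruppert pderiv f g h) p = 0)"
    by (auto simp: ruppert_functional_def split: option.split)
  moreover have "(\<forall>p. coeff2 (ruppert pderiv f g h) p = 0) \<longleftrightarrow> ruppert pderiv f g h = 0"
    using coeff2_eqI[of "ruppert pderiv f g h" 0] by auto
  ultimately show ?thesis by auto
qed

lemma ruppert_kernel_vector:
  fixes f :: "'a::idom poly poly"
  assumes "\<And>e. (\<Sum>j\<in>unknowns (l + m). ruppert_matrix l m f e j * v j) = 0"
  obtains g h where "ruppert pderiv f g h = 0" "euler_coeff l m g h = 0"
    "deg_less (l + m) g" "deg_less (l + m) h"
    "\<And>p. coeff2 g p = (if fst p + snd p < l + m then v (True, p) else 0)"
    "\<And>p. coeff2 h p = (if fst p + snd p < l + m then v (False, p) else 0)"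
proof -
  define w where "w b = (\<Sum>j\<in>unknowns (l + m). smult [:v j:] (unknown_monom b j))" for b
  have c: "coeff2 (w b) p = (if fst p + snd p < l + m then v (b, p) else 0)" for b p
    unfolding w_def by (rule coeff2_unknown_sum)
  have "\<forall>e. ruppert_functional l m f e (w True) (w False) = 0"
    using assms unfolding w_def
    by (simp add: ruppert_functional_sum[OF finite_unknowns] ruppert_matrix_def)
  then have "ruppert pderiv f (w True) (w False) = 0" "euler_coeff l m (w True) (w False) = 0"
    unfolding ruppert_functional_all_zero by blast+
  moreover have "deg_less (l + m) (w b)" for b by (auto simp: deg_less_def c split: if_splits)
  ultimately show ?thesis using that c by blast
qed

lemma rigid_iff_inj_system:
  "rigid l m f \<longleftrightarrow> inj_system (unknowns (l + m)) (ruppert_matrix l m f)"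
proof
  assume r: "rigid l m f"
  show "inj_system (unknowns (l + m)) (ruppert_matrix l m f)"
    unfolding inj_system_def
  proof (intro allI impI ballI)
    fix v j assume v: "\<forall>e. (\<Sum>j\<in>unknowns (l + m). ruppert_matrix l m f e j * v j) = 0"
      and j: "j \<in> unknowns (l + m)"
    obtain g h where gh: "ruppert pderiv f g h = 0" "euler_coeff l m g h = 0"
      "deg_less (l + m) g" "deg_less (l + m) h"
      and c: "\<And>p. coeff2 g p = (if fst p + snd p < l + m then v (True, p) else 0)"
        "\<And>p. coeff2 h p = (if fst p + snd p < l + m then v (False, p) else 0)"
      using ruppert_kernel_vector[OF v[rule_format]] by blast
    have "g = 0" "h = 0" using r gh unfolding rigid_def by blast+
    moreover obtain b p where "j = (b, p)" "fst p + snd p < l + m"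
      using j by (auto simp: unknowns_def)
    ultimately show "v j = 0" using c(1)[of p] c(2)[of p] by (cases b) simp_all
  qed
next
  assume i: "inj_system (unknowns (l + m)) (ruppert_matrix l m f)"
  show "rigid l m f"
    unfolding rigid_def
  proof (intro allI impI)
    fix g h assume *: "deg_less (l + m) g" "deg_less (l + m) h"
      "ruppert pderiv f g h = 0" "euler_coeff l m g h = 0"
    define v where "v j = (if fst j then coeff2 g (snd j) else coeff2 h (snd j))" for j
    have g: "g = (\<Sum>j\<in>unknowns (l + m). smult [:v j:] (unknown_monom True j))"
      by (rule deg_less_eq_unknown_sum[OF *(1)]) (simp add: v_def)
    have h: "h = (\<Sum>j\<in>unknowns (l + m). smult [:v j:] (unknown_monom False j))"
      by (rule deg_less_eq_unknown_sum[OF *(2)]) (simp add: v_def)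
    have "(\<Sum>j\<in>unknowns (l + m). ruppert_matrix l m f e j * v j) = 0" for e
    proof -
      have "ruppert_functional l m f e g h = 0"
        using *(3,4) ruppert_functional_all_zero by blast
      then show ?thesis
        by (subst (asm) g, subst (asm) h)
           (simp add: ruppert_functional_sum[OF finite_unknowns] ruppert_matrix_def)
    qed
    from inj_systemD[OF i this] have z: "\<And>j. j \<in> unknowns (l + m) \<Longrightarrow> v j = 0" .
    have low: "coeff2 g (i, j) = 0 \<and> coeff2 h (i, j) = 0" if "i + j < l + m" for i j
    proof -
      have "v (True, i, j) = 0" "v (False, i, j) = 0"
        by (rule z, use that in \<open>simp add: unknowns_def\<close>)+
      then show ?thesis by (simp add: v_def)
    qed
    have "coeff2 g (i, j) = 0 \<and> coeff2 h (i, j) = 0" for i j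
      using *(1,2) low[of i j] unfolding deg_less_def by metis
    then show "g = 0 \<and> h = 0" by (auto intro!: coeff2_eqI)
  qed
qed

text \<open>
  The matrix is built from the coefficients of \<open>f\<close> by ring operations and derivatives only.
\<close>

lemma ruppert_matrix_hom:
  fixes \<phi> :: "'a::idom \<Rightarrow> 'b::idom"
  assumes "cring_hom \<phi>"
  shows "ruppert_matrix l m (map_coeffs2 \<phi> f) e j = \<phi> (ruppert_matrix l m f e j)"
proof -
  interpret cring_hom \<phi> by fact
  interpret m: cring_hom "map_poly \<phi>" by (rule cring_hom_map_poly)
  interpret mm: cring_hom "map_coeffs2 \<phi>" by (rule cring_hom_map_coeffs2)
  have um: "map_coeffs2 \<phi> (unknown_monom b j) = unknown_monom b j" for b
    by (simp add: unknown_monom_def m.map_poly_hom_monom map_poly_hom_monom)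
  have pd: "map_poly pderiv (map_coeffs2 \<phi> g) = map_coeffs2 \<phi> (map_poly pderiv g)" for g
    by (rule poly_eqI) (simp add: coeff_map_poly map_poly_hom_pderiv[OF assms])
  have "ruppert pderiv (map_coeffs2 \<phi> f) (map_coeffs2 \<phi> g) (map_coeffs2 \<phi> h) = map_coeffs2 \<phi> (ruppert pderiv f g h)" for g h
    by (simp add: ruppert_def pd mm.hom_add mm.hom_diff mm.hom_mult
          map_poly_hom_pderiv[OF cring_hom_map_poly])
  then have "ruppert_functional l m (map_coeffs2 \<phi> f) e (map_coeffs2 \<phi> g) (map_coeffs2 \<phi> h) =
      \<phi> (ruppert_functional l m f e g h)" for g h
    by (auto simp: ruppert_functional_def euler_coeff_def coeff2_map_coeffs2 hom_add split: option.split)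
  from this[of "unknown_monom True j" "unknown_monom False j"] show ?thesis
    by (simp add: ruppert_matrix_def um)
qed

lemma rigid_reflect:
  fixes \<phi> :: "'a::idom \<Rightarrow> 'b::idom"
  assumes "cring_hom \<phi>" "rigid l m (map_coeffs2 \<phi> f)"
  shows "rigid l m f"
proof -
  have "(\<lambda>e j. \<phi> (ruppert_matrix l m f e j)) = ruppert_matrix l m (map_coeffs2 \<phi> f)"
    by (simp add: ruppert_matrix_hom[OF assms(1)] fun_eq_iff)
  with assms(2) inj_system_reflect[OF assms(1) finite_unknowns, of "l + m" "ruppert_matrix l m f"]
  show ?thesis unfolding rigid_iff_inj_system by simp
qed

lemma rigid_specialize:
  fixes f :: "'a::idom poly poly"
  assumes "rigid l m f"
  shows "\<exists>\<delta>. \<delta> \<noteq> 0 \<and> (\<forall>\<phi> :: 'a \<Rightarrow> 'b::idom. cring_hom \<phi> \<longrightarrow> \<phi> \<delta> \<noteq> 0 \<longrightarrow> rigid l m (map_coeffs2 \<phi> f))"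
proof -
  have "(\<lambda>e j. \<phi> (ruppert_matrix l m f e j)) = ruppert_matrix l m (map_coeffs2 \<phi> f)"
    if "cring_hom \<phi>" for \<phi> :: "'a \<Rightarrow> 'b"
    by (simp add: ruppert_matrix_hom[OF that] fun_eq_iff)
  note hom = this
  obtain \<delta> where \<delta>: "\<delta> \<noteq> 0" "\<And>\<phi> :: 'a \<Rightarrow> 'b. cring_hom \<phi> \<Longrightarrow> \<phi> \<delta> \<noteq> 0 \<Longrightarrow>
      inj_system (unknowns (l + m)) (\<lambda>e j. \<phi> (ruppert_matrix l m f e j))"
    using inj_system_specialize[OF finite_unknowns assms[unfolded rigid_iff_inj_system], where 'b = 'b]
    by blast
  show ?thesis
  proof (intro exI[of _ \<delta>] conjI allI impI)
    show "\<delta> \<noteq> 0" by fact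
    fix \<phi> :: "'a \<Rightarrow> 'b" assume \<phi>: "cring_hom \<phi>" "\<phi> \<delta> \<noteq> 0"
    show "rigid l m (map_coeffs2 \<phi> f)"
      using \<delta>(2)[OF \<phi>] unfolding rigid_iff_inj_system hom[OF \<phi>(1)] .
  qed
qed

section \<open>Derivations of fraction fields\<close>

definition fract_der :: "('a::idom \<Rightarrow> 'a) \<Rightarrow> 'a fract \<Rightarrow> 'a fract" where
  "fract_der d q = (THE r. \<exists>a b. b \<noteq> 0 \<and> q = Fract a b \<and> r = Fract (d a * b - a * d b) (b * b))"

text \<open>
  The quotient rule does not depend on the chosen fraction: differentiate \<open>a b' = a' b\<close>.
\<close>

lemma fract_der_Fract:
  assumes "derivation d" "b \<noteq> 0"
  shows "fract_der d (Fract a b) = Fract (d a * b - a * d b) (b * b)"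
  unfolding fract_der_def
proof (rule the_equality)
  show "\<exists>a' b'. b' \<noteq> 0 \<and> Fract a b = Fract a' b' \<and>
      Fract (d a * b - a * d b) (b * b) = Fract (d a' * b' - a' * d b') (b' * b')"
    using assms(2) by blast
next
  interpret derivation d by fact
  fix r assume "\<exists>a' b'. b' \<noteq> 0 \<and> Fract a b = Fract a' b' \<and> r = Fract (d a' * b' - a' * d b') (b' * b')"
  then obtain a' b' where *: "b' \<noteq> 0" "Fract a b = Fract a' b'"
    "r = Fract (d a' * b' - a' * d b') (b' * b')" by blast
  have eq: "a * b' = a' * b" using *(1,2) assms(2) by (simp add: eq_fract)
  then have deq: "d a * b' + a * d b' = d a' * b + a' * d b"
    by (metis der_mult)
  have "(d a' * b' - a' * d b') * (b * b) - (d a * b - a * d b) * (b' * b')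
      = (d a' * b + a' * d b - (d a * b' + a * d b')) * (b * b') 
        - a' * b * (b' * d b + b * d b') + a * b' * (b * d b' + b' * d b)"
    by (simp add: algebra_simps)
  also have "\<dots> = 0" unfolding deq eq by (simp add: algebra_simps)
  finally show "r = Fract (d a * b - a * d b) (b * b)"
    unfolding *(3) using *(1) assms(2) by (subst eq_fract) auto
qed

lemma derivation_fract_der:
  assumes "derivation d"
  shows "derivation (fract_der d)"
proof
  interpret derivation d by fact
  fix x y :: "'a fract"
  obtain a b where x: "x = Fract a b" "b \<noteq> 0" by (cases x)
  obtain a' b' where y: "y = Fract a' b'" "b' \<noteq> 0" by (cases y)
  show "fract_der d (x + y) = fract_der d x + fract_der d y"
    unfolding x(1) y(1) using x(2) y(2)
    by (simp add: fract_der_Fract[OF assms] eq_fract der_add der_mult) (simp add: algebra_simps)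
  show "fract_der d (x * y) = fract_der d x * y + x * fract_der d y"
    unfolding x(1) y(1) using x(2) y(2)
    by (simp add: fract_der_Fract[OF assms] eq_fract der_add der_mult) (simp add: algebra_simps)
qed

lemma fract_der_to_fract:
  assumes "derivation d"
  shows "fract_der d (to_fract a) = to_fract (d a)"
  using fract_der_Fract[OF assms, of 1 a] derivation.der_one[OF assms]
  by (simp add: to_fract_def)

text \<open>
  If \<open>(p / q)' = 0\<close>, comparison of leading coefficients in \<open>p' q = p q'\<close> gives \<open>deg p = deg q\<close> unless
  \<open>p = 0\<close>. The combination of \<open>p\<close> and \<open>q\<close> that cancels the leading terms satisfies the same
  equation with a smaller degree, so it is \<open>0\<close>.
\<close>

lemma pderiv_proportional:
  fixes p q :: "'a::{idom,ring_char_0} poly"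
  assumes "pderiv p * q = p * pderiv q" "q \<noteq> 0"
  shows "smult (lead_coeff q) p = smult (lead_coeff p) q"
proof -
  have deg: "degree r = degree q" if eq: "pderiv r * q = r * pderiv q" and r: "r \<noteq> 0" for r
  proof (rule ccontr)
    assume ne: "degree r \<noteq> degree q"
    let ?n = "degree r + degree q - 1"
    have A: "coeff (pderiv r * q) ?n = of_nat (degree r) * (lead_coeff r * lead_coeff q)"
    proof (cases "degree r")
      case 0
      then show ?thesis by (simp add: pderiv_eq_0_iff[THEN iffD2])
    next
      case (Suc k)
      have "coeff (pderiv r * q) (k + degree q) = coeff (pderiv r) k * lead_coeff q"
        using coeff_mult_degree_sum[of "pderiv r" q] Suc by (simp add: degree_pderiv)
      then show ?thesis using Suc by (simp add: coeff_pderiv mult.assoc)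
    qed
    have B: "coeff (r * pderiv q) ?n = of_nat (degree q) * (lead_coeff r * lead_coeff q)"
    proof (cases "degree q")
      case 0
      then show ?thesis by (simp add: pderiv_eq_0_iff[THEN iffD2])
    next
      case (Suc k)
      have "coeff (r * pderiv q) (degree r + k) = lead_coeff r * coeff (pderiv q) k"
        using coeff_mult_degree_sum[of r "pderiv q"] Suc by (simp add: degree_pderiv)
      then show ?thesis using Suc by (simp add: coeff_pderiv algebra_simps)
    qed
    from A B eq have "(of_nat (degree r) :: 'a) = of_nat (degree q)"
      using r assms(2) by simp
    with ne show False by simp
  qed
  define r where "r = smult (lead_coeff q) p - smult (lead_coeff p) q"
  have "pderiv r * q = r * pderiv q"
    unfolding r_def
    by (simp add: pderiv_diff pderiv_smult left_diff_distrib right_diff_distrib assms(1))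
       (simp add: mult.commute)
  have "r = 0"
  proof (rule ccontr)
    assume r: "r \<noteq> 0"
    from deg[OF \<open>pderiv r * q = r * pderiv q\<close> r] have dr: "degree r = degree q" .
    have "p \<noteq> 0" using r by (auto simp: r_def)
    from deg[OF assms(1) this] have dp: "degree p = degree q" .
    have "coeff r (degree q) = 0" by (simp add: r_def dp)
    with dr r show False by (metis leading_coeff_0_iff)
  qed
  then show ?thesis by (simp add: r_def)
qed

lemma fract_der_pderiv_const:
  fixes c :: "'a::{idom,ring_char_0} poly fract"
  assumes "fract_der pderiv c = 0"
  obtains a b where "b \<noteq> 0" "c = Fract [:a:] [:b:]"
proof -
  obtain p q where c: "c = Fract p q" "q \<noteq> 0" by (cases c)
  have "pderiv p * q = p * pderiv q"
    using assms c(2) unfolding c(1)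
    by (simp add: fract_der_Fract[OF derivation_pderiv] Zero_fract_def eq_fract)
  from pderiv_proportional[OF this c(2)]
  have "p * [:lead_coeff q:] = [:lead_coeff p:] * q" by (simp add: mult.commute)
  then have "c = Fract [:lead_coeff p:] [:lead_coeff q:]"
    unfolding c(1) using c(2) by (simp add: eq_fract)
  with that[of "lead_coeff q" "lead_coeff p"] c(2) show ?thesis by simp
qed

section \<open>Rigid polynomials are irreducible\<close>

lemma total_degree2_0 [simp]: "total_degree2 0 = 0"
  using total_degree2_const[of 0] by simp

lemma deg_less_iff: "deg_less n f \<longleftrightarrow> f = 0 \<or> total_degree2 f < n"
  for f :: "'a::comm_monoid_add poly poly"
proof
  assume less: "deg_less n f"
  show "f = 0 \<or> total_degree2 f < n"
  proof (cases "f = 0")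
    case False
    then obtain l m where "coeff2 f (l, m) \<noteq> 0" "l + m = total_degree2 f"
      by (rule total_degree2_attained)
    with less show ?thesis unfolding deg_less_def by metis
  qed simp
next
  assume "f = 0 \<or> total_degree2 f < n"
  then show "deg_less n f"
    unfolding deg_less_def by (auto dest: coeff2_le_total_degree2)
qed

lemma deg_less_diff:
  fixes f g :: "'a::ab_group_add poly poly"
  assumes "deg_less n f" "deg_less n g"
  shows "deg_less n (f - g)"
  unfolding deg_less_def
proof (intro allI impI)
  fix i j assume "coeff2 (f - g) (i, j) \<noteq> 0"
  then have "coeff2 f (i, j) \<noteq> 0 \<or> coeff2 g (i, j) \<noteq> 0" by auto
  with assms show "i + j < n" unfolding deg_less_def by blast
qed

lemma deg_less_smult:
  fixes f :: "'a::comm_semiring_0 poly poly"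
  shows "deg_less n f \<Longrightarrow> deg_less n (smult [:c:] f)"
  unfolding deg_less_def coeff2_smult using mult_zero_right by metis

lemma deg_less_mult:
  fixes f g :: "'a::idom poly poly"
  assumes "deg_less n f" "total_degree2 g \<le> k"
  shows "deg_less (n + k) (f * g)"
  using assms by (cases "f * g = 0") (auto simp: deg_less_iff total_degree2_mult)

lemma coeff2_pderiv: "coeff2 (pderiv f) (i, j) = of_nat (Suc i) * coeff2 f (Suc i, j)"
  for f :: "'a::idom poly poly"
  by (simp add: coeff2_def coeff_pderiv of_nat_poly flip: of_nat_Suc)

lemma coeff2_map_pderiv: "coeff2 (map_poly pderiv f) (i, j) = of_nat (Suc j) * coeff2 f (i, Suc j)"
  for f :: "'a::idom poly poly"
  by (simp add: coeff2_def coeff_map_poly coeff_pderiv flip: of_nat_Suc)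

lemma deg_less_pderiv: "deg_less (total_degree2 f) (pderiv f)"
  and deg_less_map_pderiv: "deg_less (total_degree2 f) (map_poly pderiv f)"
  for f :: "'a::idom poly poly"
  unfolding deg_less_def coeff2_pderiv coeff2_map_pderiv
  using coeff2_le_total_degree2[of f "Suc _"] coeff2_le_total_degree2[of f _ "Suc _"] by force+

lemma euler_coeff_self:
  fixes f :: "'a::idom poly poly"
  shows "euler_coeff l m (pderiv f) (map_poly pderiv f) = of_nat (l + m) * coeff2 f (l, m)"
  by (cases l; cases m)
     (simp_all add: euler_coeff_def coeff2_pderiv coeff2_map_pderiv algebra_simps)

lemma total_degree2_eq_0_if_derivs_0:
  fixes f :: "'a::{idom,ring_char_0} poly poly"
  assumes "pderiv f = 0" "map_poly pderiv f = 0"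
  shows "total_degree2 f = 0"
proof (rule ccontr)
  assume nz: "total_degree2 f \<noteq> 0"
  then have "f \<noteq> 0" by auto
  then obtain l m where lm: "coeff2 f (l, m) \<noteq> 0" "l + m = total_degree2 f"
    by (rule total_degree2_attained)
  have "of_nat (l + m) * coeff2 f (l, m) = 0"
    unfolding euler_coeff_self[symmetric] assms by (simp add: euler_coeff_def)
  with lm nz show False by (simp del: of_nat_add)
qed

text \<open>
  \<open>(p\<^sub>Y r, p\<^sub>Z r) / (p r)\<close> is the logarithmic derivative of \<open>p\<close>, which is closed.
\<close>

lemma ruppert_log_derivative:
  assumes "derivation d"
  shows "ruppert d (p * r) (pderiv p * r) (map_poly d p * r) = 0"
proof -
  interpret derivation "map_poly d" using assms by (rule derivation.derivation_map_poly)
  show ?thesis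
    by (simp add: ruppert_def der_mult pderiv_mult pderiv_map_poly_der[OF assms] algebra_simps)
qed

text \<open>
  \<open>(p\<^sub>Y s, p\<^sub>Z s) / (p\<^sup>2 s)\<close> is the differential of \<open>- 1 / p\<close>.
\<close>

lemma ruppert_square:
  assumes "derivation d"
  shows "ruppert d (p * (p * s)) (pderiv p * s) (map_poly d p * s) = 0"
proof -
  interpret derivation "map_poly d" using assms by (rule derivation.derivation_map_poly)
  show ?thesis
    by (simp add: ruppert_def der_mult pderiv_mult pderiv_map_poly_der[OF assms] algebra_simps)
qed

lemma rigid_proportional:
  fixes f :: "'a::idom poly poly"
  assumes "rigid l m f" "total_degree2 f \<le> l + m"
    and "deg_less (l + m) g" "deg_less (l + m) h" "ruppert pderiv f g h = 0"
  defines "a \<equiv> of_nat (l + m) * coeff2 f (l, m)"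
    and "b \<equiv> euler_coeff l m g h"
  shows "smult [:a:] g = smult [:b:] (pderiv f)" "smult [:a:] h = smult [:b:] (map_poly pderiv f)"
proof -
  define g' h' where "g' = smult [:a:] g - smult [:b:] (pderiv f)"
    and "h' = smult [:a:] h - smult [:b:] (map_poly pderiv f)"
  have dl: "deg_less (l + m) (smult [:c:] q - smult [:c':] q')"
    if "deg_less (l + m) q" "deg_less (l + m) q'" for c c' and q q' :: "'a poly poly"
    using that by (intro deg_less_diff deg_less_smult)
  have le: "deg_less (l + m) (pderiv f)" "deg_less (l + m) (map_poly pderiv f)"
    using deg_less_pderiv[of f] deg_less_map_pderiv[of f] assms(2)
    by (auto simp: deg_less_iff)
  have g'_eq: "g' = smult [:a:] g + smult [:-b:] (pderiv f)"
    and h'_eq: "h' = smult [:a:] h + smult [:-b:] (map_poly pderiv f)"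
    unfolding g'_def h'_def by (rule coeff2_eqI, simp)+
  have fun_eq: "ruppert_functional l m f e g' h' = a * ruppert_functional l m f e g h
      - b * ruppert_functional l m f e (pderiv f) (map_poly pderiv f)" for e
    using ruppert_functional_add[of l m f e "smult [:a:] g" "smult [:-b:] (pderiv f)"
        "smult [:a:] h" "smult [:-b:] (map_poly pderiv f)"]
    unfolding ruppert_functional_smult g'_eq h'_eq by simp
  have "ruppert_functional l m f e g' h' = 0" for e
  proof (cases e)
    case None
    then show ?thesis unfolding fun_eq
      by (simp add: ruppert_functional_def euler_coeff_self a_def b_def)
  next
    case (Some p)
    have "ruppert pderiv f (pderiv f) (map_poly pderiv f) = 0"
      using ruppert_log_derivative[OF derivation_pderiv, of f 1] by simp
    then show ?thesis unfolding fun_eq using Some assms(5)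
      by (simp add: ruppert_functional_def)
  qed
  then have "g' = 0 \<and> h' = 0"
    using assms(1) dl[OF assms(3) le(1)] dl[OF assms(4) le(2)]
      ruppert_functional_all_zero[of l m f g' h']
    unfolding rigid_def g'_def h'_def by blast
  then show "smult [:a:] g = smult [:b:] (pderiv f)" "smult [:a:] h = smult [:b:] (map_poly pderiv f)"
    by (simp_all add: g'_def h'_def)
qed

text \<open>
  Let \<open>p\<close> be a prime factor of \<open>f = p r\<close> with \<open>r\<close> not constant. If \<open>p\<close> does not divide \<open>r\<close>, then
  \<open>(p\<^sub>Y r, p\<^sub>Z r)\<close> is a solution; were it proportional to \<open>(f\<^sub>Y, f\<^sub>Z)\<close>, divisibility by \<open>p\<close> would
  make \<open>p\<close> or \<open>r\<close> constant. If \<open>r = p s\<close>, then \<open>(p\<^sub>Y s, p\<^sub>Z s)\<close> is a nonzero solution, and it has too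
  small a degree to be affected by the normalization.
\<close>

lemma rigid_imp_irreducible:
  fixes f :: "'c::{field_char_0,factorial_ring_gcd,semiring_gcd_mult_normalize} poly poly"
  assumes "rigid l m f" "total_degree2 f = l + m" "1 \<le> l + m" "coeff2 f (l, m) \<noteq> 0"
  shows "irreducible f"
proof (rule irreducibleI)
  have unit_iff: "q dvd 1 \<longleftrightarrow> q \<noteq> 0 \<and> total_degree2 q = 0" for q :: "'c poly poly"
    by (rule is_unit_poly_poly_iff)
  show f0: "f \<noteq> 0" using assms(4) by auto
  show "\<not> f dvd 1" using assms(2,3) unfolding unit_iff by linarith
  fix a b assume ab: "f = a * b"
  show "a dvd 1 \<or> b dvd 1"
  proof (rule ccontr)
    assume neg: "\<not> (a dvd 1 \<or> b dvd 1)"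
    moreover have "a \<noteq> 0" using ab f0 by auto
    ultimately obtain p where p: "p dvd a" "prime p" using prime_divisor_exists[of a] by blast
    then obtain a' where a': "a = p * a'" by (elim dvdE)
    define r where "r = a' * b"
    have fr: "f = p * r" by (simp add: ab a' r_def)
    have nz: "p \<noteq> 0" "r \<noteq> 0" using fr f0 by auto
    have "total_degree2 b \<noteq> 0" using neg nz by (auto simp: unit_iff r_def)
    then have tr: "total_degree2 r \<noteq> 0" using nz by (auto simp: r_def total_degree2_mult)
    have pe: "prime_elem p" using p(2) by simp
    have tp: "total_degree2 p \<noteq> 0" using prime_elem_not_unit[OF pe] nz(1) unfolding unit_iff by (metis)
    have tf: "l + m = total_degree2 p + total_degree2 r"
      using assms(2) fr nz by (simp add: total_degree2_mult)
    define c1 where "c1 = of_nat (l + m) * coeff2 f (l, m)"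
    have "l + m \<noteq> 0" using assms(3) by linarith
    then have c1: "c1 \<noteq> 0" using assms(4) unfolding c1_def mult_eq_0_iff of_nat_eq_0_iff by blast
    show False
    proof (cases "p dvd r")
      case True
      then obtain s where s: "r = p * s" by (elim dvdE)
      have ts: "total_degree2 r = total_degree2 p + total_degree2 s"
        using s nz by (simp add: total_degree2_mult)
      have dl: "deg_less (total_degree2 p + total_degree2 s) (pderiv p * s)"
        "deg_less (total_degree2 p + total_degree2 s) (map_poly pderiv p * s)"
        by (intro deg_less_mult deg_less_pderiv deg_less_map_pderiv order.refl)+
      then have dl': "deg_less (l + m) (pderiv p * s)" "deg_less (l + m) (map_poly pderiv p * s)"
        using tf ts by (auto simp: deg_less_iff)
      have high: "coeff2 q (i, j) = 0"
        if "deg_less (total_degree2 p + total_degree2 s) q" "Suc (i + j) = l + m"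
        for q :: "'c poly poly" and i j
      proof -
        have "\<not> i + j < total_degree2 p + total_degree2 s"
          using that(2) tf ts tp by linarith
        with that(1) show ?thesis unfolding deg_less_def by blast
      qed
      have "coeff2 (pderiv p * s) (l - 1, m) = 0" if "l \<noteq> 0"
        by (rule high[OF dl(1)]) (use that in simp)
      moreover have "coeff2 (map_poly pderiv p * s) (l, m - 1) = 0" if "m \<noteq> 0"
        by (rule high[OF dl(2)]) (use that in simp)
      ultimately have "euler_coeff l m (pderiv p * s) (map_poly pderiv p * s) = 0"
        by (cases "l = 0"; cases "m = 0") (simp_all add: euler_coeff_def)
      moreover have "ruppert pderiv f (pderiv p * s) (map_poly pderiv p * s) = 0"
        unfolding fr s by (rule ruppert_square[OF derivation_pderiv])
      ultimately have "pderiv p * s = 0 \<and> map_poly pderiv p * s = 0"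
        using assms(1) dl' unfolding rigid_def by blast
      then have "total_degree2 p = 0"
        using nz s by (intro total_degree2_eq_0_if_derivs_0) auto
      with tp show False by simp
    next
      case False
      have dl: "deg_less (l + m) (pderiv p * r)" "deg_less (l + m) (map_poly pderiv p * r)"
        unfolding tf by (intro deg_less_mult deg_less_pderiv deg_less_map_pderiv order.refl)+
      define c2 where "c2 = euler_coeff l m (pderiv p * r) (map_poly pderiv p * r)"
      have rup: "ruppert pderiv f (pderiv p * r) (map_poly pderiv p * r) = 0"
        unfolding fr by (rule ruppert_log_derivative[OF derivation_pderiv])
      interpret dZ: derivation "map_poly pderiv :: 'c poly poly \<Rightarrow> _"
        by (rule derivation.derivation_map_poly[OF derivation_pderiv])
      note pr = rigid_proportional[OF assms(1) eq_imp_le[OF assms(2)] dl rup, folded c1_def c2_def]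
      have sub: "smult [:c1 - c2:] x = smult [:c2:] y"
        if "smult [:c1:] x = smult [:c2:] (x + y)" for x y :: "'c poly poly"
      proof -
        have "smult [:c1 - c2:] x = smult [:c1:] x - smult [:c2:] x" by (simp flip: smult_diff_left)
        then show ?thesis using that by (simp add: smult_add_right)
      qed
      have eqY: "smult [:c1 - c2:] (pderiv p * r) = smult [:c2:] (p * pderiv r)"
        by (rule sub) (use pr(1) in \<open>simp add: fr pderiv_mult algebra_simps\<close>)
      have eqZ: "smult [:c1 - c2:] (map_poly pderiv p * r) = smult [:c2:] (p * map_poly pderiv r)"
        by (rule sub) (use pr(2) in \<open>simp add: fr dZ.der_mult algebra_simps\<close>)
      show False
      proof (cases "c1 = c2")
        case True
        then have "pderiv r = 0" "map_poly pderiv r = 0" using eqY eqZ c1 nz by auto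
        then have "total_degree2 r = 0" by (rule total_degree2_eq_0_if_derivs_0)
        with tr show False by simp
      next
        case ne: False
        have key: "q = 0" if "smult [:c1 - c2:] (q * r) = smult [:c2:] (p * w)"
          "deg_less (total_degree2 p) q" for q w
        proof -
          have "smult [:inverse (c1 - c2):] (smult [:c1 - c2:] (q * r)) = q * r"
            using ne by (simp add: one_pCons[symmetric])
          then have "q * r = p * smult [:inverse (c1 - c2):] (smult [:c2:] w)"
            unfolding that(1) by simp
          then have "p dvd q * r" by (rule dvdI)
          then have "p dvd q" using pe False by (auto simp: prime_elem_dvd_mult_iff)
          then show "q = 0"
            using dvd_imp_total_degree2_le[of p q] that(2)
            by (cases "q = 0") (auto simp: deg_less_iff)
        qed
        have "pderiv p = 0" using key[OF eqY deg_less_pderiv] .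
        moreover have "map_poly pderiv p = 0" using key[OF eqZ deg_less_map_pderiv] .
        ultimately have "total_degree2 p = 0" by (rule total_degree2_eq_0_if_derivs_0)
        with tp show False by simp
      qed
    qed
  qed
qed

section \<open>Constants of a derivation in a simple extension\<close>

text \<open>
  A combination of \<open>q\<close> and \<open>F\<close> of least degree divides both, and an irreducible \<open>F\<close> that does not
  divide \<open>q\<close> has no common factor with it.
\<close>

lemma field_poly_bezout:
  fixes F q :: "'a::field poly"
  assumes "irreducible F" "\<not> F dvd q"
  obtains u v where "u * q + v * F = 1"
proof -
  \<comment> \<open>the degrees of the nonzero elements of the ideal generated by \<open>q\<close> and \<open>F\<close>\<close>
  let ?P = "\<lambda>n. \<exists>p. p \<noteq> 0 \<and> degree p = n \<and> (\<exists>u v. p = u * q + v * F)"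
  have "q \<noteq> 0" using assms(2) by auto
  then have "?P (degree q)" by (intro exI[of _ q] conjI exI[of _ 1] exI[of _ 0]) auto
  then have "?P (LEAST n. ?P n)" by (rule LeastI)
  then obtain p u v where p: "p \<noteq> 0" "degree p = (LEAST n. ?P n)" "p = u * q + v * F" by blast
  have least: "degree p \<le> degree p'" if "p' \<noteq> 0" "p' = u' * q + v' * F" for p' u' v'
    unfolding p(2) by (rule Least_le) (use that in blast)
  have dvd: "p dvd w" if w: "w = u' * q + v' * F" for w u' v'
  proof (rule ccontr)
    assume nd: "\<not> p dvd w"
    then have nz: "w mod p \<noteq> 0" by (simp add: dvd_eq_mod_eq_0)
    have "w mod p = w - w div p * p" by (simp add: minus_div_mult_eq_mod)
    also have "\<dots> = (u' - w div p * u) * q + (v' - w div p * v) * F"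
      by (subst (2) p(3), subst w) (simp add: algebra_simps)
    finally have "degree p \<le> degree (w mod p)" by (rule least[OF nz])
    moreover have "degree (w mod p) < degree p"
      using nz p(1) degree_mod_less'[of p w] by blast
    ultimately show False by simp
  qed
  have "p dvd q" by (rule dvd[of q 1 0]) simp
  moreover have "p dvd F" by (rule dvd[of F 0 1]) simp
  then obtain r where r: "F = p * r" by (elim dvdE)
  then have "p dvd 1 \<or> r dvd 1" by (rule irreducibleD[OF assms(1)])
  moreover have "\<not> r dvd 1"
  proof
    assume "r dvd 1"
    then have "F dvd p" unfolding r by (simp add: mult_unit_dvd_iff)
    with \<open>p dvd q\<close> assms(2) show False using dvd_trans by blast
  qed
  ultimately have "p dvd 1" by simp
  then obtain s where "1 = p * s" by (elim dvdE)
  then have "(s * u) * q + (s * v) * F = 1" using p(3) by (simp add: algebra_simps)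
  then show ?thesis by (rule that)
qed

text \<open>
  The powers \<open>1, u, \<dots>, u\<^sup>n\<close> modulo \<open>F\<close>, where \<open>n = deg F\<close>, are \<open>n + 1\<close> vectors in a space of
  dimension \<open>n\<close>.
\<close>

lemma algebraic_mod_irreducible:
  fixes F u :: "'a::field poly"
  assumes "F \<noteq> 0"
  obtains m where "m \<noteq> 0" "F dvd pcompose m u"
proof -
  define n where "n = degree F"
  define M where "M e j = coeff (u ^ j mod F) e" for e j
  have "\<not> inj_system {..n} M"
  proof (rule not_inj_system_underdetermined[of _ "{..<n}"])
    fix e j assume e: "e \<notin> {..<n}"
    show "M e j = 0"
    proof (cases "u ^ j mod F = 0")
      case False
      then have "degree (u ^ j mod F) < n"
        using degree_mod_less'[of F "u ^ j"] assms unfolding n_def by blast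
      with e show ?thesis by (simp add: M_def coeff_eq_0)
    qed (simp add: M_def)
  qed auto
  then obtain v j0 where v: "\<And>e. (\<Sum>j\<le>n. M e j * v j) = 0" and j0: "j0 \<le> n" "v j0 \<noteq> 0"
    unfolding inj_system_def by auto
  define m where "m = (\<Sum>j\<le>n. monom (v j) j)"
  have "coeff m j0 = v j0" using j0(1) by (simp add: m_def coeff_sum)
  with j0 have m0: "m \<noteq> 0" by auto
  have pm: "pcompose (monom c j) u = smult c (u ^ j)" for c j
    by (induction j) (simp_all add: monom_0 monom_Suc pcompose_pCons)
  have "pcompose m u = (\<Sum>j\<le>n. smult (v j) (u ^ j))"
    by (simp add: m_def pcompose_sum pm)
  moreover have "F dvd smult (v j) (u ^ j) - smult (v j) (u ^ j mod F)" for j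
  proof -
    have "F dvd u ^ j - u ^ j mod F" by (simp add: minus_mod_eq_mult_div)
    then show ?thesis unfolding smult_diff_right[symmetric] by (rule dvd_smult)
  qed
  then have "F dvd (\<Sum>j\<le>n. smult (v j) (u ^ j)) - (\<Sum>j\<le>n. smult (v j) (u ^ j mod F))"
    unfolding sum_subtractf[symmetric] by (rule dvd_sum)
  moreover have "(\<Sum>j\<le>n. smult (v j) (u ^ j mod F)) = 0"
    by (rule poly_eqI) (use v in \<open>simp add: coeff_sum M_def mult.commute\<close>)
  ultimately have "F dvd pcompose m u" by simp
  with m0 that show ?thesis by blast
qed

text \<open>
  The minimal polynomial of the class of \<open>u\<close> modulo \<open>F\<close>.
\<close>

definition is_min_poly :: "'a::field poly \<Rightarrow> 'a poly \<Rightarrow> 'a poly \<Rightarrow> bool" where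
  "is_min_poly F u m \<longleftrightarrow> lead_coeff m = 1 \<and> F dvd pcompose m u \<and>
     (\<forall>m'. m' \<noteq> 0 \<longrightarrow> F dvd pcompose m' u \<longrightarrow> degree m \<le> degree m')"

lemma min_poly_exists:
  fixes F u :: "'a::field poly"
  assumes "F \<noteq> 0"
  obtains m where "is_min_poly F u m"
proof -
  let ?P = "\<lambda>n. \<exists>m. m \<noteq> 0 \<and> degree m = n \<and> F dvd pcompose m u"
  obtain m1 where "m1 \<noteq> 0" "F dvd pcompose m1 u" by (rule algebraic_mod_irreducible[OF assms])
  then have "?P (degree m1)" by blast
  then have "?P (LEAST n. ?P n)" by (rule LeastI)
  then obtain m where m: "m \<noteq> 0" "degree m = (LEAST n. ?P n)" "F dvd pcompose m u" by blast
  have "is_min_poly F u (smult (inverse (lead_coeff m)) m)"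
    unfolding is_min_poly_def
  proof (intro conjI allI impI)
    show "lead_coeff (smult (inverse (lead_coeff m)) m) = 1" using m(1) by simp
    show "F dvd pcompose (smult (inverse (lead_coeff m)) m) u"
      using m(3) by (simp add: pcompose_smult dvd_smult)
    fix m' assume "m' \<noteq> 0" "F dvd pcompose m' u"
    then have "degree m \<le> degree m'" unfolding m(2) by (intro Least_le) blast
    then show "degree (smult (inverse (lead_coeff m)) m) \<le> degree m'" using m(1) by simp
  qed
  then show ?thesis by (rule that)
qed

text \<open>
  The Hamiltonian vector field \<open>F\<^sub>Y d/dZ - F\<^sub>Z d/dY\<close>. It kills \<open>F\<close>, so it acts on the quotient by \<open>F\<close>,
  where it is \<open>F\<^sub>Y\<close> times the unique extension of \<open>d\<close>. Working with it avoids the division by \<open>F\<^sub>Y\<close>: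
  for irreducible \<open>F\<close> in characteristic \<open>0\<close>, the constants of the quotient are the classes of the \<open>u\<close>
  with \<open>F dvd ham d F u\<close>.
\<close>

definition ham :: "('a::idom \<Rightarrow> 'a) \<Rightarrow> 'a poly \<Rightarrow> 'a poly \<Rightarrow> 'a poly" where
  "ham d F u = map_poly d u * pderiv F - pderiv u * map_poly d F"

lemma ham_self [simp]: "ham d F F = 0"
  by (simp add: ham_def)

lemma derivation_ham: "derivation d \<Longrightarrow> derivation (ham d F)"
proof -
  assume "derivation d"
  then interpret derivation "map_poly d" by (rule derivation.derivation_map_poly)
  show ?thesis
    by unfold_locales (simp_all add: ham_def der_add der_mult pderiv_add pderiv_mult algebra_simps)
qed

lemma ham_const: "derivation d \<Longrightarrow> ham d F [:c:] = smult (d c) (pderiv F)"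
proof -
  assume "derivation d"
  then interpret derivation d .
  show ?thesis by (simp add: ham_def map_poly_der_pCons)
qed

text \<open>
  The chain rule.
\<close>

lemma ham_pcompose:
  assumes "derivation d"
  shows "ham d F (pcompose m u) =
    pcompose (map_poly d m) u * pderiv F + pcompose (pderiv m) u * ham d F u"
proof -
  interpret d: derivation d by fact
  interpret derivation "ham d F" by (rule derivation_ham[OF assms])
  show ?thesis
  proof (induction m)
    case 0
    then show ?case by simp
  next
    case (pCons a m)
    show ?case
      by (simp add: pcompose_pCons der_add der_mult pCons.IH ham_const[OF assms]
            d.map_poly_der_pCons pderiv_pCons pcompose_add algebra_simps)
  qed
qed

lemma ham_dvd:
  assumes "derivation d" "F dvd u"
  shows "F dvd ham d F u"
proof -
  interpret derivation "ham d F" by (rule derivation_ham[OF assms(1)])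
  obtain s where "u = F * s" using assms(2) by (elim dvdE)
  then show ?thesis by (simp add: der_mult)
qed

lemma irreducible_field_poly_degree:
  fixes F :: "'a::field poly"
  assumes "irreducible F"
  shows "0 < degree F"
proof (rule ccontr)
  assume "\<not> 0 < degree F"
  then obtain c where c: "F = [:c:]" by (auto elim: degree_eq_zeroE)
  then have "c \<noteq> 0" using assms by auto
  then have "F dvd 1" by (auto simp: c is_unit_const_poly_iff dvd_field_iff)
  with assms show False by (simp add: irreducible_def)
qed

lemma irreducible_not_dvd_pderiv:
  fixes F :: "'a::field_char_0 poly"
  assumes "irreducible F"
  shows "\<not> F dvd pderiv F"
proof
  have deg: "0 < degree F" by (rule irreducible_field_poly_degree[OF assms])
  then have "pderiv F \<noteq> 0" by (simp add: pderiv_eq_0_iff)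
  moreover assume "F dvd pderiv F"
  ultimately have "degree F \<le> degree (pderiv F)" by (rule dvd_imp_degree_le[rotated])
  with deg show False by (simp add: degree_pderiv)
qed

lemma irreducible_dvd_multD:
  fixes F :: "'a::field poly"
  assumes "irreducible F" "F dvd a * b"
  shows "F dvd a \<or> F dvd b"
  using assms field_poly_irreducible_imp_prime prime_elem_dvd_multD by blast

text \<open>
  Apply the derivation to \<open>m(u) = 0\<close>: since the coefficients of \<open>m\<close> are constants, either \<open>u\<close> is a
  constant or \<open>m'(u) = 0\<close>, and in the latter case \<open>m'\<close> is a relation of smaller degree.
\<close>

lemma ham_dvd_if_algebraic_over_constants:
  fixes F :: "'a::field_char_0 poly"
  assumes d: "derivation d" and F: "irreducible F"
    and "m \<noteq> 0" "map_poly d m = 0" "F dvd pcompose m u"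
  shows "F dvd ham d F u"
  using assms(3-5)
proof (induction "degree m" arbitrary: m rule: less_induct)
  case less
  have "degree m \<noteq> 0"
  proof
    assume "degree m = 0"
    then obtain c where c: "m = [:c:]" by (auto elim: degree_eq_zeroE)
    with less.prems have "F dvd [:c:]" "c \<noteq> 0" by auto
    then have "degree F \<le> 0" using dvd_imp_degree_le[of F "[:c:]"] by simp
    with irreducible_field_poly_degree[OF F] show False by simp
  qed
  then have m': "degree (pderiv m) < degree m" "pderiv m \<noteq> 0"
    by (simp_all add: degree_pderiv pderiv_eq_0_iff)
  have "F dvd ham d F (pcompose m u)" by (rule ham_dvd[OF d less.prems(3)])
  then have "F dvd pcompose (pderiv m) u * ham d F u"
    by (simp add: ham_pcompose[OF d] less.prems(2))
  then consider "F dvd pcompose (pderiv m) u" | "F dvd ham d F u"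
    using irreducible_dvd_multD[OF F] by blast
  then show ?case
  proof cases
    case 1
    moreover have "map_poly d (pderiv m) = 0"
      using less.prems(2) pderiv_map_poly_der[OF d, of m] by simp
    ultimately show ?thesis using less.hyps[OF m'(1) m'(2)] by blast
  qed
qed

text \<open>
  Apply the derivation to \<open>m(u) = 0\<close>. As \<open>u\<close> is a constant, the polynomial with the differentiated
  coefficients also annihilates \<open>u\<close>; but \<open>m\<close> is monic, so its degree is smaller and it is zero.
\<close>

lemma min_poly_coeffs_constant:
  fixes F :: "'a::field_char_0 poly"
  assumes d: "derivation d" and F: "irreducible F"
    and m: "is_min_poly F u m" and u: "F dvd ham d F u"
  shows "map_poly d m = 0"
proof (rule ccontr)
  interpret derivation d by fact
  assume nz: "map_poly d m \<noteq> 0"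
  have m': "lead_coeff m = 1" "F dvd pcompose m u"
    "\<And>m'. m' \<noteq> 0 \<Longrightarrow> F dvd pcompose m' u \<Longrightarrow> degree m \<le> degree m'"
    using m by (auto simp: is_min_poly_def)
  have "F dvd ham d F (pcompose m u)" by (rule ham_dvd[OF d m'(2)])
  moreover have "F dvd pcompose (pderiv m) u * ham d F u" using u by simp
  ultimately have "F dvd pcompose (map_poly d m) u * pderiv F"
    unfolding ham_pcompose[OF d] by (simp add: dvd_add_left_iff)
  then have "F dvd pcompose (map_poly d m) u"
    using irreducible_dvd_multD[OF F] irreducible_not_dvd_pderiv[OF F] by blast
  from m'(3)[OF nz this] have le: "degree m \<le> degree (map_poly d m)" .
  have "coeff (map_poly d m) n = 0" if "n \<ge> degree m" for n
    using that m'(1) by (cases "n = degree m") (simp_all add: coeff_der coeff_eq_0)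
  then have "lead_coeff (map_poly d m) = 0" using le by blast
  with nz show False by simp
qed

text \<open>
  Modulo \<open>F\<close>, the equation says \<open>g F\<^sub>Z = h F\<^sub>Y\<close>, so \<open>(g, h) = u (F\<^sub>Y, F\<^sub>Z)\<close> with \<open>u = g / F\<^sub>Y\<close>. If one
  writes \<open>g = u F\<^sub>Y + \<alpha> F\<close> and \<open>h = u F\<^sub>Z + \<beta> F\<close> and inserts this, the equation modulo \<open>F\<^sup>2\<close> says that
  \<open>u\<close> is a constant of the quotient by \<open>F\<close>.
\<close>

lemma ruppert_solution_proportional:
  fixes F :: "'a::field_char_0 poly"
  assumes d: "derivation d" and F: "irreducible F"
    and closed: "\<And>u. F dvd ham d F u \<Longrightarrow> \<exists>c. d c = 0 \<and> F dvd u - [:c:]"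
    and rup: "ruppert d F g h = 0"
  obtains c where "d c = 0" "F dvd g - smult c (pderiv F)" "F dvd h - smult c (map_poly d F)"
proof -
  interpret D: derivation "map_poly d" using d by (rule derivation.derivation_map_poly)
  define F1 F2 where "F1 = pderiv F" and "F2 = map_poly d F"
  obtain s t where st: "s * F1 + t * F = 1"
    using field_poly_bezout[OF F irreducible_not_dvd_pderiv[OF F]] unfolding F1_def by blast
  define u where "u = g * s"
  have g: "g = u * F1 + g * t * F"
    using arg_cong[OF st, of "\<lambda>x. g * x"] by (simp add: u_def algebra_simps)
  have "g * F2 - h * F1 = F * (map_poly d g - pderiv h)"
    using rup by (simp add: ruppert_def F1_def F2_def algebra_simps)
  then have "F1 * (u * F2 - h) = F * (map_poly d g - pderiv h - g * t * F2)"
    by (subst (asm) (1) g) (simp add: algebra_simps)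
  then have "F dvd F1 * (u * F2 - h)" by simp
  then have "F dvd u * F2 - h"
    using irreducible_dvd_multD[OF F] irreducible_not_dvd_pderiv[OF F] unfolding F1_def by blast
  then obtain \<beta>' where "u * F2 - h = F * \<beta>'" by (elim dvdE)
  then have h: "h = u * F2 + (- \<beta>') * F" by (simp add: algebra_simps)
  define \<alpha> \<beta> where "\<alpha> = g * t" and "\<beta> = - \<beta>'"
  have g': "g = u * F1 + \<alpha> * F" and h': "h = u * F2 + \<beta> * F"
    using g h by (simp_all add: \<alpha>_def \<beta>_def)
  \<comment> \<open>the terms without a factor \<open>F\<close> cancel because \<open>(F1, F2)\<close> is closed\<close>
  have "ruppert d F (u * F1 + \<alpha> * F) (u * F2 + \<beta> * F)
     = F * (ham d F u + F * (map_poly d \<alpha> - pderiv \<beta>))"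
    by (simp add: ruppert_def ham_def F1_def F2_def D.der_add D.der_mult pderiv_add pderiv_mult
          pderiv_map_poly_der[OF d] algebra_simps)
  then have "F * (ham d F u + F * (map_poly d \<alpha> - pderiv \<beta>)) = 0"
    using rup g' h' by simp
  then have "ham d F u + F * (map_poly d \<alpha> - pderiv \<beta>) = 0" using F by auto
  then have "ham d F u = F * (pderiv \<beta> - map_poly d \<alpha>)" by (simp add: algebra_simps eq_neg_iff_add_eq_0)
  then have "F dvd ham d F u" by simp
  then obtain c where c: "d c = 0" "F dvd u - [:c:]" using closed by blast
  have "g - smult c F1 = (u - [:c:]) * F1 + \<alpha> * F" by (subst g') (simp add: algebra_simps)
  then have 1: "F dvd g - smult c F1" using c(2) by simp
  have "h - smult c F2 = (u - [:c:]) * F2 + \<beta> * F" by (subst h') (simp add: algebra_simps)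
  then have 2: "F dvd h - smult c F2" using c(2) by simp
  from that[OF c(1)] 1 2 show ?thesis unfolding F1_def F2_def by blast
qed

section \<open>Irreducible polynomials over algebraically closed fields are rigid\<close>

instance fract :: ("{idom,ring_char_0}") field_char_0
proof
  show "inj (of_nat :: nat \<Rightarrow> 'a fract)"
    by (simp add: inj_def of_nat_fract eq_fract)
qed

text \<open>
  \<open>m(u)\<close> is a product of factors \<open>u - x\<close>, and the irreducible \<open>F\<close> divides one of them.
\<close>

lemma dvd_of_split_min_poly:
  fixes \<kappa> :: "'c::alg_closed_field \<Rightarrow> 'a::field"
  assumes "cring_hom \<kappa>" and F: "irreducible F"
    and "m \<noteq> 0" "F dvd pcompose (map_poly \<kappa> m) u"
  shows "\<exists>x. F dvd u - [:\<kappa> x:]"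
  using assms(3,4)
proof (induction "degree m" arbitrary: m rule: less_induct)
  case less
  interpret cring_hom \<kappa> by fact
  show ?case
  proof (cases "degree m = 0")
    case True
    then obtain c where c: "m = [:c:]" by (auto elim: degree_eq_zeroE)
    then have "\<kappa> c * \<kappa> (inverse c) = 1" using less.prems(1) by (simp flip: hom_mult)
    then have "\<kappa> c \<noteq> 0" by auto
    moreover have "F dvd [:\<kappa> c:]" using less.prems(2) by (simp add: c map_poly_hom_pCons)
    ultimately have "degree F \<le> 0" using dvd_imp_degree_le[of F "[:\<kappa> c:]"] by simp
    with irreducible_field_poly_degree[OF F] show ?thesis by simp
  next
    case False
    then obtain x where "poly m x = 0" using alg_closed_imp_poly_has_root[of m] by auto
    then obtain q where q: "m = [:-x, 1:] * q" using poly_eq_0_iff_dvd[of m x] by (metis dvdE)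
    then have q0: "q \<noteq> 0" using less.prems(1) by auto
    have "pcompose (map_poly \<kappa> m) u = (u - [:\<kappa> x:]) * pcompose (map_poly \<kappa> q) u"
      unfolding q map_poly_hom_mult pcompose_mult
      by (simp add: map_poly_hom_pCons pcompose_pCons hom_uminus)
    then have "F dvd u - [:\<kappa> x:] \<or> F dvd pcompose (map_poly \<kappa> q) u"
      using less.prems(2) irreducible_dvd_multD[OF F] by simp
    moreover have "degree m = Suc (degree q)" unfolding q using q0 by (subst degree_mult_eq) auto
    ultimately show ?thesis using less.hyps[of q] q0 by auto
  qed
qed

lemma map_poly_preimage:
  assumes "cring_hom \<kappa>" "inj \<kappa>" "\<And>n. coeff p n \<in> range \<kappa>"
  obtains q where "map_poly \<kappa> q = p"
proof -
  interpret cring_hom \<kappa> by fact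
  have "the_inv \<kappa> 0 = 0" using the_inv_f_f[OF assms(2), of 0] by simp
  have "coeff (map_poly \<kappa> (map_poly (the_inv \<kappa>) p)) n = coeff p n" for n
    using assms(3)[of n] \<open>the_inv \<kappa> 0 = 0\<close>
    by (auto simp: coeff_map_poly coeff_hom the_inv_f_f[OF assms(2)])
  then show ?thesis by (intro that poly_eqI)
qed

lemma cring_hom_to_fract: "cring_hom to_fract"
  by unfold_locales simp_all

lemma fract_poly_pderiv: "fract_poly (pderiv f) = pderiv (fract_poly f)"
  by (rule map_poly_hom_pderiv[OF cring_hom_to_fract])

lemma fract_poly_der:
  "derivation d \<Longrightarrow> map_poly (fract_der d) (fract_poly f) = fract_poly (map_poly d f)"
  by (rule poly_eqI)
     (simp add: coeff_map_poly derivation.der_zero derivation_fract_der fract_der_to_fract)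

lemma fract_poly_ruppert:
  assumes "derivation d"
  shows "ruppert (fract_der d) (fract_poly f) (fract_poly g) (fract_poly h) =
           fract_poly (ruppert d f g h)"
  by (simp add: ruppert_def fract_poly_der[OF assms] flip: fract_poly_pderiv)

text \<open>
  If \<open>f\<close> does not involve \<open>Y\<close>, it has degree one and the system is solved by hand. Otherwise work in
  \<open>C(Z)[Y]\<close> for the given algebraically closed field \<open>C\<close>: the constants of \<open>d/dZ\<close> on \<open>C(Z)\<close> are \<open>C\<close>, and
  a constant \<open>u\<close> of the quotient by \<open>f\<close> has a minimal polynomial over \<open>C\<close>, which splits. So
  \<open>ruppert_solution_proportional\<close> applies. By Gauss's lemma \<open>f\<close> divides
  \<open>g - c f\<^sub>Y\<close> and \<open>h - c f\<^sub>Z\<close> in \<open>C[Z][Y]\<close>, and both have smaller total degree.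
\<close>

lemma irreducible_imp_rigid:
  fixes f :: "'c::{alg_closed_field,field_char_0,factorial_ring_gcd,semiring_gcd_mult_normalize} poly poly"
  assumes irr: "irreducible f"
    and lm: "total_degree2 f = l + m" "coeff2 f (l, m) \<noteq> 0"
  shows "rigid l m f"
proof (cases "degree f = 0")
  case True
  then obtain q where q: "f = [:q:]" by (auto elim: degree_eq_zeroE)
  then have "irreducible q" using irr by (simp add: irreducible_const_poly_iff)
  then have "\<not> 1 < degree q" "0 < degree q"
    using alg_closed_imp_reducible irreducible_field_poly_degree by blast+
  then have "degree q = 1" by linarith
  then obtain a b where ab: "q = [:a, b:]" "b \<noteq> 0"
    by (metis degree1_coeffs degree_pCons_0 pCons_0_0 zero_neq_one)
  have [simp]: "l = 0"
    using lm(2) by (cases l) (simp_all add: q coeff2_def)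
  have "m \<le> 1"
    using lm(2) le_degree[of q m] \<open>degree q = 1\<close> by (simp add: q coeff2_def)
  moreover have "total_degree2 f \<noteq> 0"
    using irr is_unit_poly_poly_iff[of f] by (auto simp: irreducible_def)
  ultimately have [simp]: "m = 1" using lm(1) by simp
  show ?thesis
    unfolding rigid_def
  proof (intro allI impI)
    fix g h assume *: "deg_less (l + m) g" "deg_less (l + m) h"
      "ruppert pderiv f g h = 0" "euler_coeff l m g h = 0"
    have const: "w = [:[:coeff2 w (0, 0):]:]" if "deg_less (l + m) w" for w :: "'c poly poly"
      by (rule total_degree2_eq_0D) (use that in \<open>auto simp: deg_less_iff\<close>)
    \<comment> \<open>\<open>l = 0\<close> and \<open>m = 1\<close>, so \<open>g\<close> and \<open>h\<close> are constants and the normalization is \<open>h = 0\<close>\<close>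
    have "coeff2 h (0, 0) = 0" using *(4) by (simp add: euler_coeff_def)
    then have h: "h = 0" using const[OF *(2)] by simp
    obtain c where c: "g = [:[:c:]:]" using const[OF *(1)] by blast
    have "map_poly pderiv f = [:[:b:]:]" by (simp add: q ab map_poly_pCons pderiv_pCons)
    then have "g * [:[:b:]:] = 0" using *(3) h c
      by (simp add: ruppert_def map_poly_pCons pderiv_pCons)
    then show "g = 0 \<and> h = 0" using ab h by auto
  qed
next
  case False
  define F where "F = fract_poly f"
  define d where "d = fract_der (pderiv :: 'c poly \<Rightarrow> _)"
  have der: "derivation d" unfolding d_def by (intro derivation_fract_der derivation_pderiv)
  have F: "irreducible F" and cont: "content f = 1"
    using irr nonconst_poly_irreducible_iff[OF False] by (auto simp: F_def)
  define \<kappa> where "\<kappa> c = to_fract [:c:]" for c :: 'c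
  have \<kappa>: "cring_hom \<kappa>" by unfold_locales (simp_all add: \<kappa>_def flip: to_fract_add to_fract_mult one_pCons)
  interpret cring_hom \<kappa> by (rule \<kappa>)
  have inj: "inj \<kappa>" by (auto simp: inj_def \<kappa>_def)
  have const: "\<exists>x. c = \<kappa> x" if "d c = 0" for c
  proof -
    obtain a b where ab: "b \<noteq> 0" "c = Fract [:a:] [:b:]"
      using \<open>d c = 0\<close> unfolding d_def by (rule fract_der_pderiv_const)
    then have "c = \<kappa> (a / b)" by (simp add: \<kappa>_def to_fract_def eq_fract)
    then show ?thesis by blast
  qed
  have closed: "\<exists>c. d c = 0 \<and> F dvd u - [:c:]" if u: "F dvd ham d F u" for u
  proof -
    obtain mp where mp: "is_min_poly F u mp"
      by (rule min_poly_exists[of F u]) (use F in auto)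
    have dm: "map_poly d mp = 0" by (rule min_poly_coeffs_constant[OF der F mp u])
    have "coeff mp n \<in> range \<kappa>" for n
      using const derivation.coeff_der[OF der, of mp n] dm by simp (metis rangeI)
    then obtain m1 where "map_poly \<kappa> m1 = mp" by (rule map_poly_preimage[OF \<kappa> inj])
    moreover from this have "m1 \<noteq> 0" "F dvd pcompose (map_poly \<kappa> m1) u"
      using mp by (auto simp: is_min_poly_def)
    ultimately obtain x where "F dvd u - [:\<kappa> x:]"
      using dvd_of_split_min_poly[OF \<kappa> F, of m1 u] by auto
    moreover have "d (\<kappa> x) = 0"
      by (simp add: d_def \<kappa>_def fract_der_to_fract[OF derivation_pderiv] pderiv_pCons)
    ultimately show ?thesis by blast
  qed
  show ?thesis
    unfolding rigid_def
  proof (intro allI impI)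
    fix g h assume *: "deg_less (l + m) g" "deg_less (l + m) h"
      "ruppert pderiv f g h = 0" "euler_coeff l m g h = 0"
    have "ruppert d F (fract_poly g) (fract_poly h) = 0"
      unfolding d_def F_def fract_poly_ruppert[OF derivation_pderiv] *(3) by simp
    then obtain c where c: "d c = 0" "F dvd fract_poly g - smult c (pderiv F)"
        "F dvd fract_poly h - smult c (map_poly d F)"
      using ruppert_solution_proportional[OF der F closed] by blast
    obtain x where x: "c = to_fract [:x:]" using const[OF c(1)] by (auto simp: \<kappa>_def)
    have dvd: "f dvd g - smult [:x:] (pderiv f)" "f dvd h - smult [:x:] (map_poly pderiv f)"
      using c(2,3) cont unfolding F_def x d_def fract_poly_der[OF derivation_pderiv]
        fract_poly_pderiv[symmetric] fract_poly_smult[symmetric] fract_poly_diff[symmetric]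
      by (blast intro: fract_poly_dvdD)+
    have small: "w = 0" if "f dvd w" "deg_less (l + m) w" for w
      using dvd_imp_total_degree2_le[OF that(1)] that(2) lm(1) by (cases "w = 0") (auto simp: deg_less_iff)
    have dl: "deg_less (l + m) (q - smult [:x:] q')"
      if "deg_less (l + m) q" "deg_less (l + m) q'" for q q' :: "'c poly poly"
      using that by (intro deg_less_diff deg_less_smult)
    have g: "g = smult [:x:] (pderiv f)"
      using small[OF dvd(1) dl[OF *(1)]] deg_less_pderiv[of f] lm(1) by simp
    have h: "h = smult [:x:] (map_poly pderiv f)"
      using small[OF dvd(2) dl[OF *(2)]] deg_less_map_pderiv[of f] lm(1) by simp
    have "x * (of_nat (l + m) * coeff2 f (l, m)) = 0"
      using *(4) ruppert_functional_smult[of l m f None x "pderiv f" "map_poly pderiv f"]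
      unfolding g h by (simp add: ruppert_functional_def euler_coeff_self)
    moreover have "total_degree2 f \<noteq> 0"
      using irr is_unit_poly_poly_iff[of f] by (auto simp: irreducible_def)
    then have "of_nat (l + m) \<noteq> (0 :: 'c)" using lm(1) by (simp del: of_nat_add)
    ultimately have "x = 0" using lm(2) by simp
    then show "g = 0 \<and> h = 0" by (simp add: g h)
  qed
qed

section \<open>Gauss's lemma relative to a factorial subring\<close>

text \<open>
  \<open>S\<close> is a subring that contains the divisors of its nonzero elements, with a size \<open>\<mu>\<close> that gives
  factorizations into irreducible elements, and with irreducible elements of \<open>S\<close> being prime as far
  as products in \<open>S\<close> are concerned. For polynomials in several variables such an \<open>S\<close> is the set of
  polynomials in a subset of the variables. Adding one variable at a time, unique
  factorization can then be proved by induction inside one type.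
\<close>

locale factorial_subring =
  fixes S :: "'a::idom set" and \<mu> :: "'a \<Rightarrow> nat"
  assumes zero_in: "0 \<in> S" and one_in: "1 \<in> S"
    and add_in: "a \<in> S \<Longrightarrow> b \<in> S \<Longrightarrow> a + b \<in> S"
    and mult_in: "a \<in> S \<Longrightarrow> b \<in> S \<Longrightarrow> a * b \<in> S"
    and uminus_in: "a \<in> S \<Longrightarrow> - a \<in> S"
    and saturated: "a * b \<in> S \<Longrightarrow> a * b \<noteq> 0 \<Longrightarrow> a \<in> S"
    and \<mu>_mult: "a \<noteq> 0 \<Longrightarrow> b \<noteq> 0 \<Longrightarrow> \<mu> (a * b) = \<mu> a + \<mu> b"
    and \<mu>_0: "a \<noteq> 0 \<Longrightarrow> \<mu> a = 0 \<Longrightarrow> a dvd 1"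
    and irreducible_prime: "p \<in> S \<Longrightarrow> irreducible p \<Longrightarrow>
          a \<in> S \<Longrightarrow> b \<in> S \<Longrightarrow> p dvd a * b \<Longrightarrow> p dvd a \<or> p dvd b"
begin

definition polys :: "'a poly set" where
  "polys = {p. \<forall>n. coeff p n \<in> S}"

lemma sum_in: "(\<And>x. x \<in> A \<Longrightarrow> f x \<in> S) \<Longrightarrow> sum f A \<in> S"
  by (induction A rule: infinite_finite_induct) (auto intro: zero_in add_in)

lemma diff_in: "a \<in> S \<Longrightarrow> b \<in> S \<Longrightarrow> a - b \<in> S"
  using add_in[of a "- b"] uminus_in by simp

lemma polys_zero: "0 \<in> polys" and polys_one: "1 \<in> polys"
  by (auto simp: polys_def zero_in one_in coeff_pCons one_pCons split: nat.split)

lemma polys_const: "[:c:] \<in> polys \<longleftrightarrow> c \<in> S"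
  by (auto simp: polys_def coeff_pCons zero_in split: nat.splits)

lemma polys_add: "p \<in> polys \<Longrightarrow> q \<in> polys \<Longrightarrow> p + q \<in> polys"
  and polys_diff: "p \<in> polys \<Longrightarrow> q \<in> polys \<Longrightarrow> p - q \<in> polys"
  and polys_mult: "p \<in> polys \<Longrightarrow> q \<in> polys \<Longrightarrow> p * q \<in> polys"
  and polys_smult: "c \<in> S \<Longrightarrow> p \<in> polys \<Longrightarrow> smult c p \<in> polys"
  by (auto simp: polys_def add_in diff_in mult_in coeff_mult zero_in intro!: sum_in)

lemma saturated': "a * b \<in> S \<Longrightarrow> a * b \<noteq> 0 \<Longrightarrow> b \<in> S"
  using saturated[of b a] by (simp add: mult.commute)

lemma polys_smultD:
  assumes "smult p c \<in> polys" "p \<noteq> 0"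
  shows "c \<in> polys"
  unfolding polys_def
proof (clarify)
  fix n
  have "p * coeff c n \<in> S" using assms(1) by (simp add: polys_def)
  then show "coeff c n \<in> S" using saturated'[of p "coeff c n"] assms(2) zero_in
    by (cases "coeff c n = 0") auto
qed

lemma irreducible_factor_exists:
  assumes "s \<in> S" "s \<noteq> 0" "\<not> s dvd 1"
  obtains p s' where "s = p * s'" "p \<in> S" "s' \<in> S" "irreducible p"
proof -
  have "\<exists>p s'. s = p * s' \<and> irreducible p"
    using assms(2,3)
  proof (induction "\<mu> s" arbitrary: s rule: less_induct)
    case less
    show ?case
    proof (cases "irreducible s")
      case True
      then show ?thesis by (metis mult.right_neutral)
    next
      case False
      then obtain a b where ab: "s = a * b" "\<not> a dvd 1" "\<not> b dvd 1"
        using less.prems by (auto simp: irreducible_def)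
      then have nz: "a \<noteq> 0" "b \<noteq> 0" using less.prems by auto
      then have "\<mu> a < \<mu> s" using \<mu>_0[of b] ab by (auto simp: \<mu>_mult)
      from less.hyps[OF this nz(1) ab(2)] show ?thesis
        unfolding ab(1) by (metis mult.assoc)
    qed
  qed
  then obtain p s' where "s = p * s'" "irreducible p" by blast
  moreover have "p \<in> S" "s' \<in> S"
    using saturated[of p s'] saturated'[of p s'] assms calculation(1) by auto
  ultimately show ?thesis using that by blast
qed

text \<open>
  If \<open>p\<close> divides neither factor, take the first coefficient of each that is not divisible by \<open>p\<close>; the
  coefficient of \<open>f g\<close> at the sum of their indices is not divisible by \<open>p\<close> either.
\<close>

lemma irreducible_imp_prime_on_polys:
  assumes p: "p \<in> S" "irreducible p" and fg: "f \<in> polys" "g \<in> polys"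
    and dvd: "[:p:] dvd f * g"
  shows "[:p:] dvd f \<or> [:p:] dvd g"
proof (rule ccontr)
  assume "\<not> ([:p:] dvd f \<or> [:p:] dvd g)"
  then have ex: "\<exists>n. \<not> p dvd coeff f n" "\<exists>n. \<not> p dvd coeff g n"
    by (auto simp: const_poly_dvd_iff)
  define a b where "a = (LEAST n. \<not> p dvd coeff f n)" and "b = (LEAST n. \<not> p dvd coeff g n)"
  have a: "\<not> p dvd coeff f a" "\<And>n. n < a \<Longrightarrow> p dvd coeff f n"
    unfolding a_def using LeastI_ex[OF ex(1)] not_less_Least by blast+
  have b: "\<not> p dvd coeff g b" "\<And>n. n < b \<Longrightarrow> p dvd coeff g n"
    unfolding b_def using LeastI_ex[OF ex(2)] not_less_Least by blast+
  have "coeff (f * g) (a + b) = coeff f a * coeff g b +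
      (\<Sum>i\<in>{..a + b} - {a}. coeff f i * coeff g (a + b - i))"
    unfolding coeff_mult by (subst sum.remove[of _ a]) auto
  moreover have "p dvd (\<Sum>i\<in>{..a + b} - {a}. coeff f i * coeff g (a + b - i))"
  proof (rule dvd_sum)
    fix i assume i: "i \<in> {..a + b} - {a}"
    show "p dvd coeff f i * coeff g (a + b - i)"
    proof (cases "i < a")
      case True
      then show ?thesis using a(2) by simp
    next
      case False
      with i have "a + b - i < b" by auto
      then show ?thesis using b(2) by simp
    qed
  qed
  moreover have "p dvd coeff (f * g) (a + b)" using dvd by (simp add: const_poly_dvd_iff)
  ultimately have "p dvd coeff f a * coeff g b" by (simp add: dvd_add_left_iff)
  with irreducible_prime[OF p] a(1) b(1) fg show False by (auto simp: polys_def)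
qed

definition primitive_in :: "'a poly \<Rightarrow> bool" where
  "primitive_in q \<longleftrightarrow> (\<forall>c. [:c:] dvd q \<longrightarrow> c \<in> S \<longrightarrow> c dvd 1)"

text \<open>
  Gauss's lemma: the prime factors of \<open>s\<close> do not divide the primitive \<open>q\<close>, so they divide \<open>c\<close> and can
  be cancelled one by one.
\<close>

lemma cancel_const:
  assumes "primitive_in q" "q \<in> polys"
    and "s \<in> S" "s \<noteq> 0" "c \<in> polys" "h \<in> polys" "q * c = smult s h"
  shows "\<exists>c'\<in>polys. q * c' = h"
  using assms(3-)
proof (induction "\<mu> s" arbitrary: s c rule: less_induct)
  case less
  show ?case
  proof (cases "s dvd 1")
    case True
    then obtain t where t: "s * t = 1" by (metis dvdE)
    then have "t \<in> S" using saturated'[of s t] one_in by simp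
    moreover have "q * smult t c = h"
      using arg_cong[OF less.prems(5), of "smult t"] t by (simp add: mult.commute)
    ultimately show ?thesis using less.prems polys_smult by blast
  next
    case False
    obtain p s' where p: "s = p * s'" "p \<in> S" "s' \<in> S" "irreducible p"
      using irreducible_factor_exists[OF less.prems(1,2) False] .
    have pnz: "p \<noteq> 0" "s' \<noteq> 0" using p(1) less.prems(2) by auto
    have punit: "\<not> p dvd 1" using p(4) by (simp add: irreducible_def)
    have "q * c = [:p:] * smult s' h" unfolding less.prems(5) p(1) by (simp add: mult.commute)
    then have "[:p:] dvd q * c" by (rule dvdI)
    moreover have "\<not> [:p:] dvd q" using assms(1) p(2) punit by (auto simp: primitive_in_def)
    ultimately have "[:p:] dvd c"
      using irreducible_imp_prime_on_polys[OF p(2,4) assms(2) less.prems(3)] by blast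
    then obtain c' where c': "c = smult p c'" by (auto elim: dvdE)
    have "c' \<in> polys" using less.prems(3) pnz(1) polys_smultD by (simp add: c')
    moreover have "q * c' = smult s' h"
    proof -
      have "smult p (q * c') = smult p (smult s' h)" using less.prems(5) by (simp add: c' p(1) mult.commute)
      then have "[:p:] * (q * c') = [:p:] * smult s' h" by (simp add: mult.commute)
      then show ?thesis using pnz(1) by (metis mult_left_cancel pCons_eq_0_iff)
    qed
    moreover have "\<mu> s' < \<mu> s"
      using \<mu>_0[OF pnz(1)] punit pnz by (auto simp: p(1) \<mu>_mult)
    ultimately show ?thesis using less.hyps p(3) pnz(2) less.prems(4) by blast
  qed
qed

lemma primitive_part_exists:
  assumes "r \<in> polys" "r \<noteq> 0"
  obtains c r0 where "c \<in> S" "c \<noteq> 0" "r0 \<in> polys" "primitive_in r0" "r = smult c r0"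
proof -
  have "\<exists>c r0. c \<in> S \<and> c \<noteq> 0 \<and> r0 \<in> polys \<and> primitive_in r0 \<and> r = smult c r0"
    using assms
  proof (induction "\<mu> (lead_coeff r)" arbitrary: r rule: less_induct)
    case less
    show ?case
    proof (cases "primitive_in r")
      case True
      then show ?thesis using less.prems one_in by (intro exI[of _ 1] exI[of _ r]) auto
    next
      case False
      then obtain p where p: "[:p:] dvd r" "p \<in> S" "\<not> p dvd 1" by (auto simp: primitive_in_def)
      then obtain r' where r': "r = smult p r'" by (auto elim: dvdE)
      then have nz: "p \<noteq> 0" "r' \<noteq> 0" using less.prems(2) by auto
      have "r' \<in> polys" using less.prems(1) nz(1) polys_smultD by (simp add: r')
      moreover have "\<mu> (lead_coeff r') < \<mu> (lead_coeff r)"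
        using \<mu>_0[OF nz(1)] p(3) nz by (auto simp: r' \<mu>_mult)
      ultimately obtain c r0 where "c \<in> S" "c \<noteq> 0" "r0 \<in> polys" "primitive_in r0" "r' = smult c r0"
        using less.hyps nz(2) by blast
      then show ?thesis using p(2) nz(1) by (intro exI[of _ "p * c"] exI[of _ r0]) (auto simp: r' mult_in)
    qed
  qed
  then show ?thesis using that by blast
qed

text \<open>
  Pseudo-division by an element \<open>r\<close> of least degree of an ideal leaves no remainder.
\<close>

lemma pseudo_multiple:
  assumes sub: "\<And>a b w w'. a \<in> polys \<Longrightarrow> b \<in> polys \<Longrightarrow> w \<in> W \<Longrightarrow> w' \<in> W \<Longrightarrow> a * w - b * w' \<in> W"
    and W: "W \<subseteq> polys" and r: "r \<in> W" "r \<noteq> 0" "\<And>w. w \<in> W \<Longrightarrow> w \<noteq> 0 \<Longrightarrow> degree r \<le> degree w"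
    and w: "w \<in> W"
  shows "\<exists>s\<in>S. \<exists>t\<in>polys. s \<noteq> 0 \<and> smult s w = r * t"
  using w
proof (induction "degree w" arbitrary: w rule: less_induct)
  case less
  show ?case
  proof (cases "w = 0")
    case True
    then show ?thesis using one_in polys_zero by (intro bexI[of _ 1] bexI[of _ 0]) auto
  next
    case False
    define k where "k = degree w - degree r"
    define w1 where "w1 = smult (lead_coeff r) w - monom (lead_coeff w) k * r"
    have le: "degree r \<le> degree w" using r(3) less.prems False by blast
    have cS: "lead_coeff r \<in> S" "monom (lead_coeff w) k \<in> polys"
      using r(1) less.prems W by (auto simp: polys_def zero_in)
    have "[:lead_coeff r:] * w - monom (lead_coeff w) k * r \<in> W"
      by (rule sub) (use cS less.prems r(1) in \<open>auto simp: polys_const\<close>)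
    then have w1W: "w1 \<in> W" by (simp add: w1_def)
    have "w1 = 0 \<or> degree w1 < degree w"
    proof (cases "w1 = 0")
      case nz: False
      have "degree (monom (lead_coeff w) k * r) = degree w"
        using False r(2) le by (subst degree_mult_eq) (auto simp: degree_monom_eq k_def)
      then have "degree w1 \<le> degree w" unfolding w1_def
        by (intro degree_diff_le) auto
      moreover have "coeff w1 (degree w) = 0"
        using le by (simp add: w1_def coeff_monom_mult k_def)
      ultimately show ?thesis using nz by (metis le_neq_implies_less leading_coeff_0_iff)
    qed simp
    then obtain s t where st: "s \<in> S" "t \<in> polys" "s \<noteq> 0" "smult s w1 = r * t"
      using less.hyps[of w1] w1W one_in polys_zero by (metis mult_zero_right smult_0_right zero_neq_one)
    have "smult (s * lead_coeff r) w = r * (t + smult s (monom (lead_coeff w) k))"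
      using st(4) by (simp add: w1_def smult_diff_right algebra_simps flip: smult_smult)
    moreover have "s * lead_coeff r \<in> S" "s * lead_coeff r \<noteq> 0"
      using st cS r(2) by (auto simp: mult_in)
    moreover have "t + smult s (monom (lead_coeff w) k) \<in> polys"
      using st cS by (intro polys_add polys_smult)
    ultimately show ?thesis by blast
  qed
qed

text \<open>
  Let \<open>r\<close> be an element of least degree in the ideal generated by \<open>f\<close> and \<open>q\<close>, and \<open>r0\<close> its primitive
  part. By pseudo-division and \<open>cancel_const\<close>, \<open>r0\<close> divides both \<open>f\<close> and \<open>q\<close>. As \<open>q\<close> is irreducible,
  either \<open>r0\<close> is associated to \<open>q\<close>, and \<open>q\<close> divides \<open>f\<close>; or \<open>r0\<close> is a unit, so that \<open>r\<close> is a constant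
  \<open>\<rho> = a f + b q\<close>. Then \<open>q\<close> divides \<open>\<rho> g = a f g + b q g\<close>, hence \<open>g\<close>.
\<close>

lemma irreducible_poly_prime:
  assumes q: "q \<in> polys" "q \<noteq> 0"
    and irr: "\<And>a b. a \<in> polys \<Longrightarrow> b \<in> polys \<Longrightarrow> q = a * b \<Longrightarrow> a dvd 1 \<or> b dvd 1"
    and pos: "0 < degree q"
    and fg: "f \<in> polys" "g \<in> polys" "c \<in> polys" "f * g = q * c"
  shows "(\<exists>c\<in>polys. f = q * c) \<or> (\<exists>c\<in>polys. g = q * c)"
proof -
  have prim: "primitive_in q"
    unfolding primitive_in_def
  proof (intro allI impI)
    fix p assume "[:p:] dvd q" and p: "p \<in> S"
    then obtain q' where q': "q = [:p:] * q'" by (elim dvdE)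
    then have nz: "p \<noteq> 0" using q(2) by auto
    have "q' \<in> polys" using q(1) nz polys_smultD by (simp add: q')
    then have "[:p:] dvd 1 \<or> q' dvd 1" using irr[OF _ _ q'] p by (simp add: polys_const)
    moreover have "\<not> q' dvd 1"
    proof
      assume "q' dvd 1"
      then have "degree q' = 0" by (auto simp: is_unit_poly_iff)
      with q' pos show False by (simp split: if_splits)
    qed
    ultimately show "p dvd 1" by (simp add: is_unit_const_poly_iff)
  qed
  define W where "W = {a * f + b * q |a b. a \<in> polys \<and> b \<in> polys}"
  have WI: "a * f + b * q \<in> W" if "a \<in> polys" "b \<in> polys" for a b using that by (auto simp: W_def)
  have Wsub: "W \<subseteq> polys" using q fg by (auto simp: W_def intro!: polys_add polys_mult)
  have fW: "f \<in> W" and qW: "q \<in> W" using WI[of 1 0] WI[of 0 1] polys_zero polys_one by auto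
  have sub: "x * w - y * w' \<in> W" if x: "x \<in> polys" "y \<in> polys" "w \<in> W" "w' \<in> W" for x y w w'
  proof -
    obtain a b a' b' where ab: "w = a * f + b * q" "w' = a' * f + b' * q"
      "a \<in> polys" "b \<in> polys" "a' \<in> polys" "b' \<in> polys"
      using x(3,4) unfolding W_def by blast
    have "x * w - y * w' = (x * a - y * a') * f + (x * b - y * b') * q"
      by (simp add: ab algebra_simps)
    also have "\<dots> \<in> W" using x(1,2) ab by (intro WI polys_diff polys_mult)
    finally show ?thesis .
  qed
  obtain r where r: "r \<in> W" "r \<noteq> 0" "\<And>w. w \<in> W \<Longrightarrow> w \<noteq> 0 \<Longrightarrow> degree r \<le> degree w"
  proof -
    let ?P = "\<lambda>n. \<exists>w. w \<in> W \<and> w \<noteq> 0 \<and> degree w = n"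
    have "?P (degree q)" using qW q(2) by blast
    then have "?P (LEAST n. ?P n)" by (rule LeastI)
    then obtain r where "r \<in> W" "r \<noteq> 0" "degree r = (LEAST n. ?P n)" by blast
    moreover have "(LEAST n. ?P n) \<le> degree w" if "w \<in> W" "w \<noteq> 0" for w
      by (rule Least_le) (use that in blast)
    ultimately show ?thesis using that by metis
  qed
  obtain c0 r0 where r0: "c0 \<in> S" "c0 \<noteq> 0" "r0 \<in> polys" "primitive_in r0" "r = smult c0 r0"
    using primitive_part_exists[of r] r(1,2) Wsub by blast
  have r0_dvd: "\<exists>e\<in>polys. r0 * e = w" if wW: "w \<in> W" for w
  proof -
    obtain s t where st: "s \<in> S" "t \<in> polys" "s \<noteq> 0" "smult s w = r * t"
      using pseudo_multiple[OF sub Wsub r wW] by blast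
    have "r0 * smult c0 t = smult s w" using st(4) by (simp add: r0(5))
    then show ?thesis
      using cancel_const[OF r0(4,3) st(1,3)] polys_smult[OF r0(1) st(2)] wW Wsub by blast
  qed
  obtain e where e: "e \<in> polys" "q = r0 * e" using r0_dvd[OF qW] by metis
  obtain e' where e': "e' \<in> polys" "f = r0 * e'" using r0_dvd[OF fW] by metis
  have "r0 dvd 1 \<or> e dvd 1" by (rule irr[OF r0(3) e(1) e(2)])
  then show ?thesis
  proof
    assume "e dvd 1"
    then obtain i where i: "e * i = 1" by (metis dvdE)
    obtain j where j: "e = [:j:]" "j dvd 1" using \<open>e dvd 1\<close> by (auto simp: is_unit_poly_iff)
    obtain j' where j': "j * j' = 1" using j(2) by (metis dvdE)
    have "j \<in> S" using e(1) by (simp add: j polys_const)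
    then have "j' \<in> S" using saturated'[of j j'] j' one_in by simp
    have "r0 = q * [:j':]" using j' by (simp add: e(2) j mult.commute)
    then have "f = q * ([:j':] * e')" using e'(2) by (simp add: mult.assoc)
    moreover have "[:j':] * e' \<in> polys" using \<open>j' \<in> S\<close> e'(1) by (intro polys_mult) (auto simp: polys_const)
    ultimately show ?thesis by blast
  next
    assume "r0 dvd 1"
    then obtain j where j: "r0 = [:j:]" "j dvd 1" by (auto simp: is_unit_poly_iff)
    define \<rho> where "\<rho> = c0 * j"
    have rr: "r = [:\<rho>:]" by (simp add: r0(5) j \<rho>_def)
    have "\<rho> \<noteq> 0" using rr r(2) by auto
    have "\<rho> \<in> S" using r(1) Wsub by (auto simp: rr polys_const)
    obtain a b where ab: "[:\<rho>:] = a * f + b * q" "a \<in> polys" "b \<in> polys"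
      using r(1) unfolding rr W_def by auto
    have "smult \<rho> g = [:\<rho>:] * g" by simp
    also have "\<dots> = a * (f * g) + b * q * g" unfolding ab(1) by (simp add: algebra_simps)
    also have "\<dots> = q * (a * c + b * g)" unfolding fg(4) by (simp add: algebra_simps)
    finally have "q * (a * c + b * g) = smult \<rho> g" by simp
    moreover have "a * c + b * g \<in> polys" using ab fg by (intro polys_add polys_mult)
    ultimately obtain c' where "c' \<in> polys" "q * c' = g"
      using cancel_const[OF prim q(1) \<open>\<rho> \<in> S\<close> \<open>\<rho> \<noteq> 0\<close> _ fg(2)] by blast
    then show ?thesis by blast
  qed
qed

end

section \<open>Multivariate polynomials\<close>

lemma poly_mapping_sum_single: "p = (\<Sum>t\<in>Poly_Mapping.keys p. Poly_Mapping.single t (Poly_Mapping.lookup p t))"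
  by (rule poly_mapping_eqI)
     (auto simp: lookup_sum lookup_single when_def in_keys_iff sum.delta)

lemma sum_keys_superset:
  fixes f :: "'t \<Rightarrow> 'a::comm_monoid_add \<Rightarrow> 'b::comm_monoid_add"
  assumes "finite T" "Poly_Mapping.keys p \<subseteq> T" "\<And>t. f t 0 = 0"
  shows "(\<Sum>t\<in>Poly_Mapping.keys p. f t (Poly_Mapping.lookup p t)) =
         (\<Sum>t\<in>T. f t (Poly_Mapping.lookup p t))"
  using assms by (intro sum.mono_neutral_left) (auto simp: in_keys_iff)

text \<open>
  Both \<open>mpoly_eval\<close> and \<open>expand_mpoly\<close> are sums of this form.
\<close>

lemma sum_keys_add:
  fixes f :: "'t \<Rightarrow> 'a::comm_monoid_add \<Rightarrow> 'b::comm_monoid_add"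
  assumes "\<And>t. f t 0 = 0" "\<And>t a b. f t (a + b) = f t a + f t b"
  shows "(\<Sum>t\<in>Poly_Mapping.keys (p + q). f t (Poly_Mapping.lookup (p + q) t)) =
     (\<Sum>t\<in>Poly_Mapping.keys p. f t (Poly_Mapping.lookup p t)) +
     (\<Sum>t\<in>Poly_Mapping.keys q. f t (Poly_Mapping.lookup q t))"
proof -
  let ?T = "Poly_Mapping.keys p \<union> Poly_Mapping.keys q"
  have T: "finite ?T" "Poly_Mapping.keys (p + q) \<subseteq> ?T" "Poly_Mapping.keys p \<subseteq> ?T"
    "Poly_Mapping.keys q \<subseteq> ?T" by (auto dest: keys_add[THEN subsetD])
  show ?thesis
    using sum_keys_superset[of ?T p f, OF T(1,3) assms(1)] sum_keys_superset[of ?T q f, OF T(1,4) assms(1)]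
      sum_keys_superset[of ?T "p + q" f, OF T(1,2) assms(1)]
    by (simp add: lookup_add assms(2) sum.distrib)
qed

lemma cring_hom_poly_mappingI:
  fixes \<Phi> :: "('t::comm_monoid_add \<Rightarrow>\<^sub>0 'a::comm_ring_1) \<Rightarrow> 'b::comm_ring_1"
  assumes add: "\<And>p q. \<Phi> (p + q) = \<Phi> p + \<Phi> q"
    and mult: "\<And>s t a b. \<Phi> (Poly_Mapping.single (s + t) (a * b)) =
               \<Phi> (Poly_Mapping.single s a) * \<Phi> (Poly_Mapping.single t b)"
    and one: "\<Phi> (Poly_Mapping.single 0 1) = 1"
  shows "cring_hom \<Phi>"
proof
  fix p q :: "'t \<Rightarrow>\<^sub>0 'a"
  have zero: "\<Phi> 0 = 0" using add[of 0 0] by simp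
  have sum: "\<Phi> (sum f A) = (\<Sum>x\<in>A. \<Phi> (f x))" for f :: "'c \<Rightarrow> _" and A
    by (induction A rule: infinite_finite_induct) (auto simp: add zero)
  let ?m = "\<lambda>p t. Poly_Mapping.single t (Poly_Mapping.lookup p t)"
  have decomp: "\<Phi> p = (\<Sum>s\<in>Poly_Mapping.keys p. \<Phi> (?m p s))" for p
    using arg_cong[OF poly_mapping_sum_single[of p], of \<Phi>] unfolding sum .
  have "p * q = (\<Sum>s\<in>Poly_Mapping.keys p. \<Sum>t\<in>Poly_Mapping.keys q. ?m p s * ?m q t)"
    using arg_cong2[OF poly_mapping_sum_single[of p] poly_mapping_sum_single[of q], of "(*)"]
    unfolding sum_product .
  then have "\<Phi> (p * q) =
      (\<Sum>s\<in>Poly_Mapping.keys p. \<Sum>t\<in>Poly_Mapping.keys q. \<Phi> (?m p s) * \<Phi> (?m q t))"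
    by (simp add: sum mult_single mult)
  also have "\<dots> = \<Phi> p * \<Phi> q"
    unfolding decomp[of p] decomp[of q] sum_product ..
  finally show "\<Phi> (p * q) = \<Phi> p * \<Phi> q" .
  show "\<Phi> (p + q) = \<Phi> p + \<Phi> q" by (rule add)
  show "\<Phi> 1 = 1" using one by simp
qed

lemma cring_hom_mpoly_eval:
  assumes "cring_hom h"
  shows "cring_hom (mpoly_eval h x)"
proof -
  interpret cring_hom h by fact
  let ?mon = "\<lambda>t. \<Prod>v\<in>Poly_Mapping.keys t. x v ^ Poly_Mapping.lookup t v"
  have single: "mpoly_eval h x (Poly_Mapping.single t c) = h c * ?mon t" for t c
    by (cases "c = 0") (simp_all add: mpoly_eval_def)
  have mon: "?mon t = (\<Prod>v\<in>T. x v ^ Poly_Mapping.lookup t v)"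
    if "finite T" "Poly_Mapping.keys t \<subseteq> T" for t T
    using that by (intro prod.mono_neutral_left) (auto simp: in_keys_iff)
  have mon_add: "?mon (s + t) = ?mon s * ?mon t" for s t
  proof -
    let ?T = "Poly_Mapping.keys s \<union> Poly_Mapping.keys t"
    have T: "finite ?T" "Poly_Mapping.keys (s + t) \<subseteq> ?T" "Poly_Mapping.keys s \<subseteq> ?T"
      "Poly_Mapping.keys t \<subseteq> ?T" by (auto dest: keys_add[THEN subsetD])
    show ?thesis
      unfolding mon[OF T(1,2)] mon[OF T(1,3)] mon[OF T(1,4)]
      by (simp add: lookup_add power_add prod.distrib)
  qed
  show ?thesis
  proof (rule cring_hom_poly_mappingI)
    show "mpoly_eval h x (p + q) = mpoly_eval h x p + mpoly_eval h x q" for p q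
      unfolding mpoly_eval_def
      by (rule sum_keys_add) (simp_all add: hom_add algebra_simps)
    show "mpoly_eval h x (Poly_Mapping.single (s + t) (a * b)) =
        mpoly_eval h x (Poly_Mapping.single s a) * mpoly_eval h x (Poly_Mapping.single t b)" for s t a b
      unfolding single mon_add hom_mult by (simp add: algebra_simps)
    show "mpoly_eval h x (Poly_Mapping.single 0 1) = 1" unfolding single by simp
  qed
qed

lemma expand_mpoly_single:
  "expand_mpoly i (Poly_Mapping.single t c) =
     monom (Poly_Mapping.single (Poly_Mapping.update i 0 t) c) (Poly_Mapping.lookup t i)"
  by (cases "c = 0") (simp_all add: expand_mpoly_def)

lemma update_0_add:
  "Poly_Mapping.update i 0 (s + t) = Poly_Mapping.update i 0 s + Poly_Mapping.update i (0::nat) t"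
  by (rule poly_mapping_eqI) (simp add: lookup_update lookup_add)

lemma update_0_plus_single:
  "Poly_Mapping.update i 0 t + Poly_Mapping.single i (Poly_Mapping.lookup t i) = (t :: 'i \<Rightarrow>\<^sub>0 nat)"
  by (rule poly_mapping_eqI) (simp add: lookup_update lookup_add lookup_single when_def)

lemma update_0_eq_self: "Poly_Mapping.lookup t i = 0 \<Longrightarrow> Poly_Mapping.update i 0 t = (t :: 'i \<Rightarrow>\<^sub>0 nat)"
  by (rule poly_mapping_eqI) (auto simp: lookup_update)

lemma expand_mpoly_add: "expand_mpoly i (p + q) = expand_mpoly i p + expand_mpoly i q"
  unfolding expand_mpoly_def
  by (rule sum_keys_add) (simp_all add: single_add add_monom)

lemma cring_hom_expand_mpoly:
  "cring_hom (expand_mpoly i :: ('i, 'k::comm_ring_1) mpoly \<Rightarrow> _)"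
proof (rule cring_hom_poly_mappingI)
  show "expand_mpoly i (p + q) = expand_mpoly i p + expand_mpoly i q" for p q :: "('i, 'k) mpoly"
    by (rule expand_mpoly_add)
  show "expand_mpoly i (Poly_Mapping.single (s + t) (a * b)) =
      expand_mpoly i (Poly_Mapping.single s a) * expand_mpoly i (Poly_Mapping.single t b)"
    for s t and a b :: 'k
    by (simp add: expand_mpoly_single update_0_add mult_monom mult_single lookup_add)
  have "Poly_Mapping.update i 0 0 = (0 :: 'i \<Rightarrow>\<^sub>0 nat)"
    by (rule update_0_eq_self) simp
  then show "expand_mpoly i (Poly_Mapping.single 0 1) = (1 :: ('i, 'k) mpoly poly)"
    by (simp add: expand_mpoly_single monom_0 del: single_one) (simp add: one_pCons)
qed

interpretation expand_hom: cring_hom "expand_mpoly i :: ('i, 'k::comm_ring_1) mpoly \<Rightarrow> _" for i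
  by (rule cring_hom_expand_mpoly)

text \<open>
  Substituting this variable for \<open>Z\<close> is inverse to \<open>expand_mpoly i\<close>; this is how derivatives,
  divisibility and degrees in \<open>X\<^sub>i\<close> are reduced to univariate polynomials.
\<close>

definition mvar :: "'i \<Rightarrow> ('i, 'k::comm_ring_1) mpoly" where
  "mvar i = Poly_Mapping.single (Poly_Mapping.single i 1) 1"

lemma mvar_power: "mvar i ^ n = Poly_Mapping.single (Poly_Mapping.single i n) 1"
  by (induction n) (simp_all add: mvar_def mult_single flip: single_add)

lemma cring_hom_poly_eval: "cring_hom (\<lambda>p. poly p (x :: 'a::comm_ring_1))"
  by unfold_locales simp_all

lemma poly_expand_mpoly [simp]: "poly (expand_mpoly i p) (mvar i) = (p :: ('i, 'k::comm_ring_1) mpoly)"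
proof -
  have "poly (expand_mpoly i p) (mvar i) = (\<Sum>t\<in>Poly_Mapping.keys p.
      Poly_Mapping.single t (Poly_Mapping.lookup p t))"
    unfolding expand_mpoly_def
    by (simp add: poly_sum poly_monom mvar_power mult_single update_0_plus_single)
  then show ?thesis using poly_mapping_sum_single[of p] by simp
qed

lemma expand_mpoly_eq_iff: "expand_mpoly i p = expand_mpoly i q \<longleftrightarrow> p = (q :: ('i, 'k::comm_ring_1) mpoly)"
  using poly_expand_mpoly by metis

lemma expand_mvar: "expand_mpoly i (mvar i) = ([:0, 1:] :: ('i, 'k::comm_ring_1) mpoly poly)"
proof -
  have "Poly_Mapping.update i 0 (Poly_Mapping.single i 1) = (0 :: 'i \<Rightarrow>\<^sub>0 nat)"
    by (rule poly_mapping_eqI) (simp add: lookup_update lookup_single when_def)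
  then show ?thesis by (simp add: mvar_def expand_mpoly_single monom_Suc monom_0)
qed

lemma keys_coeff_expand:
  assumes "t \<in> Poly_Mapping.keys (coeff (expand_mpoly i p) n)"
  obtains s where "s \<in> Poly_Mapping.keys p" "t = Poly_Mapping.update i 0 s" "Poly_Mapping.lookup s i = n"
proof -
  have "coeff (expand_mpoly i p) n = (\<Sum>s\<in>Poly_Mapping.keys p. if Poly_Mapping.lookup s i = n then
      Poly_Mapping.single (Poly_Mapping.update i 0 s) (Poly_Mapping.lookup p s) else 0)"
    by (simp add: expand_mpoly_def coeff_sum)
  then have "(\<Sum>s\<in>Poly_Mapping.keys p. Poly_Mapping.lookup (if Poly_Mapping.lookup s i = n then
      Poly_Mapping.single (Poly_Mapping.update i 0 s) (Poly_Mapping.lookup p s) else 0) t) \<noteq> 0"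
    using assms by (simp add: in_keys_iff lookup_sum)
  then obtain s where "s \<in> Poly_Mapping.keys p" "Poly_Mapping.lookup (if Poly_Mapping.lookup s i = n then
      Poly_Mapping.single (Poly_Mapping.update i 0 s) (Poly_Mapping.lookup p s) else 0) t \<noteq> 0"
    by (meson sum.neutral)
  then show ?thesis using that by (auto simp: lookup_single when_def split: if_splits)
qed

lemma in_mpoly_vars_iff: "i \<in> mpoly_vars p \<longleftrightarrow> (\<exists>t\<in>Poly_Mapping.keys p. Poly_Mapping.lookup t i \<noteq> 0)"
  by (auto simp: mpoly_vars_def in_keys_iff)

lemma mpoly_vars_coeff_expand:
  "mpoly_vars (coeff (expand_mpoly i p) n) \<subseteq> mpoly_vars p - {i}"
proof
  fix j assume "j \<in> mpoly_vars (coeff (expand_mpoly i p) n)"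
  then obtain t where t: "t \<in> Poly_Mapping.keys (coeff (expand_mpoly i p) n)" "Poly_Mapping.lookup t j \<noteq> 0"
    by (auto simp: in_mpoly_vars_iff)
  obtain s where "s \<in> Poly_Mapping.keys p" "t = Poly_Mapping.update i 0 s"
    using t(1) by (rule keys_coeff_expand)
  then show "j \<in> mpoly_vars p - {i}"
    using t(2) by (auto simp: in_mpoly_vars_iff lookup_update split: if_splits)
qed

lemma expand_mpoly_const_iff: "expand_mpoly i p = [:p:] \<longleftrightarrow> i \<notin> mpoly_vars p"
  for p :: "('i, 'k::comm_ring_1) mpoly"
proof
  assume "expand_mpoly i p = [:p:]"
  then have "coeff (expand_mpoly i p) 0 = p" by simp
  with mpoly_vars_coeff_expand[of i p 0] show "i \<notin> mpoly_vars p" by auto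
next
  assume i: "i \<notin> mpoly_vars p"
  have "expand_mpoly i p = (\<Sum>t\<in>Poly_Mapping.keys p. [:Poly_Mapping.single t (Poly_Mapping.lookup p t):])"
    unfolding expand_mpoly_def
    using i by (intro sum.cong) (auto simp: in_mpoly_vars_iff update_0_eq_self monom_0)
  also have "\<dots> = [:\<Sum>t\<in>Poly_Mapping.keys p. Poly_Mapping.single t (Poly_Mapping.lookup p t):]"
    by (rule poly_eqI) (simp add: coeff_sum coeff_pCons split: nat.split)
  finally show "expand_mpoly i p = [:p:]" using poly_mapping_sum_single[of p] by simp
qed

lemma expand_const: "i \<notin> mpoly_vars p \<Longrightarrow> expand_mpoly i p = [:p:]"
  for p :: "('i, 'k::comm_ring_1) mpoly"
  by (simp add: expand_mpoly_const_iff)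

lemma expand_poly_mvar:
  fixes q :: "('i, 'k::comm_ring_1) mpoly poly"
  assumes "\<And>n. i \<notin> mpoly_vars (coeff q n)"
  shows "expand_mpoly i (poly q (mvar i)) = q"
  using assms
proof (induction q)
  case (pCons a q)
  have "i \<notin> mpoly_vars a" "\<And>n. i \<notin> mpoly_vars (coeff q n)"
    using pCons.prems[of 0] pCons.prems[of "Suc _"] by simp_all
  then show ?case
    by (simp add: expand_hom.hom_add expand_hom.hom_mult expand_mvar expand_const pCons.IH)
qed simp

lemma coeff_expand_free: "i \<notin> mpoly_vars (coeff (expand_mpoly i p) n)"
  using mpoly_vars_coeff_expand[of i p n] by auto

lemma mpoly_vars_add: "mpoly_vars (p + q) \<subseteq> mpoly_vars p \<union> mpoly_vars q"
  using keys_add[of p q] by (auto simp: mpoly_vars_def)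

lemma mpoly_vars_uminus: "mpoly_vars (- p) = mpoly_vars (p :: ('i, 'k::comm_ring_1) mpoly)"
  by (auto simp: in_mpoly_vars_iff in_keys_iff)

lemma mpoly_vars_mult: "mpoly_vars (p * q) \<subseteq> mpoly_vars p \<union> mpoly_vars (q :: ('i, 'k::comm_ring_1) mpoly)"
proof
  fix i assume i: "i \<in> mpoly_vars (p * q)"
  show "i \<in> mpoly_vars p \<union> mpoly_vars q"
  proof (rule ccontr)
    assume "i \<notin> mpoly_vars p \<union> mpoly_vars q"
    then have "expand_mpoly i (p * q) = [:p * q:]" by (simp add: expand_hom.hom_mult expand_const mult.commute)
    with i show False by (simp add: expand_mpoly_const_iff)
  qed
qed

lemma mpoly_vars_single_0: "mpoly_vars (Poly_Mapping.single 0 c) = {}"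
  by (cases "c = 0") (auto simp: in_mpoly_vars_iff)

lemma mpoly_vars_0 [simp]: "mpoly_vars 0 = {}" and mpoly_vars_1 [simp]: "mpoly_vars 1 = {}"
  by (auto simp: in_mpoly_vars_iff)

lemma mpoly_vars_empty:
  assumes "mpoly_vars p = {}"
  obtains c where "p = Poly_Mapping.single 0 c"
proof -
  have "Poly_Mapping.keys p \<subseteq> {0}"
  proof
    fix t assume "t \<in> Poly_Mapping.keys p"
    then have "Poly_Mapping.keys t = {}" using assms by (auto simp: mpoly_vars_def)
    then have "t = 0" by (intro poly_mapping_eqI) (auto simp: in_keys_iff)
    then show "t \<in> {0}" by simp
  qed
  then have "p = Poly_Mapping.single 0 (Poly_Mapping.lookup p 0)"
    by (intro poly_mapping_eqI) (auto simp: lookup_single when_def in_keys_iff)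
  then show ?thesis by (rule that)
qed

section \<open>Unique factorization\<close>

lemma degree_expand_eq_0_iff: "degree (expand_mpoly i p) = 0 \<longleftrightarrow> i \<notin> mpoly_vars p"
  for p :: "('i, 'k::comm_ring_1) mpoly"
proof
  assume "degree (expand_mpoly i p) = 0"
  then obtain c where c: "expand_mpoly i p = [:c:]" by (auto elim: degree_eq_zeroE)
  then have "p = c" using poly_expand_mpoly[of i p] by simp
  with c show "i \<notin> mpoly_vars p" by (simp add: expand_mpoly_const_iff flip: expand_mpoly_const_iff)
qed (simp add: expand_const)

lemma degree_expand_mult:
  fixes p q :: "('i::linorder, 'k::idom) mpoly"
  assumes "p \<noteq> 0" "q \<noteq> 0"
  shows "degree (expand_mpoly i (p * q)) = degree (expand_mpoly i p) + degree (expand_mpoly i q)"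
proof -
  have "expand_mpoly i p \<noteq> 0" "expand_mpoly i q \<noteq> 0"
    using assms expand_mpoly_eq_iff[of i _ 0] by auto
  then show ?thesis by (simp add: expand_hom.hom_mult degree_mult_eq)
qed

lemma mpoly_vars_factor:
  fixes p q :: "('i::linorder, 'k::idom) mpoly"
  assumes "p * q \<noteq> 0"
  shows "mpoly_vars p \<subseteq> mpoly_vars (p * q)"
proof
  fix i assume i: "i \<in> mpoly_vars p"
  show "i \<in> mpoly_vars (p * q)"
    using assms i degree_expand_mult[of p q i] degree_expand_eq_0_iff[of i p]
      degree_expand_eq_0_iff[of i "p * q"] by auto
qed

text \<open>
  A size that is additive on products of nonzero polynomials and zero only for constants.
\<close>

definition mpoly_size :: "('i::finite, 'k::comm_ring_1) mpoly \<Rightarrow> nat" where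
  "mpoly_size p = (\<Sum>i\<in>UNIV. degree (expand_mpoly i p))"

lemma mpoly_const_unit:
  fixes p :: "('i, 'k::field) mpoly"
  assumes "mpoly_vars p = {}" "p \<noteq> 0"
  shows "p dvd 1"
proof -
  obtain c where c: "p = Poly_Mapping.single 0 c" using assms(1) by (rule mpoly_vars_empty)
  then have "c \<noteq> 0" using assms(2) by auto
  then have "p * Poly_Mapping.single 0 (inverse c) = 1" by (simp add: c mult_single)
  then show ?thesis by (metis dvdI)
qed

lemma factorial_subring_mpoly:
  fixes J :: "'i::{finite,linorder} set"
  assumes "\<And>p a b :: ('i, 'k::field) mpoly. mpoly_vars p \<subseteq> J \<Longrightarrow> irreducible p \<Longrightarrow>
      mpoly_vars a \<subseteq> J \<Longrightarrow> mpoly_vars b \<subseteq> J \<Longrightarrow> p dvd a * b \<Longrightarrow> p dvd a \<or> p dvd b"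
  shows "factorial_subring {p :: ('i, 'k) mpoly. mpoly_vars p \<subseteq> J} mpoly_size"
proof
  fix a b :: "('i, 'k) mpoly"
  let ?S = "{p :: ('i, 'k) mpoly. mpoly_vars p \<subseteq> J}"
  show "0 \<in> ?S" "1 \<in> ?S" by auto
  show "a + b \<in> ?S" "a * b \<in> ?S" if "a \<in> ?S" "b \<in> ?S"
    using that mpoly_vars_add[of a b] mpoly_vars_mult[of a b] by auto
  show "- a \<in> ?S" if "a \<in> ?S" using that by (simp add: mpoly_vars_uminus)
  show "a \<in> ?S" if "a * b \<in> ?S" "a * b \<noteq> 0" using that mpoly_vars_factor[of a b] by auto
  show "mpoly_size (a * b) = mpoly_size a + mpoly_size b" if "a \<noteq> 0" "b \<noteq> 0"
    using that by (simp add: mpoly_size_def degree_expand_mult sum.distrib)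
  show "a dvd 1" if "a \<noteq> 0" "mpoly_size a = 0"
    by (rule mpoly_const_unit) (use that in \<open>auto simp: mpoly_size_def degree_expand_eq_0_iff\<close>)
qed (use assms in auto)

text \<open>
  Induction on the set \<open>J\<close> of variables that occur: \<open>expand_mpoly i\<close> identifies the polynomials in
  \<open>J \<union> {i}\<close> with the univariate polynomials over those in \<open>J\<close>, to which Gauss's lemma applies.
\<close>

lemma irreducible_prime_on_vars:
  fixes J :: "'i::{finite,linorder} set" and q f g :: "('i, 'k::field) mpoly"
  assumes "finite J" "mpoly_vars q \<subseteq> J" "irreducible q"
    "mpoly_vars f \<subseteq> J" "mpoly_vars g \<subseteq> J" "q dvd f * g"
  shows "q dvd f \<or> q dvd g"
  using assms
proof (induction J arbitrary: q f g rule: finite_induct)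
  case empty
  then have "q dvd 1" by (intro mpoly_const_unit) auto
  with empty.prems show ?case by (simp add: irreducible_def)
next
  case (insert i J)
  interpret factorial_subring "{p :: ('i, 'k) mpoly. mpoly_vars p \<subseteq> J}" mpoly_size
    by (rule factorial_subring_mpoly) (rule insert.IH)
  have ex_polys: "expand_mpoly i p \<in> polys" if "mpoly_vars p \<subseteq> insert i J" for p
    using that mpoly_vars_coeff_expand[of i p] by (auto simp: polys_def)
  have contract: "expand_mpoly i (poly a (mvar i)) = a" if "a \<in> polys" for a
    using that insert.hyps(2) by (intro expand_poly_mvar) (auto simp: polys_def)
  have dvd_back: "p dvd p'" if "expand_mpoly i p dvd expand_mpoly i p'" for p p' :: "('i, 'k) mpoly"
    using cring_hom.hom_dvd[OF cring_hom_poly_eval that, of "mvar i"] by simp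
  show ?case
  proof (cases "f * g = 0 \<or> degree (expand_mpoly i q) = 0")
    case False
    then have nz: "f * g \<noteq> 0" and pos: "0 < degree (expand_mpoly i q)" by auto
    obtain c where c: "f * g = q * c" using insert.prems(5) by (elim dvdE)
    have "mpoly_vars c \<subseteq> mpoly_vars (f * g)"
      using mpoly_vars_factor[of c q] nz c by (simp add: mult.commute)
    then have "mpoly_vars c \<subseteq> insert i J"
      using mpoly_vars_mult[of f g] insert.prems(3,4) by auto
    then have C: "expand_mpoly i c \<in> polys" by (rule ex_polys)
    have eq: "expand_mpoly i f * expand_mpoly i g = expand_mpoly i q * expand_mpoly i c"
      using c by (simp flip: expand_hom.hom_mult)
    have irr: "a dvd 1 \<or> b dvd 1" if ab: "a \<in> polys" "b \<in> polys" "expand_mpoly i q = a * b" for a b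
    proof -
      have "q = poly a (mvar i) * poly b (mvar i)"
        using arg_cong[OF ab(3), of "\<lambda>p. poly p (mvar i)"] by simp
      then have "poly a (mvar i) dvd 1 \<or> poly b (mvar i) dvd 1"
        by (rule irreducibleD[OF insert.prems(2)])
      then show ?thesis
        using expand_hom.hom_dvd[of "poly a (mvar i)" 1 i] expand_hom.hom_dvd[of "poly b (mvar i)" 1 i] contract ab by auto
    qed
    have "expand_mpoly i q \<noteq> 0" using pos by auto
    from irreducible_poly_prime[OF ex_polys[OF insert.prems(1)] this irr pos
        ex_polys[OF insert.prems(3)] ex_polys[OF insert.prems(4)] C eq]
    have "expand_mpoly i q dvd expand_mpoly i f \<or> expand_mpoly i q dvd expand_mpoly i g"
      unfolding dvd_def by blast
    then show ?thesis using dvd_back by blast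
  next
    case True
    then show ?thesis
    proof
      assume "degree (expand_mpoly i q) = 0"
      then have i: "i \<notin> mpoly_vars q" by (simp add: degree_expand_eq_0_iff)
      then have "[:q:] dvd expand_mpoly i f * expand_mpoly i g"
        using expand_hom.hom_dvd[OF insert.prems(5), of i] by (simp add: expand_hom.hom_mult expand_const)
      then have "[:q:] dvd expand_mpoly i f \<or> [:q:] dvd expand_mpoly i g"
        using i insert.prems by (intro irreducible_imp_prime_on_polys ex_polys) auto
      then show ?thesis using dvd_back[of q f] dvd_back[of q g] i
        unfolding expand_const[OF i] by blast
    qed auto
  qed
qed

interpretation mpoly_ufd: factorial_subring "UNIV :: ('i::{finite,linorder}, 'k::field) mpoly set" mpoly_size
  using factorial_subring_mpoly[of "UNIV :: 'i set", where 'k = 'k]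
    irreducible_prime_on_vars[of "UNIV :: 'i set", where 'k = 'k] by simp

section \<open>Clearing denominators\<close>

definition fracs_of :: "'a::idom set \<Rightarrow> 'a fract set" where
  "fracs_of S = {Fract p q |p q. q \<noteq> 0 \<and> p \<in> S \<and> q \<in> S}"

lemma clear_denominators:
  fixes S :: "'a::idom set"
  assumes "0 \<in> S" "1 \<in> S" "\<And>a b. a \<in> S \<Longrightarrow> b \<in> S \<Longrightarrow> a * b \<in> S"
    and "\<And>n. coeff w n \<in> fracs_of S"
  shows "\<exists>s c. s \<in> S \<and> s \<noteq> 0 \<and> (\<forall>n. coeff c n \<in> S) \<and> smult (to_fract s) w = fract_poly c"
  using assms(4)
proof (induction w)
  case 0
  then show ?case using assms(1,2) by (intro exI[of _ 1] exI[of _ 0]) auto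
next
  case (pCons a w)
  obtain p q where a: "a = Fract p q" "q \<noteq> 0" "p \<in> S" "q \<in> S"
    using pCons.prems[of 0] by (auto simp: fracs_of_def)
  obtain s c where sc: "s \<in> S" "s \<noteq> 0" "\<And>n. coeff c n \<in> S" "smult (to_fract s) w = fract_poly c"
    using pCons.IH pCons.prems[of "Suc _"] by auto
  have "smult (to_fract (q * s)) (pCons a w) = pCons (to_fract (p * s)) (smult (to_fract q) (fract_poly c))"
    using a(2) by (simp add: a(1) flip: sc(4)) (simp add: to_fract_def eq_fract)
  also have "\<dots> = fract_poly (pCons (p * s) (smult q c))"
    by (simp add: cring_hom.map_poly_hom_pCons[OF cring_hom_to_fract])
  finally show ?case
    using sc a assms(3) by (intro exI[of _ "q * s"] exI[of _ "pCons (p * s) (smult q c)"])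
      (auto simp: coeff_pCons split: nat.split)
qed

lemma fracs_of_UNIV [simp]: "x \<in> fracs_of UNIV"
  by (cases x) (auto simp: fracs_of_def)

lemma ratfuns_in_eq: "ratfuns_in J = fracs_of {p. mpoly_vars p \<subseteq> J}"
  by (auto simp: ratfuns_in_def fracs_of_def)

text \<open>
  Clear the denominators of the quotient and cancel them by Gauss's lemma.
\<close>

lemma fract_poly_dvd_primitive:
  fixes F h :: "('i::{finite,linorder}, 'k::field) mpoly poly"
  assumes "\<And>c. [:c:] dvd F \<Longrightarrow> c dvd 1" "fract_poly F dvd fract_poly h"
  shows "F dvd h"
proof -
  obtain w where w: "fract_poly h = fract_poly F * w" using assms(2) by (elim dvdE)
  obtain s c where sc: "s \<noteq> 0" "smult (to_fract s) w = fract_poly c"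
    using clear_denominators[of UNIV w] by auto
  have "fract_poly (smult s h) = fract_poly (F * c)"
    by (simp add: w flip: sc(2))
  then have "F * c = smult s h" by (simp only: fract_poly_eq_iff)
  moreover have "mpoly_ufd.primitive_in F" using assms(1) by (simp add: mpoly_ufd.primitive_in_def)
  ultimately have "\<exists>c'\<in>mpoly_ufd.polys. F * c' = h"
    using sc(1) by (intro mpoly_ufd.cancel_const) (auto simp: mpoly_ufd.polys_def)
  then show ?thesis by auto
qed

section \<open>Partial derivatives\<close>

definition mderiv :: "'i \<Rightarrow> ('i::linorder, 'k::idom) mpoly \<Rightarrow> ('i, 'k) mpoly" where
  "mderiv i p = poly (pderiv (expand_mpoly i p)) (mvar i)"

lemma expand_mderiv: "expand_mpoly i (mderiv i p) = pderiv (expand_mpoly i p)"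
  unfolding mderiv_def
proof (rule expand_poly_mvar)
  fix n
  have "coeff (pderiv (expand_mpoly i p)) n = coeff (expand_mpoly i p) (Suc n) * Poly_Mapping.single 0 (of_nat (Suc n))"
    by (simp add: coeff_pderiv mult.commute flip: of_nat_Suc)
  then show "i \<notin> mpoly_vars (coeff (pderiv (expand_mpoly i p)) n)"
    using mpoly_vars_mult[of "coeff (expand_mpoly i p) (Suc n)" "Poly_Mapping.single 0 (of_nat (Suc n))"]
      coeff_expand_free[of i p "Suc n"] by (auto simp: mpoly_vars_single_0 simp del: single_of_nat)
qed

lemma derivation_mderiv: "derivation (mderiv i)"
  by unfold_locales (simp_all add: mderiv_def expand_hom.hom_add expand_hom.hom_mult pderiv_add pderiv_mult)

text \<open>
  The constants of \<open>d/dX\<^sub>i\<close> on \<open>k(X\<^sub>I)\<close> are the rational functions in the other variables: expand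
  numerator and denominator in \<open>X\<^sub>i\<close> and use \<open>pderiv_proportional\<close>.
\<close>

lemma fract_der_mderiv_eq_0_iff:
  fixes c :: "('i::{finite,linorder}, 'k::field_char_0) ratfun"
  shows "fract_der (mderiv i) c = 0 \<longleftrightarrow> c \<in> ratfuns_in (- {i})"
proof
  obtain p q where c: "c = Fract p q" "q \<noteq> 0" by (cases c)
  assume "fract_der (mderiv i) c = 0"
  then have "mderiv i p * q = p * mderiv i q"
    using c(2) unfolding c(1)
    by (simp add: fract_der_Fract[OF derivation_mderiv] Zero_fract_def eq_fract)
  then have "pderiv (expand_mpoly i p) * expand_mpoly i q = expand_mpoly i p * pderiv (expand_mpoly i q)"
    by (metis expand_hom.hom_mult expand_mderiv)
  moreover have q0: "expand_mpoly i q \<noteq> 0" using c(2) expand_mpoly_eq_iff[of i q 0] by simp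
  ultimately have "smult (lead_coeff (expand_mpoly i q)) (expand_mpoly i p) =
      smult (lead_coeff (expand_mpoly i p)) (expand_mpoly i q)" by (rule pderiv_proportional)
  from arg_cong[OF this, of "\<lambda>p. poly p (mvar i)"]
  have "lead_coeff (expand_mpoly i q) * p = lead_coeff (expand_mpoly i p) * q" by simp
  then have "c = Fract (lead_coeff (expand_mpoly i p)) (lead_coeff (expand_mpoly i q))"
    unfolding c(1) using c(2) q0 by (simp add: eq_fract mult.commute)
  moreover have "mpoly_vars (coeff (expand_mpoly i r) n) \<subseteq> - {i}" for r :: "('i, 'k) mpoly" and n
    using coeff_expand_free[of i r n] by auto
  moreover have "lead_coeff (expand_mpoly i q) \<noteq> 0" using q0 by simp
  ultimately show "c \<in> ratfuns_in (- {i})" unfolding ratfuns_in_def by blast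
next
  assume "c \<in> ratfuns_in (- {i})"
  then obtain p q where c: "c = Fract p q" "q \<noteq> 0" "i \<notin> mpoly_vars p" "i \<notin> mpoly_vars q"
    unfolding ratfuns_in_def by auto
  have "mderiv i p = 0" "mderiv i q = 0" using c(3,4) by (simp_all add: mderiv_def expand_const pderiv_pCons)
  then show "fract_der (mderiv i) c = 0"
    unfolding c(1) using c(2) by (simp add: fract_der_Fract[OF derivation_mderiv] Zero_fract_def eq_fract)
qed

section \<open>Extending homomorphisms to fraction fields\<close>

definition fract_map :: "('a::idom \<Rightarrow> 'b::idom) \<Rightarrow> 'a fract \<Rightarrow> 'b fract" where
  "fract_map \<sigma> q = (THE r. \<exists>a b. b \<noteq> 0 \<and> q = Fract a b \<and> r = Fract (\<sigma> a) (\<sigma> b))"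

context
  fixes \<sigma> :: "'a::idom \<Rightarrow> 'b::idom"
  assumes hom: "cring_hom \<sigma>" and ker: "\<And>x. \<sigma> x = 0 \<Longrightarrow> x = 0"
begin

interpretation cring_hom \<sigma> by (rule hom)

lemma fract_map_Fract:
  assumes "b \<noteq> 0"
  shows "fract_map \<sigma> (Fract a b) = Fract (\<sigma> a) (\<sigma> b)"
  unfolding fract_map_def
proof (rule the_equality)
  show "\<exists>a' b'. b' \<noteq> 0 \<and> Fract a b = Fract a' b' \<and> Fract (\<sigma> a) (\<sigma> b) = Fract (\<sigma> a') (\<sigma> b')"
    using assms by blast
next
  fix r assume "\<exists>a' b'. b' \<noteq> 0 \<and> Fract a b = Fract a' b' \<and> r = Fract (\<sigma> a') (\<sigma> b')"
  then obtain a' b' where *: "b' \<noteq> 0" "Fract a b = Fract a' b'" "r = Fract (\<sigma> a') (\<sigma> b')" by blast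
  then have "a * b' = a' * b" using assms by (simp add: eq_fract)
  then have "\<sigma> a * \<sigma> b' = \<sigma> a' * \<sigma> b" by (simp flip: hom_mult)
  moreover have "\<sigma> b \<noteq> 0" "\<sigma> b' \<noteq> 0" using ker assms *(1) by auto
  ultimately show "r = Fract (\<sigma> a) (\<sigma> b)" unfolding *(3) by (simp add: eq_fract)
qed

lemma cring_hom_fract_map: "cring_hom (fract_map \<sigma>)"
proof
  fix x y :: "'a fract"
  obtain a b where x: "x = Fract a b" "b \<noteq> 0" by (cases x)
  obtain a' b' where y: "y = Fract a' b'" "b' \<noteq> 0" by (cases y)
  have nz: "\<sigma> b \<noteq> 0" "\<sigma> b' \<noteq> 0" using ker x y by auto
  show "fract_map \<sigma> (x + y) = fract_map \<sigma> x + fract_map \<sigma> y"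
    "fract_map \<sigma> (x * y) = fract_map \<sigma> x * fract_map \<sigma> y"
    using x(2) y(2) nz by (simp_all add: x(1) y(1) fract_map_Fract hom_add hom_mult)
  show "fract_map \<sigma> 1 = 1" using fract_map_Fract[of 1 1] by (simp add: One_fract_def)
qed

lemma fract_map_to_fract: "fract_map \<sigma> (to_fract a) = to_fract (\<sigma> a)"
  using fract_map_Fract[of 1 a] by (simp add: to_fract_def)

end

section \<open>Relative algebraic closedness\<close>

text \<open>
  \<open>K\<close> is algebraically closed in the quotient of the polynomial ring by \<open>F\<close>, expressed by representatives.
\<close>

definition alg_closed_mod :: "'a::field set \<Rightarrow> 'a poly \<Rightarrow> bool" where
  "alg_closed_mod K F \<longleftrightarrow> (\<forall>u m. m \<noteq> 0 \<longrightarrow> (\<forall>n. coeff m n \<in> K) \<longrightarrow> F dvd pcompose m u \<longrightarrow>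
     (\<exists>c\<in>K. F dvd u - [:c:]))"

text \<open>
  The matrix of the system for \<open>expand i F\<close> has entries without \<open>X\<^sub>i\<close>, so the coefficients with respect
  to \<open>X\<^sub>i\<close> of a solution over \<open>k[X\<^sub>I]\<close> are solutions without \<open>X\<^sub>i\<close>. It is enough to exclude
  nonzero solutions of the latter kind, in which \<open>Z\<close> can be replaced by \<open>X\<^sub>i\<close> without loss.
\<close>

lemma rigid_descend:
  fixes f :: "('i::{finite,linorder}, 'k::field_char_0) mpoly poly poly"
  assumes f: "\<And>p. i \<notin> mpoly_vars (coeff2 f p)"
    and r: "\<And>g h. (\<And>p. i \<notin> mpoly_vars (coeff2 g p)) \<Longrightarrow> (\<And>p. i \<notin> mpoly_vars (coeff2 h p)) \<Longrightarrow>
      deg_less (l + m) g \<Longrightarrow> deg_less (l + m) h \<Longrightarrow>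
      ruppert pderiv f g h = 0 \<Longrightarrow> euler_coeff l m g h = 0 \<Longrightarrow> g = 0 \<and> h = 0"
  shows "rigid l m f"
  unfolding rigid_iff_inj_system inj_system_def
proof (intro allI impI ballI)
  let ?J = "unknowns (l + m)"
  let ?M = "ruppert_matrix l m f"
  fix v j0 assume v: "\<forall>e. (\<Sum>j\<in>?J. ?M e j * v j) = 0" and j0: "j0 \<in> ?J"
  have const: "cring_hom (\<lambda>c :: ('i, 'k) mpoly. [:c:])" by unfold_locales (simp_all add: one_pCons)
  \<comment> \<open>two homomorphisms that agree on the coefficients of \<open>f\<close> agree on the matrix,
    so the matrix entries do not involve \<open>X\<^sub>i\<close>\<close>
  have "map_coeffs2 (expand_mpoly i) f = map_coeffs2 (\<lambda>c. [:c:]) f"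
    by (rule coeff2_eqI)
       (simp add: cring_hom.coeff2_map_coeffs2[OF const] expand_hom.coeff2_map_coeffs2 expand_const f)
  then have M: "expand_mpoly i (?M e j) = [:?M e j:]" for e j
    using ruppert_matrix_hom[OF cring_hom_expand_mpoly[of i], of l m f e j]
      ruppert_matrix_hom[OF const, of l m f e j] by simp
  have "coeff (expand_mpoly i (v j0)) N = 0" for N
  proof -
    define w where "w j = coeff (expand_mpoly i (v j)) N" for j
    have w: "(\<Sum>j\<in>?J. ?M e j * w j) = 0" for e
      using arg_cong[OF v[rule_format, of e], of "\<lambda>p. coeff (expand_mpoly i p) N"]
      by (simp add: expand_hom.hom_sum expand_hom.hom_mult M coeff_sum w_def)
    obtain g h where gh: "ruppert pderiv f g h = 0" "euler_coeff l m g h = 0"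
      "deg_less (l + m) g" "deg_less (l + m) h"
      and c: "\<And>p. coeff2 g p = (if fst p + snd p < l + m then w (True, p) else 0)"
        "\<And>p. coeff2 h p = (if fst p + snd p < l + m then w (False, p) else 0)"
      using ruppert_kernel_vector[OF w] by blast
    have "i \<notin> mpoly_vars (coeff2 g p)" "i \<notin> mpoly_vars (coeff2 h p)" for p
      by (simp_all add: c w_def coeff_expand_free)
    then have "g = 0" "h = 0" using r[OF _ _ gh(3,4,1,2)] by blast+
    moreover obtain b p where "j0 = (b, p)" "fst p + snd p < l + m"
      using j0 by (auto simp: unknowns_def)
    ultimately have "w j0 = 0" using c(1)[of p] c(2)[of p] by (cases b) simp_all
    then show ?thesis by (simp add: w_def)
  qed
  then have "expand_mpoly i (v j0) = 0" by (intro poly_eqI) simp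
  then show "v j0 = 0" using expand_mpoly_eq_iff[of i "v j0" 0] by simp
qed

text \<open>
  Substitute \<open>X\<^sub>i\<close> for \<open>Z\<close> in a solution without \<open>X\<^sub>i\<close>. Over \<open>k(X\<^sub>I)\<close> with the derivation \<open>d/dX\<^sub>i\<close>, whose
  constants are \<open>K\<close>, the solution is a multiple \<open>c (F\<^sub>Y, F\<^sub>Z)\<close> modulo \<open>F\<close> with \<open>c = a / b\<close> in \<open>K\<close>. Since \<open>F\<close> is
  primitive, \<open>F\<close> divides \<open>b g - a F\<^sub>Y\<close> and \<open>b h - a F\<^sub>Z\<close> in \<open>k[X\<^sub>I][Y]\<close>. Their total degree in \<open>Y\<close> and
  \<open>X\<^sub>i\<close> is smaller than that of \<open>F\<close>, so they vanish, and the normalization gives \<open>a = 0\<close>.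
\<close>

lemma rigid_expand:
  fixes F :: "('i::{finite,linorder}, 'k::field_char_0) mpoly poly"
  assumes irr: "irreducible (fract_poly F)"
    and prim: "\<And>c. [:c:] dvd F \<Longrightarrow> c dvd 1"
    and closed: "alg_closed_mod (ratfuns_in (- {i})) (fract_poly F)"
    and lm: "total_degree2 (expand i F) = l + m" "coeff2 (expand i F) (l, m) \<noteq> 0" "1 \<le> l + m"
  shows "rigid l m (expand i F)"
proof (rule rigid_descend)
  define f where "f = expand i F"
  define Q where "Q = fract_poly F"
  define d where "d = fract_der (mderiv i :: ('i, 'k) mpoly \<Rightarrow> _)"
  define \<epsilon> where "\<epsilon> p = poly p (mvar i)" for p :: "('i, 'k) mpoly poly"
  interpret \<epsilon>: cring_hom \<epsilon> unfolding \<epsilon>_def by (rule cring_hom_poly_eval)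
  have der: "derivation d" unfolding d_def by (intro derivation_fract_der derivation_mderiv)
  have K: "d c = 0 \<longleftrightarrow> c \<in> ratfuns_in (- {i})" for c
    unfolding d_def by (rule fract_der_mderiv_eq_0_iff)
  show free_f: "i \<notin> mpoly_vars (coeff2 (expand i F) p)" for p
    by (cases p) (simp add: expand_def coeff2_def coeff_map_poly coeff_expand_free)
  have Ff: "map_poly \<epsilon> f = F"
    by (rule poly_eqI) (simp add: f_def expand_def coeff_map_poly \<epsilon>_def)
  fix g h assume free: "\<And>p. i \<notin> mpoly_vars (coeff2 g p)" "\<And>p. i \<notin> mpoly_vars (coeff2 h p)"
    and *: "deg_less (l + m) g" "deg_less (l + m) h"
      "ruppert pderiv (expand i F) g h = 0" "euler_coeff l m g h = 0"
  have ext: "map_poly (expand_mpoly i) (map_poly \<epsilon> w) = w" if "\<And>p. i \<notin> mpoly_vars (coeff2 w p)" for w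
  proof (rule poly_eqI)
    fix n
    have "i \<notin> mpoly_vars (coeff (coeff w n) k)" for k
      using that[of "(n, k)"] by (simp add: coeff2_def)
    then show "coeff (map_poly (expand_mpoly i) (map_poly \<epsilon> w)) n = coeff w n"
      by (simp add: coeff_map_poly \<epsilon>_def expand_poly_mvar)
  qed
  have md: "map_poly (mderiv i) (map_poly \<epsilon> w) = map_poly \<epsilon> (map_poly pderiv w)"
    if "\<And>p. i \<notin> mpoly_vars (coeff2 w p)" for w
  proof (rule poly_eqI)
    fix n
    have "i \<notin> mpoly_vars (coeff (coeff w n) k)" for k
      using that[of "(n, k)"] by (simp add: coeff2_def)
    then show "coeff (map_poly (mderiv i) (map_poly \<epsilon> w)) n = coeff (map_poly \<epsilon> (map_poly pderiv w)) n"
      by (simp add: coeff_map_poly \<epsilon>_def mderiv_def expand_poly_mvar)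
  qed
  define G H where "G = map_poly \<epsilon> g" and "H = map_poly \<epsilon> h"
  have pd: "pderiv (map_poly \<epsilon> w) = map_poly \<epsilon> (pderiv w)" for w
    by (rule map_poly_hom_pderiv[symmetric]) unfold_locales
  interpret m\<epsilon>: cring_hom "map_poly \<epsilon>" by (rule \<epsilon>.cring_hom_map_poly)
  have "ruppert (mderiv i) F G H = map_poly \<epsilon> (ruppert pderiv f g h)"
    unfolding ruppert_def G_def H_def m\<epsilon>.hom_add m\<epsilon>.hom_diff m\<epsilon>.hom_mult
    using md[OF free(1)] md[OF free_f] pd[of h] pd[of f] Ff by (simp add: f_def)
  then have "ruppert (mderiv i) F G H = 0" using *(3) by (simp add: f_def)
  then have rup: "ruppert d Q (fract_poly G) (fract_poly H) = 0"
    unfolding d_def Q_def fract_poly_ruppert[OF derivation_mderiv] by simp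
  have "\<exists>c. d c = 0 \<and> Q dvd u - [:c:]" if u: "Q dvd ham d Q u" for u
  proof -
    obtain mp where mp: "is_min_poly Q u mp"
      by (rule min_poly_exists[of Q u]) (use irr in \<open>auto simp: Q_def\<close>)
    have "map_poly d mp = 0" using irr by (intro min_poly_coeffs_constant[OF der _ mp u]) (simp add: Q_def)
    then have "coeff mp n \<in> ratfuns_in (- {i})" for n
      using derivation.coeff_der[OF der, of mp n] K by simp
    moreover have "mp \<noteq> 0" "Q dvd pcompose mp u" using mp by (auto simp: is_min_poly_def)
    ultimately show ?thesis using closed K unfolding alg_closed_mod_def Q_def by blast
  qed
  then obtain c where c: "d c = 0" "Q dvd fract_poly G - smult c (pderiv Q)"
      "Q dvd fract_poly H - smult c (map_poly d Q)"
    using ruppert_solution_proportional[OF der _ _ rup] irr unfolding Q_def by blast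
  obtain a b where ab: "c = Fract a b" "b \<noteq> 0" "i \<notin> mpoly_vars a" "i \<notin> mpoly_vars b"
    using c(1) K by (auto simp: ratfuns_in_def)
  have bc: "to_fract b * c = to_fract a" using ab(2) by (simp add: ab(1) to_fract_def eq_fract)
  have key: "smult [:b:] w = smult [:a:] w'"
    if w: "\<And>p. i \<notin> mpoly_vars (coeff2 w p)" "\<And>p. i \<notin> mpoly_vars (coeff2 w' p)"
      "deg_less (l + m) w" "deg_less (l + m) w'"
      "Q dvd fract_poly (map_poly \<epsilon> w) - smult c (fract_poly (map_poly \<epsilon> w'))" for w w'
  proof -
    interpret me: cring_hom "map_poly (expand_mpoly i)" by (rule expand_hom.cring_hom_map_poly)
    have "Q dvd smult (to_fract b) (fract_poly (map_poly \<epsilon> w) - smult c (fract_poly (map_poly \<epsilon> w')))"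
      using w(5) by (rule dvd_smult)
    also have "\<dots> = fract_poly (smult b (map_poly \<epsilon> w) - smult a (map_poly \<epsilon> w'))"
      by (simp add: smult_diff_right bc)
    finally have "F dvd smult b (map_poly \<epsilon> w) - smult a (map_poly \<epsilon> w')"
      unfolding Q_def by (intro fract_poly_dvd_primitive[of F, OF prim]) auto
    then have "F dvd [:b:] * map_poly \<epsilon> w - [:a:] * map_poly \<epsilon> w'" by simp
    from me.hom_dvd[OF this] have dvd: "f dvd smult [:b:] w - smult [:a:] w'"
      by (simp add: f_def expand_def me.hom_diff me.hom_mult ext[OF w(1)] ext[OF w(2)]
          expand_hom.map_poly_hom_pCons expand_const ab(3,4) del: mult_pCons_left) simp
    have "deg_less (l + m) (smult [:b:] w - smult [:a:] w')"
      using w(3,4) by (intro deg_less_diff deg_less_smult)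
    then have "smult [:b:] w - smult [:a:] w' = 0"
      using dvd_imp_total_degree2_le[OF dvd] lm(1)
      by (cases "smult [:b:] w - smult [:a:] w' = 0") (auto simp: deg_less_iff f_def)
    then show ?thesis by simp
  qed
  have of_nat_free: "i \<notin> mpoly_vars (of_nat n * p)" if "i \<notin> mpoly_vars p" for n and p :: "('i, 'k) mpoly"
    using that by (simp add: expand_hom.hom_mult expand_hom.hom_of_nat of_nat_poly expand_const flip: expand_mpoly_const_iff)
  have fY: "i \<notin> mpoly_vars (coeff2 (pderiv f) p)" for p
    by (cases p) (simp add: coeff2_pderiv of_nat_free free_f f_def del: of_nat_Suc)
  have fZ: "i \<notin> mpoly_vars (coeff2 (map_poly pderiv f) p)" for p
    by (cases p) (simp add: coeff2_map_pderiv of_nat_free free_f f_def del: of_nat_Suc)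
  have dQ: "map_poly d Q = fract_poly (map_poly \<epsilon> (map_poly pderiv f))"
    unfolding d_def Q_def fract_poly_der[OF derivation_mderiv]
    using md[OF free_f] Ff by (simp add: f_def)
  have pQ: "pderiv Q = fract_poly (map_poly \<epsilon> (pderiv f))"
    unfolding Q_def fract_poly_pderiv[symmetric] using pd[of f] Ff by simp
  have eqs: "smult [:b:] g = smult [:a:] (pderiv f)" "smult [:b:] h = smult [:a:] (map_poly pderiv f)"
    using c(2,3) deg_less_pderiv[of f] deg_less_map_pderiv[of f] lm(1)
    unfolding pQ dQ G_def H_def
    by (intro key free fY fZ *; simp add: f_def)+
  have "0 = ruppert_functional l m f None (smult [:b:] g) (smult [:b:] h)"
    unfolding ruppert_functional_smult using *(4) by (simp add: ruppert_functional_def)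
  also have "\<dots> = a * (of_nat (l + m) * coeff2 f (l, m))"
    unfolding eqs ruppert_functional_smult by (simp add: ruppert_functional_def euler_coeff_self)
  finally have "a = 0" using lm(2,3) by (auto simp: f_def simp del: of_nat_add)
  then show "g = 0 \<and> h = 0" using eqs ab(2) by simp
qed

lemma total_degree2_map_coeffs2_inj:
  assumes "cring_hom \<phi>" "\<And>x. \<phi> x = 0 \<Longrightarrow> x = 0"
  shows "total_degree2 (map_coeffs2 \<phi> f) = total_degree2 f"
proof -
  interpret cring_hom \<phi> by fact
  have "\<phi> x = 0 \<longleftrightarrow> x = 0" for x using assms(2) by auto
  then show ?thesis by (simp add: total_degree2_def coeff2_map_coeffs2)
qed

lemma total_degree2_map_coeffs2_le:
  assumes "cring_hom \<phi>"
  shows "total_degree2 (map_coeffs2 \<phi> f) \<le> total_degree2 f"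
proof -
  interpret cring_hom \<phi> by fact
  show ?thesis unfolding total_degree2_le_iff
    by (auto simp: coeff2_map_coeffs2 intro!: coeff2_le_total_degree2 elim: contrapos_nn)
qed

lemma pcompose_dvd_diff: "F dvd u - w \<Longrightarrow> F dvd pcompose m u - pcompose m w"
  for F :: "'a::comm_ring_1 poly"
proof (induction m)
  case (pCons a m)
  have "pcompose (pCons a m) u - pcompose (pCons a m) w =
      (u - w) * pcompose m u + w * (pcompose m u - pcompose m w)"
    by (simp add: pcompose_pCons algebra_simps)
  then show ?case using pCons by simp
qed simp

text \<open>
  Let \<open>E\<close> be the algebraic closure of \<open>k(X\<^sub>I)\<close>. The ring homomorphism \<open>\<sigma>: k[X\<^sub>I] \<rightarrow> E[Z]\<close> sends \<open>X\<^sub>i\<close> to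
  \<open>Z\<close> and embeds the polynomials in the other variables into \<open>E\<close>; let \<open>\<Sigma>\<close> be its extension
  \<open>k(X\<^sub>I) \<rightarrow> E(Z)\<close>. It carries \<open>K\<close> into \<open>E\<close> and \<open>F\<close> to a polynomial \<open>f\<close> that is irreducible by
  rigidity. If \<open>u\<close> modulo \<open>F\<close> is algebraic over \<open>K\<close>, its minimal polynomial splits over \<open>E\<close>, and \<open>f\<close>
  divides some \<open>\<Sigma> u - x\<close> with \<open>x\<close> in \<open>E\<close>. For \<open>u\<close> reduced modulo \<open>F\<close> this means \<open>\<Sigma> u = x\<close>, so \<open>u\<close> is an
  element of \<open>k(X\<^sub>I)\<close> that does not involve \<open>X\<^sub>i\<close>.
\<close>

lemma alg_closed_mod_if_geometrically_rigid:
  fixes F :: "('i::{finite,linorder}, 'k::field_char_0) mpoly poly"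
  defines "\<kappa> \<equiv> (\<lambda>p :: ('i, 'k) mpoly. to_ac (to_fract p))"
  assumes irr: "irreducible (fract_poly F)"
    and r: "rigid l m (map_coeffs2 \<kappa> (expand i F))"
    and lm: "total_degree2 (expand i F) = l + m" "coeff2 (expand i F) (l, m) \<noteq> 0" "1 \<le> l + m"
  shows "alg_closed_mod (ratfuns_in (- {i})) (fract_poly F)"
  unfolding alg_closed_mod_def
proof (intro allI impI)
  fix u0 mm assume mm: "mm \<noteq> 0" "\<forall>n. coeff mm n \<in> ratfuns_in (- {i})"
    and dvd0: "fract_poly F dvd pcompose mm u0"
  \<comment> \<open>reduction modulo \<open>F\<close>, so that divisibility of \<open>u - x\<close> by \<open>F\<close> becomes equality\<close>
  define u where "u = u0 mod fract_poly F"
  have F0: "fract_poly F \<noteq> 0" using irr by auto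
  have degF: "0 < degree (fract_poly F)" by (rule irreducible_field_poly_degree[OF irr])
  have u: "degree u < degree (fract_poly F)"
    using degree_mod_less[OF F0, of u0] degF by (auto simp: u_def)
  have uu: "fract_poly F dvd u0 - u" by (simp add: u_def minus_mod_eq_mult_div)
  have dvd: "fract_poly F dvd pcompose mm u"
    using dvd_diff[OF dvd0 pcompose_dvd_diff[OF uu, of mm]] by simp
  have \<kappa>: "cring_hom \<kappa>" unfolding \<kappa>_def
    by unfold_locales (simp_all add: to_ac_add to_ac_mult)
  have \<kappa>0: "\<kappa> x = 0 \<Longrightarrow> x = 0" for x by (simp add: \<kappa>_def to_ac_eq_0_iff)
  interpret \<kappa>: cring_hom \<kappa> by (rule \<kappa>)
  define \<sigma> where "\<sigma> p = map_poly \<kappa> (expand_mpoly i p)" for p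
  have \<sigma>: "cring_hom \<sigma>" unfolding \<sigma>_def
    by (rule cring_hom_comp[OF cring_hom_expand_mpoly \<kappa>.cring_hom_map_poly])
  have map0: "map_poly \<kappa> p = 0 \<Longrightarrow> p = 0" for p
    by (rule poly_eqI) (metis \<kappa>.coeff_hom \<kappa>0 coeff_0)
  have \<sigma>0: "\<sigma> p = 0 \<Longrightarrow> p = 0" for p
    using map0[of "expand_mpoly i p"] expand_mpoly_eq_iff[of i p 0] by (simp add: \<sigma>_def)
  define \<Sigma> where "\<Sigma> = fract_map \<sigma>"
  have \<Sigma>: "cring_hom \<Sigma>" unfolding \<Sigma>_def by (rule cring_hom_fract_map[OF \<sigma> \<sigma>0])
  interpret \<Sigma>: cring_hom \<Sigma> by (rule \<Sigma>)
  have \<Sigma>_Fract: "\<Sigma> (Fract a b) = Fract (\<sigma> a) (\<sigma> b)" if "b \<noteq> 0" for a b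
    unfolding \<Sigma>_def by (rule fract_map_Fract[OF \<sigma> \<sigma>0 that])
  have \<Sigma>_to_fract: "\<Sigma> (to_fract a) = to_fract (\<sigma> a)" for a
    unfolding \<Sigma>_def by (rule fract_map_to_fract[OF \<sigma> \<sigma>0])
  have \<Sigma>0: "x = 0" if "\<Sigma> x = 0" for x
  proof -
    have "\<Sigma> x * \<Sigma> (inverse x) = 1" if "x \<noteq> 0"
      using that by (simp flip: \<Sigma>.hom_mult)
    with that show ?thesis by force
  qed
  have deg\<Sigma>: "degree (map_poly \<Sigma> p) = degree p" for p
    by (rule degree_map_poly) (use \<Sigma>0 in auto)
  define f where "f = map_coeffs2 \<kappa> (expand i F)"
  have f_\<sigma>: "f = map_poly \<sigma> F"
    by (rule poly_eqI)
       (simp add: f_def expand_def coeff_map_poly \<sigma>_def)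
  have f_\<Sigma>: "fract_poly f = map_poly \<Sigma> (fract_poly F)"
    by (rule poly_eqI)
       (simp add: f_\<sigma> coeff_map_poly cring_hom.hom_zero[OF \<sigma>] \<Sigma>_to_fract)
  have "irreducible f"
    by (rule rigid_imp_irreducible[OF r[folded f_def] _ lm(3)])
       (use lm \<kappa>0 in \<open>auto simp: f_def total_degree2_map_coeffs2_inj[OF \<kappa> \<kappa>0] \<kappa>.coeff2_map_coeffs2\<close>)
  moreover have degf: "degree (fract_poly f) = degree (fract_poly F)" by (simp add: f_\<Sigma> deg\<Sigma>)
  then have "degree f \<noteq> 0" using degF by (simp add: degree_map_poly)
  ultimately have irrf: "irreducible (fract_poly f)"
    using nonconst_poly_irreducible_iff[of f] by simp
  define \<iota> where "\<iota> x = to_fract [:x:]" for x :: "('i, 'k) ratfun alg_closure"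
  have \<iota>: "cring_hom \<iota>"
    by unfold_locales (simp_all add: \<iota>_def flip: to_fract_add to_fract_mult one_pCons)
  have inj: "inj \<iota>" by (auto simp: inj_def \<iota>_def)
  have K_\<iota>: "\<Sigma> c \<in> range \<iota>" if c: "c \<in> ratfuns_in (- {i})" for c
  proof -
    obtain a b where ab: "c = Fract a b" "b \<noteq> 0" "i \<notin> mpoly_vars a" "i \<notin> mpoly_vars b"
      using c by (auto simp: ratfuns_in_def)
    have "\<Sigma> c = Fract [:\<kappa> a:] [:\<kappa> b:]"
      using ab by (simp add: \<Sigma>_Fract \<sigma>_def expand_const \<kappa>.map_poly_hom_pCons)
    also have "\<dots> = \<iota> (\<kappa> a / \<kappa> b)"
    proof -
      have "\<kappa> b \<noteq> 0" using ab(2) \<kappa>0 by blast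
      then show ?thesis by (simp add: \<iota>_def to_fract_def eq_fract)
    qed
    finally show ?thesis by simp
  qed
  have "coeff (map_poly \<Sigma> mm) n \<in> range \<iota>" for n using mm(2) K_\<iota> by (simp add: \<Sigma>.coeff_hom)
  then obtain m1 where m1: "map_poly \<iota> m1 = map_poly \<Sigma> mm" by (rule map_poly_preimage[OF \<iota> inj])
  have "map_poly \<Sigma> mm \<noteq> 0"
  proof
    assume "map_poly \<Sigma> mm = 0"
    then have "\<Sigma> (coeff mm n) = 0" for n by (metis \<Sigma>.coeff_hom coeff_0)
    then have "mm = 0" using \<Sigma>0 by (intro poly_eqI) simp
    with mm(1) show False ..
  qed
  then have m1nz: "m1 \<noteq> 0" using m1 by auto
  interpret m\<Sigma>: cring_hom "map_poly \<Sigma>" by (rule \<Sigma>.cring_hom_map_poly)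
  have "fract_poly f dvd pcompose (map_poly \<iota> m1) (map_poly \<Sigma> u)"
    using m\<Sigma>.hom_dvd[OF dvd] by (simp add: f_\<Sigma> m1 \<Sigma>.map_poly_hom_pcompose)
  from dvd_of_split_min_poly[OF \<iota> irrf m1nz this] obtain x
    where x: "fract_poly f dvd map_poly \<Sigma> u - [:\<iota> x:]" by blast
  have "map_poly \<Sigma> u = [:\<iota> x:]"
  proof (rule ccontr)
    assume "map_poly \<Sigma> u \<noteq> [:\<iota> x:]"
    then have "degree (fract_poly f) \<le> degree (map_poly \<Sigma> u - [:\<iota> x:])"
      by (intro dvd_imp_degree_le[OF x]) simp
    also have "\<dots> < degree (fract_poly f)"
      using u degF by (intro degree_diff_less) (simp_all add: degf deg\<Sigma>)
    finally show False by simp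
  qed
  then have "degree u = 0" using deg\<Sigma>[of u] by simp
  then obtain a where a: "u = [:a:]" by (auto elim: degree_eq_zeroE)
  then have ax: "\<Sigma> a = \<iota> x" using \<open>map_poly \<Sigma> u = [:\<iota> x:]\<close> by (simp add: \<Sigma>.map_poly_hom_pCons)
  obtain p q where pq: "a = Fract p q" "q \<noteq> 0" by (cases a)
  define P Q where "P = expand_mpoly i p" and "Q = expand_mpoly i q"
  have Q0: "Q \<noteq> 0" using pq(2) expand_mpoly_eq_iff[of i q 0] by (simp add: Q_def)
  have "Fract (\<sigma> p) (\<sigma> q) = Fract [:x:] 1"
    using ax pq by (simp add: \<Sigma>_Fract \<iota>_def to_fract_def)
  then have "map_poly \<kappa> P = smult x (map_poly \<kappa> Q)"
  proof -
    have "\<sigma> q \<noteq> 0" using pq(2) \<sigma>0 by blast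
    with \<open>Fract (\<sigma> p) (\<sigma> q) = Fract [:x:] 1\<close> show ?thesis
      by (simp add: eq_fract) (simp add: \<sigma>_def P_def Q_def)
  qed
  then have PQ: "\<kappa> (coeff P n) = x * \<kappa> (coeff Q n)" for n
    by (metis \<kappa>.coeff_hom coeff_smult)
  \<comment> \<open>\<open>P\<close> is \<open>x\<close> times \<open>Q\<close> with \<open>x\<close> in \<open>E\<close>, so \<open>x\<close> is a ratio of two coefficients\<close>
  define c d where "c = coeff P (degree Q)" and "d = lead_coeff Q"
  have "d \<noteq> 0" using Q0 by (simp add: d_def)
  have "\<kappa> (d * coeff P n) = \<kappa> (c * coeff Q n)" for n
    using PQ[of n] PQ[of "degree Q"] by (simp add: \<kappa>.hom_mult c_def d_def)
  then have "d * coeff P n = c * coeff Q n" for n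
    using \<kappa>0[of "d * coeff P n - c * coeff Q n"] by (simp add: \<kappa>.hom_diff)
  then have "smult d P = smult c Q" by (intro poly_eqI) simp
  from arg_cong[OF this, of "\<lambda>p. poly p (mvar i)"] have "d * p = c * q" by (simp add: P_def Q_def)
  then have "a = Fract c d" using pq \<open>d \<noteq> 0\<close> by (simp add: eq_fract mult.commute)
  moreover have "mpoly_vars c \<subseteq> - {i}" "mpoly_vars d \<subseteq> - {i}"
    using coeff_expand_free[of i p] coeff_expand_free[of i q] by (auto simp: c_def d_def P_def Q_def)
  ultimately have "a \<in> ratfuns_in (- {i})" using \<open>d \<noteq> 0\<close> unfolding ratfuns_in_def by blast
  with uu a show "\<exists>c\<in>ratfuns_in (- {i}). fract_poly F dvd u0 - [:c:]" by blast
qed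

section \<open>Specialization\<close>

lemma mpoly_eval_cong:
  assumes "\<And>v. v \<in> mpoly_vars p \<Longrightarrow> x v = y v"
  shows "mpoly_eval h x p = mpoly_eval h y p"
  unfolding mpoly_eval_def
  using assms by (intro sum.cong prod.cong refl arg_cong2[of _ _ _ _ "(*)"] arg_cong2[of _ _ _ _ "(^)"])
    (auto simp: mpoly_vars_def)

interpretation eval_hom: cring_hom "mpoly_eval id x :: ('i, 'k::comm_ring_1) mpoly \<Rightarrow> 'k" for x
  by (rule cring_hom_mpoly_eval) (unfold_locales, simp_all)

lemma mpoly_eval_mvar [simp]: "mpoly_eval id x (mvar i) = (x i :: 'k::comm_ring_1)"
  by (cases "(1::'k) = 0") (simp_all add: mvar_def mpoly_eval_def)

lemma mpoly_eval_nonzero_exists: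
  fixes p :: "('i, 'k::field_char_0) mpoly"
  assumes "finite J" "mpoly_vars p \<subseteq> J" "p \<noteq> 0"
  shows "\<exists>x. mpoly_eval id x p \<noteq> 0"
  using assms
proof (induction J arbitrary: p rule: finite_induct)
  case empty
  then have "mpoly_vars p = {}" by simp
  then obtain c where c: "p = Poly_Mapping.single 0 c" by (rule mpoly_vars_empty)
  then have "c \<noteq> 0" using empty.prems by auto
  then show ?case by (simp add: c mpoly_eval_def)
next
  case (insert i J)
  have "expand_mpoly i p \<noteq> 0" using insert.prems(2) expand_mpoly_eq_iff[of i p 0] by simp
  then have "lead_coeff (expand_mpoly i p) \<noteq> 0" by simp
  moreover have "mpoly_vars (lead_coeff (expand_mpoly i p)) \<subseteq> J"
    using mpoly_vars_coeff_expand[of i p] insert.prems(1) by blast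
  ultimately obtain x where x: "mpoly_eval id x (lead_coeff (expand_mpoly i p)) \<noteq> 0"
    using insert.IH by blast
  define P where "P = map_poly (mpoly_eval id x) (expand_mpoly i p)"
  have "coeff P (degree (expand_mpoly i p)) \<noteq> 0" using x by (simp add: P_def eval_hom.coeff_hom)
  then have "P \<noteq> 0" by auto
  then have "finite {z. poly P z = 0}" by (rule poly_roots_finite)
  then obtain z where z: "poly P z \<noteq> 0" using infinite_UNIV_char_0[where 'a='k] by (metis (mono_tags, lifting) Collect_cong UNIV_def UNIV_I mem_Collect_eq)
  have "map_poly (mpoly_eval id (x(i := z))) (expand_mpoly i p) = P"
    unfolding P_def
    by (rule poly_eqI, unfold eval_hom.coeff_hom, rule mpoly_eval_cong)
       (use coeff_expand_free[of i p] in auto)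
  then have "mpoly_eval id (x(i := z)) p = poly P z"
    using eval_hom.poly_map_poly_hom[of "x(i := z)" "expand_mpoly i p" "mvar i"] by simp
  then show ?case using z by metis
qed

lemma total_degree2_expand_pos:
  fixes F :: "('i::{finite,linorder}, 'k::field_char_0) mpoly poly"
  assumes "irreducible (fract_poly F)"
  shows "1 \<le> total_degree2 (expand i F)" "expand i F \<noteq> 0"
proof -
  have degF: "0 < degree F"
    using irreducible_field_poly_degree[OF assms] by (simp add: degree_map_poly)
  then have f0: "coeff (expand i F) (degree F) \<noteq> 0"
    using expand_mpoly_eq_iff[of i "lead_coeff F" 0] by (auto simp: expand_def coeff_map_poly)
  then obtain n where "coeff2 (expand i F) (degree F, n) \<noteq> 0"
    by (auto simp: coeff2_def poly_eq_iff)
  then show "1 \<le> total_degree2 (expand i F)"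
    using coeff2_le_total_degree2[of "expand i F" "degree F" n] degF by linarith
  show "expand i F \<noteq> 0" using f0 by auto
qed

text \<open>
  Both directions pass through the rigidity of \<open>f = expand i F\<close> over \<open>k[X\<^sub>I]\<close>. The indices \<open>l, m\<close> of the
  normalization are those of a monomial of top degree: from (III) one that survives the
  specialization is given; in the other direction \<open>x\<close> is chosen so that the monomial survives, which also
  preserves the total degree.
\<close>

lemma cond_III_iff_alg_closed_mod:
  fixes F :: "('i::{finite,linorder}, 'k::field_char_0) mpoly poly"
  assumes irr: "irreducible (fract_poly F)"
    and prim: "\<And>c. [:c:] dvd F \<Longrightarrow> c dvd 1"
  shows "cond_III i F \<longleftrightarrow> alg_closed_mod (ratfuns_in (- {i})) (fract_poly F)"
proof
  define f where "f = expand i F"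
  have sp: "to_closure2 (specialize i x F) = map_coeffs2 (\<lambda>p. to_ac (mpoly_eval id x p)) f" for x
    by (rule coeff2_eqI)
       (simp add: to_closure2_def specialize_def f_def coeff2_def coeff_map_poly to_ac_0)
  have hom: "cring_hom (\<lambda>p. to_ac (mpoly_eval id x p))" for x :: "'i \<Rightarrow> 'k"
    by unfold_locales (simp_all add: eval_hom.hom_add eval_hom.hom_mult to_ac_add to_ac_mult)
  have ac: "cring_hom (to_ac :: 'k \<Rightarrow> 'k alg_closure)" "\<And>x :: 'k. to_ac x = 0 \<Longrightarrow> x = 0"
    by (unfold_locales, simp_all add: to_ac_add to_ac_mult)
  have td: "total_degree2 (to_closure2 g) = total_degree2 g" for g :: "'k poly poly"
    unfolding to_closure2_def by (rule total_degree2_map_coeffs2_inj[OF ac])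
  {
    assume "cond_III i F"
    then obtain x where x: "irreducible (to_closure2 (specialize i x F))"
      "total_degree2 (specialize i x F) = total_degree2 f"
      unfolding cond_III_def f_def by blast
    define g where "g = to_closure2 (specialize i x F)"
    have tg: "total_degree2 g = total_degree2 f" using x(2) by (simp add: g_def td)
    have "g \<noteq> 0" using x(1) by (auto simp: g_def)
    have D: "1 \<le> total_degree2 f" unfolding f_def by (rule total_degree2_expand_pos(1)[OF irr])
    obtain l m where lm: "coeff2 g (l, m) \<noteq> 0" "l + m = total_degree2 g"
      by (rule total_degree2_attained[OF \<open>g \<noteq> 0\<close>])
    have "rigid l m g"
      using x(1) lm by (intro irreducible_imp_rigid) (simp_all add: g_def)
    then have rf: "rigid l m f" unfolding g_def sp by (rule rigid_reflect[OF hom])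
    have cf: "coeff2 f (l, m) \<noteq> 0"
      using lm(1) cring_hom.coeff2_map_coeffs2[OF hom, of x f "(l, m)"] unfolding g_def sp
      by (auto simp: to_ac_0)
    define \<kappa> where "\<kappa> = (\<lambda>p :: ('i, 'k) mpoly. to_ac (to_fract p))"
    have "cring_hom \<kappa>" unfolding \<kappa>_def by unfold_locales (simp_all add: to_ac_add to_ac_mult)
    moreover obtain \<delta> where "\<delta> \<noteq> 0"
      "\<And>\<phi> :: ('i, 'k) mpoly \<Rightarrow> ('i, 'k) ratfun alg_closure. cring_hom \<phi> \<Longrightarrow> \<phi> \<delta> \<noteq> 0 \<Longrightarrow> rigid l m (map_coeffs2 \<phi> f)"
      using rigid_specialize[OF rf, where 'b = "('i, 'k) ratfun alg_closure"] by blast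
    moreover have "\<kappa> \<delta> \<noteq> 0" using \<open>\<delta> \<noteq> 0\<close> by (simp add: \<kappa>_def to_ac_eq_0_iff)
    ultimately have "rigid l m (map_coeffs2 \<kappa> f)" by blast
    then show "alg_closed_mod (ratfuns_in (- {i})) (fract_poly F)"
      unfolding f_def \<kappa>_def
      by (rule alg_closed_mod_if_geometrically_rigid[OF irr])
         (use lm tg cf D in \<open>auto simp: f_def\<close>)
  }
  {
    assume closed: "alg_closed_mod (ratfuns_in (- {i})) (fract_poly F)"
    have D: "1 \<le> total_degree2 f" and "f \<noteq> 0"
      unfolding f_def using total_degree2_expand_pos[OF irr] by blast+
    obtain l m where lm: "coeff2 f (l, m) \<noteq> 0" "l + m = total_degree2 f"
      by (rule total_degree2_attained[OF \<open>f \<noteq> 0\<close>])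
    have rf: "rigid l m f" unfolding f_def
      by (rule rigid_expand[OF irr prim closed]) (use lm D in \<open>auto simp: f_def\<close>)
    obtain \<delta> where \<delta>: "\<delta> \<noteq> 0"
      "\<And>\<phi> :: ('i, 'k) mpoly \<Rightarrow> 'k alg_closure. cring_hom \<phi> \<Longrightarrow> \<phi> \<delta> \<noteq> 0 \<Longrightarrow> rigid l m (map_coeffs2 \<phi> f)"
      using rigid_specialize[OF rf, where 'b = "'k alg_closure"] by blast
    \<comment> \<open>rigidity and the total degree are preserved at such an \<open>x\<close>\<close>
    obtain x where x: "mpoly_eval id x (\<delta> * coeff2 f (l, m)) \<noteq> 0"
      using mpoly_eval_nonzero_exists[of UNIV "\<delta> * coeff2 f (l, m)"] \<delta>(1) lm(1) by auto
    define g where "g = to_closure2 (specialize i x F)"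
    have "rigid l m g" unfolding g_def sp
      by (rule \<delta>(2)[OF hom]) (use x in \<open>auto simp: eval_hom.hom_mult to_ac_eq_0_iff\<close>)
    moreover have cg: "coeff2 g (l, m) \<noteq> 0"
      using x unfolding g_def sp cring_hom.coeff2_map_coeffs2[OF hom] by (auto simp: eval_hom.hom_mult to_ac_eq_0_iff)
    moreover have tg: "total_degree2 g = l + m"
      using coeff2_le_total_degree2[OF cg] total_degree2_map_coeffs2_le[OF hom, of x f] lm(2)
      unfolding g_def sp by simp
    ultimately have "irreducible g"
      using rigid_imp_irreducible[of l m g] D lm(2) by simp
    then show "cond_III i F"
      unfolding cond_III_def using tg lm(2) by (auto simp: g_def td f_def)
  }
qed

text \<open>
  Evaluation at \<open>x\<close> commutes with the forms, so they do not vanish identically iff at some \<open>x\<close> they do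
  not vanish at the coefficients of the specialized polynomial, which by Noether's lemma says that it is
  irreducible of full degree.
\<close>

lemma cond_III_iff_cond_IV:
  fixes F :: "('i::{finite,linorder}, 'k::field_char_0) mpoly poly"
  assumes irr: "irreducible (fract_poly F)"
    and noether: "\<And>D\<^sub>0. 1 \<le> D\<^sub>0 \<Longrightarrow> noether_forms TYPE('k) D\<^sub>0 (B D\<^sub>0)"
  shows "cond_III i F \<longleftrightarrow> cond_IV B i F"
proof -
  define f where "f = expand i F"
  define D where "D = total_degree2 f"
  define s where "s x = specialize i x F" for x
  have D: "1 \<le> D" unfolding D_def f_def by (rule total_degree2_expand_pos(1)[OF irr])
  have s: "s x = map_coeffs2 (mpoly_eval id x) f" for x by (simp add: s_def specialize_def f_def)
  have ac: "cring_hom (to_ac :: 'k \<Rightarrow> 'k alg_closure)" "\<And>x :: 'k. to_ac x = 0 \<Longrightarrow> x = 0"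
    by (unfold_locales, simp_all add: to_ac_add to_ac_mult)
  have td: "total_degree2 (to_closure2 g) = total_degree2 g" for g :: "'k poly poly"
    unfolding to_closure2_def by (rule total_degree2_map_coeffs2_inj[OF ac])
  have sD: "total_degree2 (s x) \<le> D" for x
    unfolding s D_def by (rule total_degree2_map_coeffs2_le[OF cring_hom_mpoly_eval]) (unfold_locales, simp_all)
  have N: "forms_vanish (B D) (coeff2 (s x)) \<longleftrightarrow> reducible_over_closure (s x) \<or> total_degree2 (s x) < D" for x
    using noether[OF D] sD[of x] unfolding noether_forms_def by blast
  have eval: "mpoly_eval id x (mpoly_eval of_int (coeff2 f) b) = mpoly_eval of_int (coeff2 (s x)) b" for x b
    unfolding mpoly_eval_def[of of_int]
    by (simp add: eval_hom.hom_sum eval_hom.hom_mult eval_hom.hom_of_int eval_hom.hom_prod eval_hom.hom_power s eval_hom.coeff2_map_coeffs2)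
  have "cond_IV B i F \<longleftrightarrow> (\<exists>b\<in>B D. mpoly_eval of_int (coeff2 f) b \<noteq> 0)"
    by (simp add: cond_IV_def forms_vanish_def D_def f_def)
  also have "\<dots> \<longleftrightarrow> (\<exists>b\<in>B D. \<exists>x. mpoly_eval id x (mpoly_eval of_int (coeff2 f) b) \<noteq> 0)"
  proof -
    have "p \<noteq> 0 \<longleftrightarrow> (\<exists>x. mpoly_eval id x p \<noteq> 0)" for p :: "('i, 'k) mpoly"
      using mpoly_eval_nonzero_exists[of UNIV p] by auto
    then show ?thesis by blast
  qed
  also have "\<dots> \<longleftrightarrow> (\<exists>x. \<not> forms_vanish (B D) (coeff2 (s x)))"
    unfolding eval forms_vanish_def by blast
  also have "\<dots> \<longleftrightarrow> (\<exists>x. \<not> reducible_over_closure (s x) \<and> total_degree2 (s x) = D)"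
    unfolding N using sD by (meson le_neq_implies_less less_irrefl)
  also have "\<dots> \<longleftrightarrow> (\<exists>x. irreducible (to_closure2 (s x)) \<and> total_degree2 (s x) = D)"
  proof -
    have "irreducible (to_closure2 g) \<longleftrightarrow> \<not> reducible_over_closure g"
      if "total_degree2 g = D" for g :: "'k poly poly"
      using irreducible_iff_no_factorization[of "to_closure2 g"] that D
      unfolding td reducible_over_closure_def by simp
    then show ?thesis by blast
  qed
  also have "\<dots> \<longleftrightarrow> cond_III i F" by (simp add: cond_III_def s_def D_def f_def)
  finally show ?thesis by simp
qed

section \<open>The quotient ring\<close>

lemma type_ring_simps:
  "carrier (ring_of_type_algebra :: 'a::ring_1 ring) = UNIV"
  "x \<otimes>\<^bsub>(ring_of_type_algebra :: 'a ring)\<^esub> y = x * y"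
  "\<one>\<^bsub>(ring_of_type_algebra :: 'a ring)\<^esub> = 1"
  "x \<oplus>\<^bsub>(ring_of_type_algebra :: 'a ring)\<^esub> y = x + y"
  "\<zero>\<^bsub>(ring_of_type_algebra :: 'a ring)\<^esub> = 0"
  by (simp_all add: ring_of_type_algebra_def)

lemma type_ring_a_inv: "\<ominus>\<^bsub>(ring_of_type_algebra :: 'a::comm_ring_1 ring)\<^esub> x = - x"
proof -
  interpret cring "ring_of_type_algebra :: 'a ring" by (rule cring_from_type_algebra)
  show ?thesis by (rule minus_equality) (simp_all add: type_ring_simps)
qed

lemma type_ring_minus: "x \<ominus>\<^bsub>(ring_of_type_algebra :: 'a::comm_ring_1 ring)\<^esub> y = x - y"
  by (simp add: a_minus_def type_ring_a_inv type_ring_simps)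

interpretation ratfun_polys: cring "ratfun_poly_ring :: ('i::{finite,linorder}, 'k::field_char_0) ratfun poly ring"
  unfolding ratfun_poly_ring_def by (rule cring_from_type_algebra)

interpretation ratfuns: cring "ratfun_ring :: ('i::{finite,linorder}, 'k::field_char_0) ratfun ring"
  unfolding ratfun_ring_def by (rule cring_from_type_algebra)

lemma field_ratfun_ring: "Ring.field (ratfun_ring :: ('i::{finite,linorder}, 'k::field_char_0) ratfun ring)"
  unfolding ratfun_ring_def by (rule field_from_type_algebra)

definition quot_ideal ::
  "('i::{finite,linorder}, 'k::field_char_0) mpoly poly \<Rightarrow> ('i, 'k) ratfun poly set" where
  "quot_ideal G = PIdl\<^bsub>ratfun_poly_ring\<^esub> (fract_poly G)"

text \<open>
  Every element of \<open>quot_field G\<close> is such a class, and equality of classes is divisibility of the difference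
  by \<open>G\<close> (\<open>quot_cls_eq_iff\<close>). This translates statements about cosets into statements about polynomials.
\<close>

definition quot_cls ::
  "('i::{finite,linorder}, 'k::field_char_0) mpoly poly \<Rightarrow> ('i, 'k) ratfun poly \<Rightarrow> ('i, 'k) ratfun poly set" where
  "quot_cls G u = quot_ideal G +>\<^bsub>ratfun_poly_ring\<^esub> u"

lemma quot_ideal_mem: "u \<in> quot_ideal G \<longleftrightarrow> fract_poly G dvd u"
  by (auto simp: quot_ideal_def cgenideal_def ratfun_poly_ring_def type_ring_simps dvd_def mult.commute)

lemma ideal_quot_ideal: "ideal (quot_ideal G) ratfun_poly_ring"
  unfolding quot_ideal_def
  by (rule ratfun_polys.cgenideal_ideal) (simp add: ratfun_poly_ring_def type_ring_simps)

lemma quot_field_eq: "quot_field G = ratfun_poly_ring Quot (quot_ideal G)"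
  by (simp add: quot_field_def quot_ideal_def)

lemma quot_emb_eq: "quot_emb G a = quot_cls G [:a:]"
  by (simp add: quot_emb_def quot_cls_def quot_ideal_def)

lemma cring_quot_field: "cring (quot_field G)"
  unfolding quot_field_eq by (rule ideal.quotient_is_cring[OF ideal_quot_ideal ratfun_polys.is_cring])

lemma quot_cls_hom: "quot_cls G \<in> ring_hom ratfun_poly_ring (quot_field G)"
  using ideal.rcos_ring_hom[OF ideal_quot_ideal, of G]
  by (simp add: quot_field_eq quot_cls_def[abs_def])

lemma quot_cls_simps:
  "quot_cls G (u + w) = quot_cls G u \<oplus>\<^bsub>quot_field G\<^esub> quot_cls G w"
  "quot_cls G (u * w) = quot_cls G u \<otimes>\<^bsub>quot_field G\<^esub> quot_cls G w"
  "quot_cls G 1 = \<one>\<^bsub>quot_field G\<^esub>"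
  using ring_hom_memE[OF quot_cls_hom[of G]]
  by (simp_all add: ratfun_poly_ring_def type_ring_simps)

lemma quot_cls_carrier: "quot_cls G u \<in> carrier (quot_field G)"
  using ring_hom_memE(1)[OF quot_cls_hom[of G]]
  by (simp add: ratfun_poly_ring_def type_ring_simps)

lemma quot_cls_zero: "quot_cls G 0 = \<zero>\<^bsub>quot_field G\<^esub>"
proof -
  interpret Q: cring "quot_field G" by (rule cring_quot_field)
  have "quot_cls G 0 = quot_cls G 0 \<oplus>\<^bsub>quot_field G\<^esub> quot_cls G 0"
    by (simp flip: quot_cls_simps(1))
  then show ?thesis
    using Q.add.l_cancel_one'[of "quot_cls G 0" "quot_cls G 0"] quot_cls_carrier by auto
qed

lemma carrier_quot_field: "carrier (quot_field G) = range (quot_cls G)"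
  by (auto simp: quot_field_eq FactRing_def A_RCOSETS_def' quot_cls_def ratfun_poly_ring_def type_ring_simps)

lemma quot_cls_eq_iff: "quot_cls G u = quot_cls G w \<longleftrightarrow> fract_poly G dvd u - w"
  using ratfun_polys.quotient_eq_iff_same_a_r_cos[OF ideal_quot_ideal[of G], of u w]
  by (simp add: quot_cls_def quot_ideal_mem ratfun_poly_ring_def type_ring_simps type_ring_minus)

lemma quot_cls_eq_zero_iff: "quot_cls G u = \<zero>\<^bsub>quot_field G\<^esub> \<longleftrightarrow> fract_poly G dvd u"
  using quot_cls_eq_iff[of G u 0] by (simp add: quot_cls_zero)

lemma quot_cls_pow: "quot_cls G (u ^ n) = quot_cls G u [^]\<^bsub>quot_field G\<^esub> n"
proof -
  interpret Q: cring "quot_field G" by (rule cring_quot_field)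
  show ?thesis
    by (induction n) (simp_all add: quot_cls_simps Q.m_comm quot_cls_carrier)
qed

lemma quot_emb_hom: "quot_emb G \<in> ring_hom ratfun_ring (quot_field G)"
proof (rule ring_hom_memI)
  fix x y
  show "quot_emb G x \<in> carrier (quot_field G)" by (simp add: quot_emb_eq quot_cls_carrier)
  show "quot_emb G (x \<otimes>\<^bsub>ratfun_ring\<^esub> y) = quot_emb G x \<otimes>\<^bsub>quot_field G\<^esub> quot_emb G y"
    "quot_emb G (x \<oplus>\<^bsub>ratfun_ring\<^esub> y) = quot_emb G x \<oplus>\<^bsub>quot_field G\<^esub> quot_emb G y"
    by (simp_all add: quot_emb_eq ratfun_ring_def type_ring_simps mult.commute flip: quot_cls_simps)
  show "quot_emb G \<one>\<^bsub>ratfun_ring\<^esub> = \<one>\<^bsub>quot_field G\<^esub>"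
    by (simp add: quot_emb_eq ratfun_ring_def type_ring_simps flip: quot_cls_simps one_pCons)
qed

lemma field_quot_field:
  assumes irr: "irreducible (fract_poly G)"
  shows "Ring.field (quot_field G)"
proof -
  interpret Q: cring "quot_field G" by (rule cring_quot_field)
  show ?thesis
  proof (rule Q.cring_fieldI2)
    have "\<not> fract_poly G dvd 1" using irr by (simp add: irreducible_def)
    then show "\<zero>\<^bsub>quot_field G\<^esub> \<noteq> \<one>\<^bsub>quot_field G\<^esub>"
      using quot_cls_eq_zero_iff[of G 1] by (auto simp: quot_cls_simps(3))
    fix a assume "a \<in> carrier (quot_field G)" "a \<noteq> \<zero>\<^bsub>quot_field G\<^esub>"
    then obtain u where u: "a = quot_cls G u" "\<not> fract_poly G dvd u"
      unfolding carrier_quot_field quot_cls_eq_zero_iff[symmetric] by blast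
    obtain s t where st: "s * u + t * fract_poly G = 1" by (rule field_poly_bezout[OF irr u(2)])
    then have "u * s - 1 = fract_poly G * (- t)" by (simp add: algebra_simps)
    then have "fract_poly G dvd u * s - 1" by simp
    then have "quot_cls G (u * s) = quot_cls G 1" by (simp add: quot_cls_eq_iff)
    then show "\<exists>b\<in>carrier (quot_field G). a \<otimes>\<^bsub>quot_field G\<^esub> b = \<one>\<^bsub>quot_field G\<^esub>"
      using u(1) quot_cls_carrier by (auto simp: quot_cls_simps)
  qed
qed

lemma pcompose_monom: "pcompose (monom c n) u = smult c (u ^ n)"
  for u :: "'a::comm_ring_1 poly"
  by (induction n) (simp_all add: monom_0 monom_Suc pcompose_pCons)

lemma Poly_snoc: "Poly (xs @ [c]) = Poly xs + monom c (length xs)"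
  for c :: "'a::comm_ring_1"
  by (simp add: Poly_append monom_altdef[symmetric] monom_0 mult_monom flip: monom_eq_1_iff)
     (simp add: monom_0 smult_monom)

text \<open>
  Lists of coefficients start with the leading one, hence the reversal.
\<close>

lemma quot_cls_pcompose:
  "quot_cls G (pcompose (Poly (rev cs)) u) = ring.eval (quot_field G) (map (quot_emb G) cs) (quot_cls G u)"
proof -
  interpret Q: cring "quot_field G" by (rule cring_quot_field)
  show ?thesis
  proof (induction cs)
    case Nil
    then show ?case by (simp add: quot_cls_zero)
  next
    case (Cons c cs)
    have "pcompose (Poly (rev (c # cs))) u = [:c:] * u ^ length cs + pcompose (Poly (rev cs)) u"
      by (simp add: Poly_snoc pcompose_add pcompose_monom)
    then show ?case by (simp add: quot_cls_simps quot_cls_pow Cons.IH quot_emb_eq del: mult_pCons_left)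
  qed
qed

lemma quot_emb_eq_zero_iff:
  assumes "irreducible (fract_poly G)"
  shows "quot_emb G a = \<zero>\<^bsub>quot_field G\<^esub> \<longleftrightarrow> a = 0"
proof
  assume "quot_emb G a = \<zero>\<^bsub>quot_field G\<^esub>"
  then have "fract_poly G dvd [:a:]" by (simp add: quot_emb_eq quot_cls_eq_zero_iff)
  then have "a \<noteq> 0 \<Longrightarrow> degree (fract_poly G) \<le> 0" using dvd_imp_degree_le[of "fract_poly G" "[:a:]"] by simp
  then show "a = 0" using irreducible_field_poly_degree[OF assms] by auto
qed (simp add: quot_emb_eq quot_cls_zero)

lemma algebraic_quot_iff:
  fixes K :: "('i::{finite,linorder}, 'k::field_char_0) ratfun set"
  assumes irr: "irreducible (fract_poly G)"
    and sub: "subring (quot_emb G ` K) (quot_field G)" and "0 \<in> K"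
  shows "ring.algebraic (quot_field G) (quot_emb G ` K) (quot_cls G u) \<longleftrightarrow>
    (\<exists>m. m \<noteq> 0 \<and> (\<forall>n. coeff m n \<in> K) \<and> fract_poly G dvd pcompose m u)"
proof -
  interpret Q: field "quot_field G" by (rule field_quot_field[OF irr])
  let ?K = "quot_emb G ` K"
  show ?thesis
  proof
    assume "Q.algebraic ?K (quot_cls G u)"
    then have "(Q.algebraic over ?K) (quot_cls G u)" by (simp add: over_def)
    then obtain p where p: "p \<in> carrier (?K [X]\<^bsub>quot_field G\<^esub>)" "p \<noteq> []"
      "Q.eval p (quot_cls G u) = \<zero>\<^bsub>quot_field G\<^esub>"
      using Q.algebraicE[OF sub quot_cls_carrier] by blast
    have pK: "set p \<subseteq> ?K" and hd: "hd p \<noteq> \<zero>\<^bsub>quot_field G\<^esub>"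
      using p(1,2) by (auto simp: univ_poly_def polynomial_def)
    have "\<exists>cs. set cs \<subseteq> K \<and> p = map (quot_emb G) cs"
      using pK
    proof (induction p)
      case (Cons x p)
      then obtain cs c where "set cs \<subseteq> K" "p = map (quot_emb G) cs" "c \<in> K" "x = quot_emb G c" by auto
      then show ?case by (intro exI[of _ "c # cs"]) auto
    qed simp
    then obtain cs where cs: "set cs \<subseteq> K" "p = map (quot_emb G) cs" by blast
    obtain c cs' where c: "cs = c # cs'" using cs(2) p(2) by (cases cs) auto
    then have c0: "c \<noteq> 0" using hd cs(2) by (auto simp: quot_emb_eq_zero_iff[OF irr])
    define m where "m = Poly (rev cs)"
    have "coeff m (length cs') = c"
      by (simp add: m_def c Poly_snoc nth_default_def)
    then have "m \<noteq> 0" using c0 by auto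
    moreover have "coeff m n \<in> K" for n
    proof (cases "n < length cs")
      case True
      then have "rev cs ! n \<in> set cs" using nth_mem[of n "rev cs"] by simp
      then show ?thesis using True cs(1) by (auto simp: m_def nth_default_def)
    qed (simp add: m_def nth_default_def \<open>0 \<in> K\<close>)
    moreover have "fract_poly G dvd pcompose m u"
      using p(3) unfolding cs(2) quot_cls_pcompose[symmetric] m_def by (simp add: quot_cls_eq_zero_iff)
    ultimately show "\<exists>m. m \<noteq> 0 \<and> (\<forall>n. coeff m n \<in> K) \<and> fract_poly G dvd pcompose m u" by blast
  next
    assume "\<exists>m. m \<noteq> 0 \<and> (\<forall>n. coeff m n \<in> K) \<and> fract_poly G dvd pcompose m u"
    then obtain m where m: "m \<noteq> 0" "\<And>n. coeff m n \<in> K" "fract_poly G dvd pcompose m u" by blast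
    define p where "p = map (quot_emb G) (rev (coeffs m))"
    have "set (coeffs m) \<subseteq> K" using m(2) by (auto simp: coeffs_def)
    moreover have "hd p = quot_emb G (lead_coeff m)"
      using m(1) by (simp add: p_def hd_map hd_rev last_coeffs_eq_coeff_degree)
    ultimately have "p \<in> carrier (?K [X]\<^bsub>quot_field G\<^esub>)"
      using m(1) by (auto simp: univ_poly_def polynomial_def p_def quot_emb_eq_zero_iff[OF irr])
    moreover have "p \<noteq> []" using m(1) by (simp add: p_def)
    moreover have "Q.eval p (quot_cls G u) = \<zero>\<^bsub>quot_field G\<^esub>"
      using m(3) unfolding p_def quot_cls_pcompose[symmetric] by (simp add: quot_cls_eq_zero_iff)
    ultimately have "(Q.algebraic over ?K) (quot_cls G u)" by (rule Q.algebraicI)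
    then show "Q.algebraic ?K (quot_cls G u)" by (simp add: over_def)
  qed
qed

lemma fracs_of_closed:
  fixes S :: "'a::idom set"
  assumes "0 \<in> S" "1 \<in> S" "\<And>a b. a \<in> S \<Longrightarrow> b \<in> S \<Longrightarrow> a * b \<in> S"
    "\<And>a b. a \<in> S \<Longrightarrow> b \<in> S \<Longrightarrow> a + b \<in> S" "\<And>a. a \<in> S \<Longrightarrow> - a \<in> S"
  shows "0 \<in> fracs_of S" "1 \<in> fracs_of S"
    "x \<in> fracs_of S \<Longrightarrow> y \<in> fracs_of S \<Longrightarrow> x * y \<in> fracs_of S"
    "x \<in> fracs_of S \<Longrightarrow> y \<in> fracs_of S \<Longrightarrow> x + y \<in> fracs_of S"
    "x \<in> fracs_of S \<Longrightarrow> - x \<in> fracs_of S"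
proof -
  have mem: "Fract p q \<in> fracs_of S" if "p \<in> S" "q \<in> S" "q \<noteq> 0" for p q
    using that by (auto simp: fracs_of_def)
  show "0 \<in> fracs_of S" "1 \<in> fracs_of S"
    unfolding Zero_fract_def One_fract_def using assms by (auto intro: mem)
  show "x * y \<in> fracs_of S" "x + y \<in> fracs_of S" if xy: "x \<in> fracs_of S" "y \<in> fracs_of S"
  proof -
    obtain a b c d where "x = Fract a b" "y = Fract c d" "b \<noteq> 0" "d \<noteq> 0" "a \<in> S" "b \<in> S" "c \<in> S" "d \<in> S"
      using xy by (auto simp: fracs_of_def)
    then show "x * y \<in> fracs_of S" "x + y \<in> fracs_of S" using assms(3,4) by (auto intro!: mem)
  qed
  show "- x \<in> fracs_of S" if "x \<in> fracs_of S"
  proof -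
    obtain a b where "x = Fract a b" "b \<noteq> 0" "a \<in> S" "b \<in> S" using \<open>x \<in> fracs_of S\<close> by (auto simp: fracs_of_def)
    then show ?thesis using assms(5) by (auto intro!: mem)
  qed
qed

lemma ratfuns_in_subring:
  fixes J :: "'i::{finite,linorder} set"
  shows "0 \<in> (ratfuns_in J :: ('i, 'k::field_char_0) ratfun set)"
    "subring (quot_emb G ` ratfuns_in J) (quot_field (G :: ('i, 'k) mpoly poly))"
proof -
  let ?S = "{p :: ('i, 'k) mpoly. mpoly_vars p \<subseteq> J}"
  have c: "a * b \<in> ?S" "a + b \<in> ?S" "- a \<in> ?S" if "a \<in> ?S" "b \<in> ?S" for a b
    using that mpoly_vars_mult[of a b] mpoly_vars_add[of a b] by (auto simp: mpoly_vars_uminus)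
  have 0: "0 \<in> ?S" "1 \<in> ?S" by auto
  note K = fracs_of_closed[of ?S, OF 0 c(1) c(2) c(3), folded ratfuns_in_eq, simplified]
  show "0 \<in> (ratfuns_in J :: ('i, 'k::field_char_0) ratfun set)" by (rule K(1))
  interpret h: ring_hom_ring ratfun_ring "quot_field G" "quot_emb G"
    by (rule ring_hom_ringI2) (use ratfuns.ring_axioms cring_quot_field[of G] quot_emb_hom in \<open>auto simp: cring_def\<close>)
  have "subring (ratfuns_in J :: ('i, 'k) ratfun set) ratfun_ring"
    by (rule ratfuns.subringI)
       (use K in \<open>auto simp: ratfun_ring_def type_ring_simps type_ring_a_inv\<close>)
  then show "subring (quot_emb G ` ratfuns_in J) (quot_field G)" by (rule h.img_is_subring)
qed

lemma cond_II_iff_alg_closed_mod: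
  fixes F :: "('i::{finite,linorder}, 'k::field_char_0) mpoly poly"
  assumes irr: "irreducible (fract_poly F)"
  shows "cond_II i F \<longleftrightarrow> alg_closed_mod (ratfuns_in (- {i})) (fract_poly F)"
proof -
  let ?K = "ratfuns_in (- {i}) :: ('i, 'k) ratfun set"
  interpret Q: field "quot_field F" by (rule field_quot_field[OF irr])
  note alg = algebraic_quot_iff[OF irr ratfuns_in_subring(2)[of F "- {i}"] ratfuns_in_subring(1)]
  have mem: "quot_cls F u \<in> quot_emb F ` ?K \<longleftrightarrow> (\<exists>c\<in>?K. fract_poly F dvd u - [:c:])" for u
    by (auto simp: quot_emb_eq quot_cls_eq_iff image_iff)
  have self: "Q.algebraic (quot_emb F ` ?K) z" if "z \<in> quot_emb F ` ?K" for z
    using Q.algebraic_self[OF ratfuns_in_subring(2) that] by (simp add: over_def)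
  have "cond_II i F \<longleftrightarrow> (\<forall>z\<in>carrier (quot_field F). Q.algebraic (quot_emb F ` ?K) z \<longrightarrow> z \<in> quot_emb F ` ?K)"
    unfolding cond_II_def Let_def using self by (auto simp: quot_emb_eq quot_cls_carrier)
  also have "\<dots> \<longleftrightarrow> alg_closed_mod ?K (fract_poly F)"
    unfolding carrier_quot_field alg_closed_mod_def by (auto simp: alg mem)
  finally show ?thesis .
qed

section \<open>Strongly genuine extensions\<close>

lemma pcompose_one [simp]: "pcompose 1 u = 1" for u :: "'a::comm_ring_1 poly"
  by (simp add: one_pCons pcompose_pCons)

lemma subfield_range_quot_emb:
  fixes F :: "('i::{finite,linorder}, 'k::field_char_0) mpoly poly"
  assumes irr: "irreducible (fract_poly F)"
  shows "subfield (range (quot_emb F)) (quot_field F)"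
proof -
  interpret Q: field "quot_field F" by (rule field_quot_field[OF irr])
  interpret h: ring_hom_ring ratfun_ring "quot_field F" "quot_emb F"
    by (rule ring_hom_ringI2) (use ratfuns.ring_axioms Q.ring_axioms quot_emb_hom in auto)
  have "subfield UNIV (ratfun_ring :: ('i, 'k) ratfun ring)"
    using field.carrier_is_subfield[OF field_ratfun_ring[where 'i = 'i and 'k = 'k]]
    by (simp add: ratfun_ring_def type_ring_simps)
  then show ?thesis by (rule h.img_is_subfield(2)) (rule Q.one_not_zero)
qed

text \<open>
  The quotient is generated by the class of \<open>Y\<close>, which is a root of \<open>F\<close>.
\<close>

lemma finite_dimension_quot_field:
  assumes irr: "irreducible (fract_poly F)"
  shows "ring.finite_dimension (quot_field F) (range (quot_emb F)) (carrier (quot_field F))"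
proof -
  interpret Q: field "quot_field F" by (rule field_quot_field[OF irr])
  let ?K = "range (quot_emb F)" and ?x = "quot_cls F [:0, 1:]"
  have sf: "subfield ?K (quot_field F)" by (rule subfield_range_quot_emb[OF irr])
  have "fract_poly F \<noteq> 0" using irr by auto
  then have "Q.algebraic ?K ?x"
    using algebraic_quot_iff[OF irr subfieldE(1)[OF sf], of "[:0, 1:]"]
    by (auto intro!: exI[of _ "fract_poly F"])
  then have "Q.finite_dimension ?K (Q.simple_extension ?K ?x)"
    using Q.finite_dimension_simple_extension[OF sf quot_cls_carrier] by (simp add: over_def)
  moreover have "quot_cls F u \<in> Q.simple_extension ?K ?x" for u
  proof (induction u)
    case 0
    then show ?case by (simp add: quot_cls_zero Q.simple_extension.zero)
  next
    case (pCons a u)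
    have "pCons a u = u * [:0, 1:] + [:a:]" by simp
    then have "quot_cls F (pCons a u) = quot_cls F u \<otimes>\<^bsub>quot_field F\<^esub> ?x \<oplus>\<^bsub>quot_field F\<^esub> quot_emb F a"
      by (simp add: quot_emb_eq flip: quot_cls_simps)
    then show ?case using Q.simple_extension.lin[OF pCons.IH, of "quot_emb F a"] by simp
  qed
  then have "Q.simple_extension ?K ?x = carrier (quot_field F)"
    using Q.simple_extension_in_carrier[OF subfieldE(3)[OF sf] quot_cls_carrier, of "[:0, 1:]"]
    unfolding carrier_quot_field by blast
  ultimately show ?thesis by simp
qed

text \<open>
  \<open>M\<close> is a subspace of a finite-dimensional space, so it has a finite spanning list, and spans are the
  same whether computed in \<open>M\<close> or in the whole quotient.
\<close>

lemma finite_extension_subfield: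
  assumes irr: "irreducible (fract_poly F)"
    and M: "subfield M (quot_field F)" "range (quot_emb F) \<subseteq> M"
  shows "finite_extension_of_ratfun (quot_field F\<lparr>carrier := M\<rparr>) (quot_emb F)"
proof -
  interpret Q: field "quot_field F" by (rule field_quot_field[OF irr])
  let ?K = "range (quot_emb F)" and ?M = "quot_field F\<lparr>carrier := M\<rparr>"
  have sf: "subfield ?K (quot_field F)" by (rule subfield_range_quot_emb[OF irr])
  have fM: "Ring.field ?M" by (rule Q.subfield_iff(2)[OF M(1)])
  interpret M: field ?M by (rule fM)
  have sub: "subring M (quot_field F)" by (rule subfieldE(1)[OF M(1)])
  have sfM: "subfield ?K ?M"
  proof (rule M.subfield_iff(1))
    show "Ring.field (?M\<lparr>carrier := ?K\<rparr>)" using Q.subfield_iff(2)[OF sf] by simp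
  qed (use M(2) in simp)
  have "subalgebra ?K M (quot_field F)"
    unfolding subalgebra_def subalgebra_axioms_def
    using subring.axioms(1)[OF sub] subringE(6)[OF sub] M(2) by blast
  then have "Q.finite_dimension ?K M"
    by (rule Q.subalbegra_incl_imp_finite_dimension[OF sf finite_dimension_quot_field[OF irr]])
       (rule subfieldE(3)[OF M(1)])
  then obtain n where "Q.dimension n ?K M" by (rule Q.finite_dimensionE')
  then obtain Us where Us: "set Us \<subseteq> carrier (quot_field F)" "Q.Span ?K Us = M"
    using Q.exists_base[OF sf] by blast
  then have "set Us \<subseteq> M" using Q.Span_base_incl[OF sf Us(1)] by simp
  then have "M.finite_dimension ?K (M.Span ?K Us)" by (intro M.Span_finite_dimension[OF sfM]) simp
  then have "M.finite_dimension ?K (carrier ?M)"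
    using Us(2) by (simp add: Q.Span_consistent[OF sub])
  moreover have "quot_emb F \<in> ring_hom ratfun_ring ?M"
    using ring_hom_memE[OF quot_emb_hom[of F]] M(2)
    by (intro ring_hom_memI) auto
  ultimately show ?thesis using fM by (simp add: finite_extension_of_ratfun_def)
qed

lemma degree_in_eq_0_iff: "degree_in i G = 0 \<longleftrightarrow> (\<forall>n. i \<notin> mpoly_vars (coeff G n))"
proof -
  let ?A = "{Poly_Mapping.lookup t i |t l. t \<in> Poly_Mapping.keys (coeff G l)}"
  have "?A \<subseteq> (\<Union>l\<le>degree G. (\<lambda>t. Poly_Mapping.lookup t i) ` Poly_Mapping.keys (coeff G l))"
  proof clarify
    fix t l assume t: "t \<in> Poly_Mapping.keys (coeff G l)"
    then have "coeff G l \<noteq> 0" by auto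
    with t show "Poly_Mapping.lookup t i \<in>
        (\<Union>l\<le>degree G. (\<lambda>t. Poly_Mapping.lookup t i) ` Poly_Mapping.keys (coeff G l))"
      using le_degree by blast
  qed
  then have fin: "finite ?A" by (rule finite_subset) auto
  have "degree_in i G = 0 \<longleftrightarrow> (\<forall>a\<in>?A. a = 0)"
    unfolding degree_in_def using Max_eq_iff[of "insert 0 ?A" 0] fin by auto
  also have "\<dots> \<longleftrightarrow> (\<forall>n. i \<notin> mpoly_vars (coeff G n))"
    by (auto simp: in_mpoly_vars_iff)
  finally show ?thesis .
qed

lemma min_poly_dvd_iff:
  fixes F :: "'a::field poly"
  assumes "is_min_poly F u m"
  shows "F dvd pcompose q u \<longleftrightarrow> m dvd q"
proof
  assume F: "F dvd pcompose q u"
  have "pcompose q u = pcompose m u * pcompose (q div m) u + pcompose (q mod m) u"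
    by (simp flip: pcompose_mult pcompose_add)
  then have "F dvd pcompose (q mod m) u"
    using F assms by (auto simp: is_min_poly_def dvd_add_right_iff)
  moreover have "m \<noteq> 0" using assms by (auto simp: is_min_poly_def)
  ultimately have "q mod m = 0"
    using assms degree_mod_less'[of m q] unfolding is_min_poly_def by (meson not_le)
  then show "m dvd q" by (simp add: dvd_eq_mod_eq_0)
next
  assume "m dvd q"
  then obtain r where "q = m * r" by (elim dvdE)
  then show "F dvd pcompose q u" using assms by (auto simp: is_min_poly_def pcompose_mult)
qed

text \<open>
  If \<open>m = a b\<close>, then \<open>F\<close> divides \<open>a(u)\<close> or \<open>b(u)\<close>, and minimality makes the other factor constant.
\<close>

lemma min_poly_irreducible:
  fixes F :: "'a::field poly"
  assumes irr: "irreducible F" and m: "is_min_poly F u m"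
  shows "irreducible m"
proof (rule irreducibleI)
  show m0: "m \<noteq> 0" using m by (auto simp: is_min_poly_def)
  show "\<not> m dvd 1"
    using min_poly_dvd_iff[OF m, of 1] irr by (simp add: irreducible_def)
  fix a b assume ab: "m = a * b"
  have *: "y dvd 1" if "m = x * y" "F dvd pcompose x u" for x y
  proof -
    have nz: "x \<noteq> 0" "y \<noteq> 0" using that m0 by auto
    have "degree m \<le> degree x" using m nz(1) that(2) by (simp add: is_min_poly_def)
    then have "degree y = 0" using that(1) nz by (simp add: degree_mult_eq)
    then show ?thesis using nz(2) by (auto simp: is_unit_iff_degree)
  qed
  have "F dvd pcompose a u * pcompose b u"
    using m by (simp add: is_min_poly_def ab pcompose_mult)
  then show "a dvd 1 \<or> b dvd 1"
    using irreducible_dvd_multD[OF irr] *[of a b] *[of b a] ab by (auto simp: mult.commute)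
qed

lemma subfield_generated:
  assumes irr: "irreducible (fract_poly F)"
    and mp: "is_min_poly (fract_poly F) u mp"
  shows "subfield (range (\<lambda>p. quot_cls F (pcompose p u))) (quot_field F)"
proof -
  interpret Q: field "quot_field F" by (rule field_quot_field[OF irr])
  let ?c = "\<lambda>p. quot_cls F (pcompose p u)"
  have ops: "?c (p + q) = ?c p \<oplus>\<^bsub>quot_field F\<^esub> ?c q" "?c (p * q) = ?c p \<otimes>\<^bsub>quot_field F\<^esub> ?c q" for p q
    by (simp_all add: pcompose_add pcompose_mult quot_cls_simps)
  have one: "?c 1 = \<one>\<^bsub>quot_field F\<^esub>" by (simp add: quot_cls_simps(3))
  have neg: "\<ominus>\<^bsub>quot_field F\<^esub> ?c p = ?c (- p)" for p
    by (rule Q.minus_equality) (simp_all add: quot_cls_carrier quot_cls_zero flip: ops)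
  show ?thesis
  proof (rule Q.subfieldI')
    show "subring (range ?c) (quot_field F)"
    proof -
      have "\<one>\<^bsub>quot_field F\<^esub> \<in> range ?c" unfolding one[symmetric] by (rule rangeI)
      then show ?thesis
        by (intro Q.subringI) (auto simp: quot_cls_carrier neg simp flip: ops)
    qed
    fix k assume k: "k \<in> range ?c - {\<zero>\<^bsub>quot_field F\<^esub>}"
    then obtain p where p1: "k = ?c p" by blast
    have "\<not> mp dvd p"
      using k p1 unfolding min_poly_dvd_iff[OF mp, symmetric] quot_cls_eq_zero_iff[symmetric] by blast
    note p = p1 this
    obtain s t where st: "s * p + t * mp = 1"
      by (rule field_poly_bezout[OF min_poly_irreducible[OF irr mp] p(2)])
    then have "p * s - 1 = mp * (- t)" by (simp add: algebra_simps)
    then have "mp dvd p * s - 1" by simp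
    then have "?c (p * s) = ?c 1"
      unfolding quot_cls_eq_iff pcompose_diff[symmetric] min_poly_dvd_iff[OF mp] .
    then have "k \<otimes>\<^bsub>quot_field F\<^esub> ?c s = \<one>\<^bsub>quot_field F\<^esub>"
      unfolding ops(2) one p(1) .
    then have "inv\<^bsub>quot_field F\<^esub> k = ?c s"
      by (intro Q.comm_inv_char) (auto simp: p(1) quot_cls_carrier)
    then show "inv\<^bsub>quot_field F\<^esub> k \<in> range ?c" by simp
  qed
qed

text \<open>
  The substitution \<open>p \<mapsto> p(u)\<close> has the ideal generated by the minimal polynomial as kernel; its inverse
  on the image is the required isomorphism.
\<close>

lemma presented_by_min_poly:
  assumes irr: "irreducible (fract_poly F)"
    and mp: "is_min_poly (fract_poly F) u mp" and G: "fract_poly G = smult s mp" "s \<noteq> 0"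
  shows "presented_by (quot_field F\<lparr>carrier := range (\<lambda>p. quot_cls F (pcompose p u))\<rparr>) (quot_emb F) G"
proof -
  let ?c = "\<lambda>p. quot_cls F (pcompose p u)"
  have eq: "?c p = ?c q \<longleftrightarrow> quot_cls G p = quot_cls G q" for p q
    unfolding quot_cls_eq_iff pcompose_diff[symmetric] min_poly_dvd_iff[OF mp] G(1)
    using G(2) by (simp add: smult_dvd_iff)
  define \<phi> where "\<phi> z = quot_cls G (SOME p. z = ?c p)" for z
  have \<phi>: "\<phi> (?c p) = quot_cls G p" for p
  proof -
    have "?c p = ?c (SOME q. ?c p = ?c q)" by (rule someI[of "\<lambda>q. ?c p = ?c q"]) simp
    then show ?thesis unfolding \<phi>_def using eq by metis
  qed
  have ops: "?c (p + q) = ?c p \<oplus>\<^bsub>quot_field F\<^esub> ?c q" "?c (p * q) = ?c p \<otimes>\<^bsub>quot_field F\<^esub> ?c q" for p q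
    by (simp_all add: pcompose_add pcompose_mult quot_cls_simps)
  have one: "\<one>\<^bsub>quot_field F\<^esub> = ?c 1" by (simp add: quot_cls_simps(3))
  have "\<phi> \<in> ring_hom (quot_field F\<lparr>carrier := range ?c\<rparr>) (quot_field G)"
  proof (rule ring_hom_memI)
    fix x y assume "x \<in> carrier (quot_field F\<lparr>carrier := range ?c\<rparr>)"
    then obtain p where p: "x = ?c p" by auto
    show "\<phi> x \<in> carrier (quot_field G)" by (simp add: p \<phi> quot_cls_carrier)
    assume "y \<in> carrier (quot_field F\<lparr>carrier := range ?c\<rparr>)"
    then obtain q where q: "y = ?c q" by auto
    have "\<phi> (x \<otimes>\<^bsub>quot_field F\<^esub> y) = quot_cls G (p * q)" "\<phi> (x \<oplus>\<^bsub>quot_field F\<^esub> y) = quot_cls G (p + q)"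
      unfolding p q ops[symmetric] by (rule \<phi>)+
    then show "\<phi> (x \<otimes>\<^bsub>quot_field F\<lparr>carrier := range ?c\<rparr>\<^esub> y) = \<phi> x \<otimes>\<^bsub>quot_field G\<^esub> \<phi> y"
      "\<phi> (x \<oplus>\<^bsub>quot_field F\<lparr>carrier := range ?c\<rparr>\<^esub> y) = \<phi> x \<oplus>\<^bsub>quot_field G\<^esub> \<phi> y"
      unfolding p q \<phi> quot_cls_simps by simp_all
  next
    show "\<phi> \<one>\<^bsub>quot_field F\<lparr>carrier := range ?c\<rparr>\<^esub> = \<one>\<^bsub>quot_field G\<^esub>"
      using \<phi>[of 1] by (simp add: one quot_cls_simps(3)[of G])
  qed
  moreover have "bij_betw \<phi> (range ?c) (carrier (quot_field G))"
    unfolding bij_betw_def inj_on_def carrier_quot_field by (auto simp: \<phi> eq image_iff)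
  ultimately have "\<phi> \<in> ring_iso (quot_field F\<lparr>carrier := range ?c\<rparr>) (quot_field G)"
    by (simp add: ring_iso_def)
  moreover have "\<phi> (quot_emb F a) = quot_emb G a" for a
    using \<phi>[of "[:a:]"] by (simp add: quot_emb_eq)
  ultimately show ?thesis unfolding presented_by_def by blast
qed

text \<open>
  Suppose that \<open>u\<close> modulo \<open>F\<close> is algebraic over \<open>K\<close> but not in \<open>K\<close>. It is a constant of the quotient, so its
  minimal polynomial over \<open>k(X\<^sub>I)\<close> has coefficients in \<open>K\<close>; cleared of denominators it becomes a
  polynomial \<open>G\<close> without \<open>X\<^sub>i\<close> that presents the subfield \<open>M\<close> generated by \<open>u\<close>. This subfield is
  nontrivial: were \<open>u\<close> in \<open>k(X\<^sub>I)\<close>, being a constant it would lie in \<open>K\<close>.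
\<close>

lemma cond_I_imp_alg_closed_mod:
  fixes F :: "('i::{finite,linorder}, 'k::field_char_0) mpoly poly"
  assumes irr: "irreducible (fract_poly F)" and I: "cond_I F"
  shows "alg_closed_mod (ratfuns_in (- {i})) (fract_poly F)"
proof (rule ccontr)
  let ?K = "ratfuns_in (- {i}) :: ('i, 'k) ratfun set"
  define d where "d = fract_der (mderiv i :: ('i, 'k) mpoly \<Rightarrow> _)"
  have der: "derivation d" unfolding d_def by (intro derivation_fract_der derivation_mderiv)
  have K: "d c = 0 \<longleftrightarrow> c \<in> ?K" for c unfolding d_def by (rule fract_der_mderiv_eq_0_iff)
  assume "\<not> alg_closed_mod ?K (fract_poly F)"
  then obtain u m where m: "m \<noteq> 0" "\<And>n. coeff m n \<in> ?K" "fract_poly F dvd pcompose m u"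
    and nK: "\<And>c. c \<in> ?K \<Longrightarrow> \<not> fract_poly F dvd u - [:c:]"
    unfolding alg_closed_mod_def by blast
  have "map_poly d m = 0"
    using m(2) K by (intro poly_eqI) (simp add: derivation.coeff_der[OF der])
  then have ham: "fract_poly F dvd ham d (fract_poly F) u"
    using ham_dvd_if_algebraic_over_constants[OF der irr m(1) _ m(3)] by simp
  obtain mp where mp: "is_min_poly (fract_poly F) u mp"
    by (rule min_poly_exists[of "fract_poly F" u]) (use irr in auto)
  have "map_poly d mp = 0" by (rule min_poly_coeffs_constant[OF der irr mp ham])
  then have mpK: "coeff mp n \<in> ?K" for n
    using derivation.coeff_der[OF der, of mp n] K by simp
  let ?S = "{p :: ('i, 'k) mpoly. mpoly_vars p \<subseteq> - {i}}"
  have "\<exists>s c. s \<in> ?S \<and> s \<noteq> 0 \<and> (\<forall>n. coeff c n \<in> ?S) \<and> smult (to_fract s) mp = fract_poly c"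
  proof (rule clear_denominators)
    show "a * b \<in> ?S" if "a \<in> ?S" "b \<in> ?S" for a b
      using that mpoly_vars_mult[of a b] by auto
    show "coeff mp n \<in> fracs_of ?S" for n
      using mpK unfolding ratfuns_in_eq .
  qed auto
  then obtain s G where G: "s \<noteq> 0" "\<And>n. coeff G n \<in> ?S" "fract_poly G = smult (to_fract s) mp" by metis
  define M where "M = range (\<lambda>p. quot_cls F (pcompose p u))"
  have "subfield M (quot_field F)" unfolding M_def by (rule subfield_generated[OF irr mp])
  moreover have "range (quot_emb F) \<subset> M"
  proof
    show "range (quot_emb F) \<subseteq> M"
    proof clarify
      fix a show "quot_emb F a \<in> M"
        unfolding M_def quot_emb_eq by (rule image_eqI[of _ _ "[:a:]"]) simp_all
    qed
    have "quot_cls F u \<in> M" unfolding M_def 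
      by (rule image_eqI[of _ _ "[:0, 1:]"]) (simp_all add: pcompose_pCons)
    moreover have "quot_cls F u \<notin> range (quot_emb F)"
    proof
      assume "quot_cls F u \<in> range (quot_emb F)"
      then obtain a where a: "fract_poly F dvd u - [:a:]" by (auto simp: quot_emb_eq quot_cls_eq_iff)
      interpret W: derivation "ham d (fract_poly F)" by (rule derivation_ham[OF der])
      have "fract_poly F dvd ham d (fract_poly F) u - smult (d a) (pderiv (fract_poly F))"
        using ham_dvd[OF der a] by (simp only: W.der_diff ham_const[OF der])
      then have "fract_poly F dvd smult (d a) (pderiv (fract_poly F))"
        using dvd_diff[OF ham] by fastforce
      then have "d a = 0"
        using irreducible_not_dvd_pderiv[OF irr] dvd_smult_cancel by blast
      then show False using a nK K by blast
    qed
    ultimately show "range (quot_emb F) \<noteq> M" by blast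
  qed
  ultimately have "genuine_extension (quot_field F\<lparr>carrier := M\<rparr>) (quot_emb F)"
    using I unfolding cond_I_def strongly_genuine_extension_def by blast
  moreover have "presented_by (quot_field F\<lparr>carrier := M\<rparr>) (quot_emb F) G"
    unfolding M_def by (rule presented_by_min_poly[OF irr mp G(3)]) (use G(1) in simp)
  ultimately have "degree_in i G \<noteq> 0" unfolding genuine_extension_def by blast
  moreover have "degree_in i G = 0" unfolding degree_in_eq_0_iff using G(2) by auto
  ultimately show False by simp
qed

text \<open>
  Let \<open>\<phi>\<close> identify \<open>M\<close> with the quotient by \<open>G\<close>, where \<open>G\<close> does not involve \<open>X\<^sub>i\<close>, and let \<open>z\<close>, the class of \<open>u\<close>,
  correspond to the class of \<open>Y\<close>. Then \<open>G(u) = 0\<close>, so \<open>z\<close> is algebraic over \<open>K\<close> and hence in \<open>K\<close>; but \<open>z\<close>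
  generates \<open>M\<close>, so \<open>M\<close> would be trivial.
\<close>

lemma cond_I_if_alg_closed_mod:
  fixes F :: "('i::{finite,linorder}, 'k::field_char_0) mpoly poly"
  assumes irr: "irreducible (fract_poly F)"
    and closed: "\<And>i. alg_closed_mod (ratfuns_in (- {i})) (fract_poly F)"
  shows "cond_I F"
  unfolding cond_I_def strongly_genuine_extension_def
proof (intro conjI allI impI)
  interpret Q: field "quot_field F" by (rule field_quot_field[OF irr])
  show "finite_extension_of_ratfun (quot_field F) (quot_emb F)"
    unfolding finite_extension_of_ratfun_def
    using Q.field_axioms quot_emb_hom finite_dimension_quot_field[OF irr] by blast
  fix M assume M: "subfield M (quot_field F) \<and> range (quot_emb F) \<subset> M"
  let ?M = "quot_field F\<lparr>carrier := M\<rparr>"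
  have sub: "subring M (quot_field F)" using M subfieldE(1) by blast
  show "genuine_extension ?M (quot_emb F)"
    unfolding genuine_extension_def
  proof (intro conjI allI impI)
    show "finite_extension_of_ratfun ?M (quot_emb F)"
      using M by (intro finite_extension_subfield[OF irr]) auto
    show "range (quot_emb F) \<noteq> carrier ?M" using M by auto
    fix G i assume "presented_by ?M (quot_emb F) G"
    then obtain \<phi> where \<phi>: "\<phi> \<in> ring_hom ?M (quot_field G)" "bij_betw \<phi> M (carrier (quot_field G))"
      and \<phi>_emb: "\<And>a. \<phi> (quot_emb F a) = quot_emb G a"
      unfolding presented_by_def ring_iso_def by auto
    have \<phi>_ops: "\<phi> (x \<oplus>\<^bsub>quot_field F\<^esub> y) = \<phi> x \<oplus>\<^bsub>quot_field G\<^esub> \<phi> y"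
      "\<phi> (x \<otimes>\<^bsub>quot_field F\<^esub> y) = \<phi> x \<otimes>\<^bsub>quot_field G\<^esub> \<phi> y" if "x \<in> M" "y \<in> M" for x y
      using ring_hom_memE(2,3)[OF \<phi>(1), of x y] that by simp_all
    obtain z where z: "z \<in> M" "\<phi> z = quot_cls G [:0, 1:]"
      using bij_betw_imp_surj_on[OF \<phi>(2)] quot_cls_carrier[of G "[:0, 1:]"] by (metis imageE)
    then obtain u where u: "z = quot_cls F u"
      using subringE(1)[OF sub] unfolding carrier_quot_field by blast
    have pc: "quot_cls F (pcompose p u) \<in> M \<and> \<phi> (quot_cls F (pcompose p u)) = quot_cls G p" for p
    proof (induction p)
      case 0
      have "quot_cls F 0 = quot_emb F 0" "quot_cls G 0 = quot_emb G 0" by (simp_all add: quot_emb_eq)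
      moreover have "quot_emb F 0 \<in> M" using M by blast
      ultimately show ?case using \<phi>_emb by simp
    next
      case (pCons a p)
      have e: "quot_cls F (pcompose (pCons a p) u) = 
          quot_emb F a \<oplus>\<^bsub>quot_field F\<^esub> (z \<otimes>\<^bsub>quot_field F\<^esub> quot_cls F (pcompose p u))"
        by (simp add: pcompose_pCons quot_cls_simps quot_emb_eq u)
      have "pCons a p = [:a:] + [:0, 1:] * p" by simp
      then have "quot_cls G (pCons a p) = quot_emb G a \<oplus>\<^bsub>quot_field G\<^esub> 
          (quot_cls G [:0, 1:] \<otimes>\<^bsub>quot_field G\<^esub> quot_cls G p)"
        by (simp only: quot_cls_simps quot_emb_eq)
      moreover have "quot_emb F a \<in> M" using M by auto
      moreover have "z \<otimes>\<^bsub>quot_field F\<^esub> quot_cls F (pcompose p u) \<in> M"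
        using subringE(6)[OF sub z(1)] pCons.IH by blast
      ultimately show ?case
        unfolding e using pCons.IH z subringE(7)[OF sub] by (simp add: \<phi>_ops \<phi>_emb)
    qed
    have dvd_iff: "fract_poly F dvd pcompose p u \<longleftrightarrow> fract_poly G dvd p" for p
    proof -
      have "quot_cls F (pcompose p u) = quot_cls F (pcompose 0 u) \<longleftrightarrow> quot_cls G p = quot_cls G 0"
        using pc[of p] pc[of 0] bij_betw_imp_inj_on[OF \<phi>(2)] by (metis inj_onD)
      then show ?thesis by (simp add: quot_cls_eq_iff)
    qed
    show "degree_in i G \<noteq> 0"
    proof
      \<comment> \<open>\<open>G\<close> is not zero, since the minimal polynomial of \<open>u\<close> would have to be a multiple of it\<close>
      assume "degree_in i G = 0"
      then have free: "i \<notin> mpoly_vars (coeff G n)" for n by (simp add: degree_in_eq_0_iff)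
      obtain mp where mp: "is_min_poly (fract_poly F) u mp"
        by (rule min_poly_exists[of "fract_poly F" u]) (use irr in auto)
      then have "fract_poly G dvd mp" "mp \<noteq> 0" using dvd_iff by (auto simp: is_min_poly_def)
      then have "fract_poly G \<noteq> 0" by auto
      moreover have "coeff (fract_poly G) n \<in> ratfuns_in (- {i})" for n
      proof -
        have "coeff (fract_poly G) n = Fract (coeff G n) 1" 
          by (simp add: coeff_map_poly) (simp add: to_fract_def)
        then show ?thesis unfolding ratfuns_in_def
          using free[of n] by (intro CollectI exI[of _ "coeff G n"] exI[of _ 1]) auto
      qed
      moreover have "fract_poly F dvd pcompose (fract_poly G) u" using dvd_iff by simp
      ultimately obtain c where c: "fract_poly F dvd u - [:c:]"
        using closed[of i] unfolding alg_closed_mod_def by blast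
      have "M \<subseteq> range (quot_emb F)"
      proof
        fix w assume w: "w \<in> M"
        then have "\<phi> w \<in> carrier (quot_field G)" using bij_betw_imp_surj_on[OF \<phi>(2)] by blast
        then obtain p where "\<phi> w = quot_cls G p" unfolding carrier_quot_field by blast
        then have "w = quot_cls F (pcompose p u)"
          using pc[of p] w bij_betw_imp_inj_on[OF \<phi>(2)] by (metis inj_onD)
        also have "\<dots> = quot_cls F (pcompose p [:c:])"
          unfolding quot_cls_eq_iff by (rule pcompose_dvd_diff[OF c])
        also have "pcompose p [:c:] = [:poly p c:]"
          by (induction p) (simp_all add: pcompose_pCons)
        finally show "w \<in> range (quot_emb F)" by (simp add: quot_emb_eq)
      qed
      with M show False by blast
    qed
  qed
qed

theorem theorem4p2:
  fixes F :: "('i::{finite,linorder}, 'k::field_char_0) mpoly poly"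
    and B :: "nat \<Rightarrow> coeff_form set"
  assumes "number_field TYPE('k)"
    and "2 \<le> card (UNIV :: 'i set)"
    and "\<And>l t. algebraic_int (Poly_Mapping.lookup (Polynomial.coeff F l) t)"
    and "comm_semiring_1_class.irreducible (fract_poly F)"
    and primitive: "\<And>c. [:c:] dvd F \<Longrightarrow> c dvd 1"
    and "\<And>D\<^sub>0. 1 \<le> D\<^sub>0 \<Longrightarrow> noether_forms TYPE('k) D\<^sub>0 (B D\<^sub>0)"
  shows "(cond_I F \<longleftrightarrow> (\<forall>i\<^sub>0. cond_II i\<^sub>0 F)) \<and>
         ((\<forall>i\<^sub>0. cond_II i\<^sub>0 F) \<longleftrightarrow> (\<forall>i\<^sub>0. cond_III i\<^sub>0 F)) \<and>
         ((\<forall>i\<^sub>0. cond_III i\<^sub>0 F) \<longleftrightarrow> (\<forall>i\<^sub>0. cond_IV B i\<^sub>0 F)) \<and>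
         (\<forall>i\<^sub>0. (cond_II i\<^sub>0 F \<longleftrightarrow> cond_III i\<^sub>0 F) \<and> (cond_III i\<^sub>0 F \<longleftrightarrow> cond_IV B i\<^sub>0 F))"
proof -
  have I: "cond_I F \<longleftrightarrow> (\<forall>i\<^sub>0. cond_II i\<^sub>0 F)"
    using cond_I_imp_alg_closed_mod[OF assms(4)] cond_I_if_alg_closed_mod[OF assms(4)]
    unfolding cond_II_iff_alg_closed_mod[OF assms(4)] by blast
  have II: "cond_II i\<^sub>0 F \<longleftrightarrow> cond_III i\<^sub>0 F" for i\<^sub>0
    unfolding cond_II_iff_alg_closed_mod[OF assms(4)]
    by (rule cond_III_iff_alg_closed_mod[OF assms(4) primitive, symmetric])
  have III: "cond_III i\<^sub>0 F \<longleftrightarrow> cond_IV B i\<^sub>0 F" for i\<^sub>0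
    by (rule cond_III_iff_cond_IV[OF assms(4,6)])
  show ?thesis using I II III by simp
qed

end
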